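(* Let $N\ge3$, $0<s<1<p<N$, $\theta\in[s,1]$, and let $\Omega\subset\mathbb{R}^N$ be a bounded domain with smooth boundary containing the origin. If $\mu<\bar\mu(\theta)$, then the functional $\mathcal{I}_\mu:X(\Omega)\to\mathbb{R}$, $$\mathcal{I}_\mu(u):=\frac1p\left(\int_\Omega|\nabla u|^pdx+\iint_{\mathbb{R}^{2N}}\frac{|u(x)-u(y)|^p}{|x-y|^{N+sp}}\,dx\,dy-\mu\int_\Omega\frac{|u|^p}{|x|^{p\theta}}dx\right),$$ is coercive (i.e. $\mathcal{I}_\mu(u)\to\infty$ as $\|u\|_X\to\infty$) and weakly lower semicontinuous on $X(\Omega)$ (i.e. $u_k\rightharpoonup u$ weakly in $X(\Omega)$ implies $\liminf_{k\to\infty}\mathcal{I}_\mu(u_k)\ge\mathcal{I}_\mu(u)$).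
   Context: The space $X(\Omega)$ is the completion of $C_0^\infty(\Omega)$ with respect to the norm $\|u\|_X=\left(\|\nabla u\|_{L^p(\mathbb{R}^N)}^p+[u]_{s,p}^p\right)^{1/p}$, where $[u]_{s,p}^p=\iint_{\mathbb{R}^{2N}}\frac{|u(x)-u(y)|^p}{|x-y|^{N+ps}}\,dx\,dy$; functions in $X(\Omega)$ are regarded as functions on $\mathbb{R}^N$ vanishing a.e. in $\mathbb{R}^N\setminus\Omega$. The constant $\bar\mu(\theta)$ is $$\bar\mu(\theta):=\begin{cases}C_{N,p,s}&\text{if }\theta=s,\\ \min\left\{\frac{C_H(1-s)}{\theta-s},\frac{C_{N,p,s}(1-s)}{1-\theta}\right\}&\text{if }\theta\in(s,1),\\ C_H&\text{if }\theta=1,\end{cases}$$ where $C_H=\left(\frac{N-p}{p}\right)^p$ is the best constant in the Hardy inequality $C_H\int_\Omega\frac{|u|^p}{|x|^p}dx\le\int_\Omega|\nabla u|^p dx$, $u\in W_0^{1,p}(\Omega)$, and $C_{N,p,s}$ is the best constant in the fractional Hardy inequality $C_{N,p,s}\int_{\mathbb{R}^N}\frac{|u|^p}{|x|^{ps}}dx\le\iint_{\mathbb{R}^{2N}}\frac{|u(x)-u(y)|^p}{|x-y|^{N+sp}}\,dx\,dy$, $u\in W^{s,p}(\mathbb{R}^N)$. Explicitly, $C_{N,p,s}=2\int_0^1 t^{ps-1}\left|1-t^{(N-ps)/p}\right|^p\Phi_{N,s,p}(t)\,dt$ with $\Phi_{N,s,p}(t)=|\mathbb{S}^{N-2}|\int_{-1}^1\frac{(1-r^2)^{(N-3)/2}\,dr}{(1-2rt+t^2)^{(N+ps)/2}}$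 for $N\ge2$. *)

theory Defs
  imports "HOL-Analysis.Analysis"
begin

section \<open>Smooth functions, test functions and smooth bounded domains\<close>

definition pderivative :: "'n::finite \<Rightarrow> (real^'n \<Rightarrow> real) \<Rightarrow> real^'n \<Rightarrow> real" where
  "pderivative i f x = frechet_derivative f (at x) (axis i 1)"

primrec C_k :: "nat \<Rightarrow> (real^'n::finite \<Rightarrow> real) \<Rightarrow> bool" where
  "C_k 0 f \<longleftrightarrow> continuous_on UNIV f"
| "C_k (Suc k) f \<longleftrightarrow> (\<forall>x. f differentiable (at x)) \<and> (\<forall>i. C_k k (pderivative i f))"

definition smooth :: "(real^'n::finite \<Rightarrow> real) \<Rightarrow> bool" where
  "smooth f \<longleftrightarrow> (\<forall>k. C_k k f)"

definition C0_infinity :: "(real^'n::finite) set \<Rightarrow> (real^'n \<Rightarrow> real) set" where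
  "C0_infinity \<Omega> =
    {\<phi>. smooth \<phi> \<and> compact (closure {x. \<phi> x \<noteq> 0}) \<and> closure {x. \<phi> x \<noteq> 0} \<subseteq> \<Omega>}"

text \<open>
  The boundary is smooth if, near each of its points, the set lies on one side of the graph of a
  smooth function of the remaining coordinates, for a suitable choice of coordinate axis \<open>i\<close> and
  orientation \<open>\<sigma>\<close>.  A function of the remaining coordinates is evaluated at the point whose
  \<open>i\<close>-th coordinate has been replaced by 0.
\<close>

definition smooth_boundary :: "(real^'n::finite) set \<Rightarrow> bool" where
  "smooth_boundary \<Omega> \<longleftrightarrow>
    (\<forall>x\<in>frontier \<Omega>. \<exists>r>0. \<exists>i. \<exists>\<sigma>\<in>{-1, 1::real}. \<exists>\<gamma>. smooth \<gamma> \<and>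
       \<Omega> \<inter> ball x r = {y \<in> ball x r. \<sigma> * y $ i > \<gamma> (\<chi> j. if j = i then 0 else y $ j)})"

definition smooth_bounded_domain :: "(real^'n::finite) set \<Rightarrow> bool" where
  "smooth_bounded_domain \<Omega> \<longleftrightarrow>
    open \<Omega> \<and> connected \<Omega> \<and> \<Omega> \<noteq> {} \<and> bounded \<Omega> \<and> smooth_boundary \<Omega>"


section \<open>Weak gradients and the Gagliardo seminorm\<close>

definition locally_integrable :: "(real^'n::finite \<Rightarrow> 'b::{banach, second_countable_topology}) \<Rightarrow> bool" where
  "locally_integrable f \<longleftrightarrow> (\<forall>K. compact K \<longrightarrow> set_integrable lborel K f)"

definition has_weak_gradient :: "(real^'n::finite \<Rightarrow> real) \<Rightarrow> (real^'n \<Rightarrow> real^'n) \<Rightarrow> bool" where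
  "has_weak_gradient u g \<longleftrightarrow> locally_integrable u \<and> locally_integrable g \<and>
    (\<forall>\<phi>\<in>C0_infinity UNIV. \<forall>i.
       (LINT x|lborel. u x * pderivative i \<phi> x) = - (LINT x|lborel. g x $ i * \<phi> x))"

text \<open>The weak gradient is unique up to null sets, so the choice below is harmless under integrals.\<close>

definition weak_gradient :: "(real^'n::finite \<Rightarrow> real) \<Rightarrow> real^'n \<Rightarrow> real^'n" where
  "weak_gradient u = (SOME g. has_weak_gradient u g)"

definition gagliardo_integrand ::
    "real \<Rightarrow> real \<Rightarrow> (real^'n::finite \<Rightarrow> real) \<Rightarrow> (real^'n) \<times> (real^'n) \<Rightarrow> real" where
  "gagliardo_integrand p s u =
    (\<lambda>(x, y). \<bar>u x - u y\<bar> powr p / norm (x - y) powr (real CARD('n) + p * s))"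

text \<open>The \<open>p\<close>-th power of the Gagliardo seminorm.\<close>

definition gagliardo :: "real \<Rightarrow> real \<Rightarrow> (real^'n::finite \<Rightarrow> real) \<Rightarrow> real" where
  "gagliardo p s u = (LINT z|(lborel \<Otimes>\<^sub>M lborel). gagliardo_integrand p s u z)"


section \<open>The space \<open>X(\<Omega>)\<close>\<close>

definition X_norm :: "real \<Rightarrow> real \<Rightarrow> (real^'n::finite \<Rightarrow> real) \<Rightarrow> real" where
  "X_norm p s u =
    ((LINT x|lborel. norm (weak_gradient u x) powr p) + gagliardo p s u) powr (1 / p)"

text \<open>
  The completion of \<open>C\<^sub>0\<^sup>\<infinity>(\<Omega>)\<close> is realised as a space of functions on the whole space: the closure
  of \<open>C\<^sub>0\<^sup>\<infinity>(\<Omega>)\<close>, with respect to the norm, among the weakly differentiable functions of finite norm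
  that vanish a.e. outside \<open>\<Omega>\<close>.  (For bounded \<open>\<Omega>\<close> and \<open>p > 1\<close>, Poincare's inequality makes this
  closure complete.)  Elements are Borel representatives; functions that agree a.e. represent the same
  element, so the norm is only a seminorm on representatives.  The integrability conditions
  matter because Bochner integrals of non-integrable functions are 0.
\<close>

definition X_space :: "real \<Rightarrow> real \<Rightarrow> (real^'n::finite) set \<Rightarrow> (real^'n \<Rightarrow> real) set" where
  "X_space p s \<Omega> = {u.
     u \<in> borel_measurable borel \<and>
     (AE x in lborel. x \<notin> \<Omega> \<longrightarrow> u x = 0) \<and>
     (\<exists>g. has_weak_gradient u g) \<and>
     integrable lborel (\<lambda>x. norm (weak_gradient u x) powr p) \<and>
     integrable (lborel \<Otimes>\<^sub>M lborel) (gagliardo_integrand p s u) \<and>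
     (\<exists>\<phi>. (\<forall>k. \<phi> k \<in> C0_infinity \<Omega>) \<and>
          (\<lambda>k. X_norm p s (\<lambda>x. u x - \<phi> k x)) \<longlonglongrightarrow> 0)}"

text \<open>
  Bounded linear functionals on \<open>X(\<Omega>)\<close>.  Boundedness forces them to depend only on the a.e. class.
\<close>

definition X_dual ::
    "real \<Rightarrow> real \<Rightarrow> (real^'n::finite) set \<Rightarrow> ((real^'n \<Rightarrow> real) \<Rightarrow> real) set" where
  "X_dual p s \<Omega> = {F.
     (\<forall>u\<in>X_space p s \<Omega>. \<forall>v\<in>X_space p s \<Omega>. F (\<lambda>x. u x + v x) = F u + F v) \<and>
     (\<forall>c. \<forall>u\<in>X_space p s \<Omega>. F (\<lambda>x. c * u x) = c * F u) \<and>
     (\<exists>C. \<forall>u\<in>X_space p s \<Omega>. \<bar>F u\<bar> \<le> C * X_norm p s u)}"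

definition X_weakly_converges ::
    "real \<Rightarrow> real \<Rightarrow> (real^'n::finite) set \<Rightarrow> (nat \<Rightarrow> real^'n \<Rightarrow> real) \<Rightarrow> (real^'n \<Rightarrow> real) \<Rightarrow> bool" where
  "X_weakly_converges p s \<Omega> U u \<longleftrightarrow>
     (\<forall>k. U k \<in> X_space p s \<Omega>) \<and> u \<in> X_space p s \<Omega> \<and>
     (\<forall>F\<in>X_dual p s \<Omega>. (\<lambda>k. F (U k)) \<longlonglongrightarrow> F u)"

definition X_coercive ::
    "real \<Rightarrow> real \<Rightarrow> (real^'n::finite) set \<Rightarrow> ((real^'n \<Rightarrow> real) \<Rightarrow> real) \<Rightarrow> bool" where
  "X_coercive p s \<Omega> J \<longleftrightarrow>
     (\<forall>B. \<exists>R. \<forall>u\<in>X_space p s \<Omega>. R \<le> X_norm p s u \<longrightarrow> B \<le> J u)"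

definition X_weakly_lsc ::
    "real \<Rightarrow> real \<Rightarrow> (real^'n::finite) set \<Rightarrow> ((real^'n \<Rightarrow> real) \<Rightarrow> real) \<Rightarrow> bool" where
  "X_weakly_lsc p s \<Omega> J \<longleftrightarrow>
     (\<forall>U u. X_weakly_converges p s \<Omega> U u \<longrightarrow>
        ereal (J u) \<le> liminf (\<lambda>k. ereal (J (U k))))"


section \<open>The Hardy constants\<close>

definition hardy_const :: "'n::finite itself \<Rightarrow> real \<Rightarrow> real" where
  "hardy_const _ p = ((real CARD('n) - p) / p) powr p"

definition frac_sobolev :: "real \<Rightarrow> real \<Rightarrow> (real^'n::finite \<Rightarrow> real) set" where
  "frac_sobolev p s = {u.
     u \<in> borel_measurable borel \<and>
     integrable lborel (\<lambda>x. \<bar>u x\<bar> powr p) \<and>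
     integrable (lborel \<Otimes>\<^sub>M lborel) (gagliardo_integrand p s u)}"

text \<open>
  The best constant in the fractional Hardy inequality on \<open>W\<^sup>s\<^sup>,\<^sup>p\<close>, whose closed form is the
  Frank-Seiringer formula.  The weighted integral is taken in \<open>[0,\<infinity>]\<close>, so that a divergent
  integral violates the inequality for every positive constant.
\<close>

definition frac_hardy_const :: "'n::finite itself \<Rightarrow> real \<Rightarrow> real \<Rightarrow> real" where
  "frac_hardy_const _ p s = Sup {C. 0 \<le> C \<and>
     (\<forall>u\<in>(frac_sobolev p s :: (real^'n \<Rightarrow> real) set).
        ennreal C * (\<integral>\<^sup>+x. ennreal (\<bar>u x\<bar> powr p / norm x powr (p * s)) \<partial>lborel)
          \<le> ennreal (gagliardo p s u))}"

definition mu_bar :: "'n::finite itself \<Rightarrow> real \<Rightarrow> real \<Rightarrow> real \<Rightarrow> real" where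
  "mu_bar N p s \<theta> =
    (if \<theta> = s then frac_hardy_const N p s
     else if \<theta> = 1 then hardy_const N p
     else min (hardy_const N p * (1 - s) / (\<theta> - s)) (frac_hardy_const N p s * (1 - s) / (1 - \<theta>)))"


section \<open>The functional\<close>

definition I_functional ::
    "real \<Rightarrow> real \<Rightarrow> real \<Rightarrow> (real^'n::finite) set \<Rightarrow> real \<Rightarrow> (real^'n \<Rightarrow> real) \<Rightarrow> real" where
  "I_functional p s \<theta> \<Omega> \<mu> u = 1 / p *
     ((LINT x:\<Omega>|lborel. norm (weak_gradient u x) powr p)
      + gagliardo p s u
      - \<mu> * (LINT x:\<Omega>|lborel. \<bar>u x\<bar> powr p / norm x powr (p * \<theta>)))"

end

theory Submission
  imports Defs
begin

text \<open>
  Coercivity is the Hardy inequality: the weight \<open>\<bar>x\<bar>\<^sup>-\<^sup>p\<^sup>\<theta>\<close> is at most a convex combination of the weights for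
  \<open>\<theta> = 1\<close> and \<open>\<theta> = s\<close>, and the local and the fractional Hardy inequality bound the two parts by the local and the
  nonlocal energy.  The sharp local inequality comes from \<open>\<phi> (T x) - \<phi> x = \<integral> grad \<phi> (t x) \<bullet> x dt\<close> over \<open>[1, T]\<close>,
  Jensen's inequality with the weight \<open>t\<^sup>-\<^sup>N\<^sup>/\<^sup>p\<close> and a dilation; since \<open>T\<close> is finite, it also gives a version on small
  balls with a remainder that vanishes as \<open>T\<close> grows.

  For weak lower semicontinuity, coercivity allows one to assume that the sequence is bounded.  Both energies
  are weakly lower semicontinuous by convexity.  Ball averages converge pointwise along the sequence, and the
  Gagliardo seminorm controls the distance to them, so the sequence converges in \<open>L\<^sup>p\<close> and the weighted
  term converges away from the origin.  In a small ball around the origin the weighted term cannot exceed the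
  gradient energy in a slightly larger ball by more than a small error, and that gradient energy is dropped.
\<close>

section \<open>Power inequalities and $L^p$ functions\<close>

text \<open>For \<theta> = 1 the weight scales exactly like the gradient energy, so the weighted
  term is not weakly continuous: a sequence that concentrates at the origin can keep a fixed amount
  of it while tending weakly to 0. Lower semicontinuity can then come only from comparing this
  amount with the gradient energy that concentrates along with it, and there it matters that \<mu>
  lies below the Hardy constant. For \<theta> < 1 the weight is of lower order at the origin, so the
  bound on \<mu> enters only through coercivity, that is, through the boundedness of the sequence.

  The exponent \<open>N / p\<close> is the balanced one in Jensen's inequality. Jensen with the
  weight \<open>t powr (- a)\<close> leaves the factor \<open>t powr (a * (p - 1))\<close>, the
  dilation by \<open>t\<close> contributes \<open>t powr (- N)\<close>, and for
  \<open>a = N / p\<close> the product is again \<open>t powr (- a)\<close>. Hence the constant is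
  the p-th power of the integral of the weight, which is less than
  \<open>p / (N - p)\<close>.\<close>

lemma powr_tangent:
  fixes a m p :: real
  assumes "1 < p" "0 \<le> a" "0 \<le> m"
  shows "m powr p + p * (m powr (p - 1) * (a - m)) \<le> a powr p"
proof -
  define q where "q = p / (p - 1)"
  have q: "q > 1" "1 / p + 1 / q = 1" "1 / q = (p - 1) / p"
    using assms by (auto simp: q_def field_simps)
  have "a * m powr (p - 1) \<le> a powr p / p + (m powr (p - 1)) powr q / q"
    using assms q by (intro Youngs_inequality) auto
  also have "(m powr (p - 1)) powr q = m powr p"
    using assms by (simp add: powr_powr q_def)
  also have "m powr p / q = m powr p * ((p - 1) / p)"
    using q(3) by (metis times_divide_eq_right mult.right_neutral)
  finally have "p * (a * m powr (p - 1)) \<le> a powr p + (p - 1) * m powr p"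
    using assms by (simp add: field_simps)
  moreover have "m powr (p - 1) * m = m powr p"
    using assms by (cases "m = 0") (auto simp: powr_diff)
  ultimately show ?thesis by (simp add: algebra_simps)
qed

text \<open>The supporting hyperplane of the p-th power of the norm at \<open>a\<close>;
  Cauchy-Schwarz reduces it to the scalar case. Integrated, it bounds an energy from below by an
  affine functional, which is the source of weak lower semicontinuity.\<close>

lemma norm_powr_tangent:
  fixes a b :: "'b::real_inner"
  assumes "1 < p"
  shows "norm a powr p + p * (norm a powr (p - 2) * inner a b - norm a powr p) \<le> norm b powr p"
proof -
  have "norm a powr (p - 2) * inner a b \<le> norm a powr (p - 2) * (norm a * norm b)"
    by (intro mult_left_mono norm_cauchy_schwarz) auto
  also have "\<dots> = norm a powr (p - 1) * norm b"
  proof (cases "a = 0")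
    case False
    have "norm a powr (p - 1) = norm a powr (p - 2 + 1)" by simp
    also have "\<dots> = norm a powr (p - 2) * norm a" using False by (subst powr_add) auto
    finally show ?thesis by simp
  qed auto
  finally have 1: "norm a powr (p - 2) * inner a b \<le> norm a powr (p - 1) * norm b" .
  have 2: "norm a powr p = norm a powr (p - 1) * norm a"
    by (cases "a = 0") (auto simp: powr_diff)
  have "norm a powr p + p * (norm a powr (p - 2) * inner a b - norm a powr p) \<le>
     norm a powr p + p * (norm a powr (p - 1) * (norm b - norm a))"
    using 1 2 assms by (intro add_left_mono mult_left_mono) (auto simp: algebra_simps)
  also have "\<dots> \<le> norm b powr p" using powr_tangent[OF assms, of "norm b" "norm a"] by simp
  finally show ?thesis .
qed

text \<open>Replacing the smaller of the two norms by the larger one gives this crude Young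
  inequality. It makes the pairing integrable; the missing homogeneity is restored by scaling in
  \<open>Lp_pairing_bound\<close>.\<close>

lemma norm_powr_inner_le:
  fixes a b :: "'b::real_inner"
  assumes "1 < p"
  shows "\<bar>norm a powr (p - 2) * inner a b\<bar> \<le> norm a powr p + norm b powr p"
proof (cases "a = 0")
  case False
  have "\<bar>norm a powr (p - 2) * inner a b\<bar> \<le> norm a powr (p - 2) * (norm a * norm b)"
    by (auto simp: abs_mult intro!: mult_left_mono Cauchy_Schwarz_ineq2)
  also have "\<dots> = norm a powr (p - 2 + 1) * norm b" using False by (subst powr_add) auto
  also have "\<dots> \<le> norm a powr p + norm b powr p"
  proof (cases "norm b \<le> norm a")
    case True
    have "norm a powr (p - 2 + 1) * norm b \<le> norm a powr (p - 1) * norm a"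
      using True by (simp add: mult_left_mono)
    also have "\<dots> = norm a powr p" using False by (simp add: powr_diff)
    finally show ?thesis by simp (smt (verit) powr_ge_zero)
  next
    case *: False
    have "norm a powr (p - 2 + 1) * norm b \<le> norm b powr (p - 1) * norm b"
      using * assms by (intro mult_right_mono) (auto intro!: powr_mono2)
    also have "\<dots> = norm b powr p" using * by (cases "b = 0") (auto simp: powr_diff)
    finally show ?thesis by simp (smt (verit) powr_ge_zero)
  qed
  finally show ?thesis .
qed auto

text \<open>Convexity of the p-th power for
  \<open>x + y = (1 - l) * (x / (1 - l)) + l * (y / l)\<close>. The point is the free parameter: as
  \<open>l\<close> tends to 0 the factor of \<open>x\<close> tends to 1, so a small summand
  \<open>y\<close> disturbs the leading term as little as desired.\<close>

lemma powr_add_split: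
  fixes x y p l :: real
  assumes "1 < p" "0 < l" "l < 1" "0 \<le> x" "0 \<le> y"
  shows "(x + y) powr p \<le> (1 - l) powr (1 - p) * x powr p + l powr (1 - p) * y powr p"
proof -
  have h: "c * (m powr p + p * (m powr (p - 1) * (z / c - m))) \<le> c powr (1 - p) * z powr p"
    if "0 < c" "0 \<le> z" "0 \<le> m" for c z m :: real
  proof -
    have "c * (m powr p + p * (m powr (p - 1) * (z / c - m))) \<le> c * (z / c) powr p"
      using that assms by (intro mult_left_mono powr_tangent) auto
    also have "\<dots> = c powr (1 - p) * z powr p"
      using that by (simp add: powr_divide powr_diff)
    finally show ?thesis .
  qed
  \<comment> \<open>Both tangents are taken at the sum, so that their linear parts cancel in
    \<open>eq\<close>.\<close>
  define m where "m = x + y"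
  have eq: "(1 - l) * (m powr p + p * (m powr (p - 1) * (x / (1 - l) - m))) +
      l * (m powr p + p * (m powr (p - 1) * (y / l - m))) = m powr p"
  proof -
    have "(1 - l) * (x / (1 - l)) = x" "l * (y / l) = y" using assms by auto
    then have "(1 - l) * (x / (1 - l) - m) + l * (y / l - m) = 0"
      by (auto simp: m_def algebra_simps)
    moreover have "(1 - l) * (m powr p + p * (m powr (p - 1) * (x / (1 - l) - m))) +
      l * (m powr p + p * (m powr (p - 1) * (y / l - m))) =
      m powr p + p * m powr (p - 1) * ((1 - l) * (x / (1 - l) - m) + l * (y / l - m))"
      by (simp add: algebra_simps)
    ultimately show ?thesis by simp
  qed
  show ?thesis
    using h[of "1 - l" x m] h[of l y m] assms eq unfolding m_def by force
qed

lemma norm_add_powr_split: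
  fixes x y :: "'b::real_normed_vector"
  assumes "1 < p" "0 < l" "l < 1"
  shows "norm (x + y) powr p \<le> (1 - l) powr (1 - p) * norm x powr p + l powr (1 - p) * norm y powr p"
proof -
  have "norm (x + y) powr p \<le> (norm x + norm y) powr p"
    using assms by (intro powr_mono2 norm_triangle_ineq) auto
  then show ?thesis using powr_add_split[OF assms, of "norm x" "norm y"] by force
qed

section \<open>Membership in L^p, the duality pairing, and Jensen's inequality\<close>

definition in_Lp :: "real \<Rightarrow> 'a measure \<Rightarrow> ('a \<Rightarrow> 'b::euclidean_space) \<Rightarrow> bool" where
  "in_Lp p M f \<longleftrightarrow> f \<in> borel_measurable M \<and> integrable M (\<lambda>x. norm (f x) powr p)"

text \<open>Kept as a p-th power because both energies and the weighted term have this form.\<close>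

definition Lp_pow :: "real \<Rightarrow> 'a measure \<Rightarrow> ('a \<Rightarrow> 'b::euclidean_space) \<Rightarrow> real" where
  "Lp_pow p M f = (LINT x|M. norm (f x) powr p)"

lemma Lp_pow_nonneg [simp]: "0 \<le> Lp_pow p M f"
  by (auto simp: Lp_pow_def)

lemma in_LpD:
  assumes "in_Lp p M f"
  shows "f \<in> borel_measurable M" "integrable M (\<lambda>x. norm (f x) powr p)"
  using assms by (auto simp: in_Lp_def)

lemma in_Lp_cong_AE:
  assumes "in_Lp p M f" "g \<in> borel_measurable M" "AE x in M. f x = g x"
  shows "in_Lp p M g"
proof -
  have [measurable]: "g \<in> borel_measurable M" "f \<in> borel_measurable M" using assms by (auto simp: in_Lp_def)
  show ?thesis
    unfolding in_Lp_def
    using assms by (auto intro!: integrable_cong_AE_imp[OF in_LpD(2)[OF assms(1)]])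
qed

lemma in_Lp_bounded:
  assumes "in_Lp p M g" "f \<in> borel_measurable M" "AE x in M. norm (f x) \<le> norm (g x)" "1 < p"
  shows "in_Lp p M f" "Lp_pow p M f \<le> Lp_pow p M g"
proof -
  have [measurable]: "f \<in> borel_measurable M" by fact
  have ae: "AE x in M. norm (f x) powr p \<le> norm (g x) powr p"
    using assms(3) by eventually_elim (use assms in \<open>auto intro!: powr_mono2\<close>)
  have int: "integrable M (\<lambda>x. norm (f x) powr p)"
    using in_LpD(2)[OF assms(1)] by (rule Bochner_Integration.integrable_bound) (use ae in auto)
  then show "in_Lp p M f" using assms by (auto simp: in_Lp_def)
  show "Lp_pow p M f \<le> Lp_pow p M g" unfolding Lp_pow_def
    using int in_LpD(2)[OF assms(1)] ae by (rule integral_mono_AE)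
qed

lemma in_Lp_scaleR:
  assumes "in_Lp p M f"
  shows "in_Lp p M (\<lambda>x. c *\<^sub>R f x)" "Lp_pow p M (\<lambda>x. c *\<^sub>R f x) = \<bar>c\<bar> powr p * Lp_pow p M f"
  using in_LpD[OF assms] by (auto simp: in_Lp_def Lp_pow_def powr_mult)

lemma in_Lp_add:
  assumes "in_Lp p M f" "in_Lp p M g" "1 < p"
  shows "in_Lp p M (\<lambda>x. f x + g x)"
    and "\<And>l. 0 < l \<Longrightarrow> l < 1 \<Longrightarrow> Lp_pow p M (\<lambda>x. f x + g x) \<le>
       (1 - l) powr (1 - p) * Lp_pow p M f + l powr (1 - p) * Lp_pow p M g"
proof -
  note f = in_LpD[OF assms(1)] and g = in_LpD[OF assms(2)]
  have [measurable]: "f \<in> borel_measurable M" "g \<in> borel_measurable M" using f g by auto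
  have b: "integrable M (\<lambda>x. (1 - l) powr (1 - p) * norm (f x) powr p + l powr (1 - p) * norm (g x) powr p)" for l
    using f g by auto
  have int: "integrable M (\<lambda>x. norm (f x + g x) powr p)"
    by (rule Bochner_Integration.integrable_bound[OF b[of "1/2"]])
       (use norm_add_powr_split[OF assms(3), of "1/2"] in force)+
  then show "in_Lp p M (\<lambda>x. f x + g x)" by (auto simp: in_Lp_def)
  fix l :: real assume l: "0 < l" "l < 1"
  have "Lp_pow p M (\<lambda>x. f x + g x) \<le> (LINT x|M. (1 - l) powr (1 - p) * norm (f x) powr p + l powr (1 - p) * norm (g x) powr p)"
    unfolding Lp_pow_def by (intro integral_mono int b norm_add_powr_split l assms)
  then show "Lp_pow p M (\<lambda>x. f x + g x) \<le>
       (1 - l) powr (1 - p) * Lp_pow p M f + l powr (1 - p) * Lp_pow p M g"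
    using f g by (simp add: Lp_pow_def)
qed

lemma in_Lp_diff:
  assumes "in_Lp p M f" "in_Lp p M g" "1 < p"
  shows "in_Lp p M (\<lambda>x. f x - g x)"
    and "Lp_pow p M (\<lambda>x. f x - g x) \<le> 2 powr p * (Lp_pow p M f + Lp_pow p M g)"
proof -
  have g: "in_Lp p M (\<lambda>x. (-1) *\<^sub>R g x)" "Lp_pow p M (\<lambda>x. (-1) *\<^sub>R g x) = Lp_pow p M g"
    using in_Lp_scaleR[OF assms(2), of "-1"] by auto
  show "in_Lp p M (\<lambda>x. f x - g x)" using in_Lp_add(1)[OF assms(1) g(1) assms(3)] by simp
  have "Lp_pow p M (\<lambda>x. f x - g x) \<le> (1/2) powr (1 - p) * (Lp_pow p M f + Lp_pow p M g)"
    using in_Lp_add(2)[OF assms(1) g(1) assms(3), of "1/2"] g(2) by (simp add: algebra_simps)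
  also have "(1/2::real) powr (1 - p) \<le> 2 powr p"
    by (simp add: powr_divide powr_diff)
  finally show "Lp_pow p M (\<lambda>x. f x - g x) \<le> 2 powr p * (Lp_pow p M f + Lp_pow p M g)"
    by (simp add: mult_right_mono)
qed

text \<open>The split inequality is used in both directions, for \<open>F k = f + (F k - f)\<close>
  and for \<open>f = F k - (F k - f)\<close>. First \<open>l\<close> is fixed so small that
  \<open>(1 - l) powr (1 - p)\<close> is harmless; the large factor \<open>l powr (1 - p)\<close>
  then multiplies a null sequence.\<close>

lemma Lp_conv_pow:
  assumes p: "1 < p" and F: "\<And>k. in_Lp p M (F k)" and f: "in_Lp p M f"
    and lim: "(\<lambda>k. Lp_pow p M (\<lambda>x. F k x - f x)) \<longlonglongrightarrow> 0"
  shows "(\<lambda>k. Lp_pow p M (F k)) \<longlonglongrightarrow> Lp_pow p M f"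
proof -
  define e where "e k = Lp_pow p M (\<lambda>x. F k x - f x)" for k
  define A where "A k = Lp_pow p M (F k)" for k
  define a where "a = Lp_pow p M f"
  have d: "in_Lp p M (\<lambda>x. F k x - f x)" for k by (rule in_Lp_diff[OF F f p])
  have d': "in_Lp p M (\<lambda>x. (-1) *\<^sub>R (F k x - f x))" "Lp_pow p M (\<lambda>x. (-1) *\<^sub>R (F k x - f x)) = e k" for k
    using in_Lp_scaleR[OF d, of "-1"] by (auto simp: e_def)
  have up: "A k \<le> (1 - l) powr (1 - p) * a + l powr (1 - p) * e k" if "0 < l" "l < 1" for l k
    using in_Lp_add(2)[OF f d p that] by (simp add: A_def a_def e_def)
  have lo: "a \<le> (1 - l) powr (1 - p) * A k + l powr (1 - p) * e k" if "0 < l" "l < 1" for l k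
  proof -
    have "(\<lambda>x. F k x + (-1) *\<^sub>R (F k x - f x)) = f" by (auto simp: algebra_simps)
    then show ?thesis
      using in_Lp_add(2)[OF F d'(1) p that, of k k] d'(2)[of k]
      by (simp add: A_def a_def e_def)
  qed
  have e0: "e \<longlonglongrightarrow> 0" using lim by (simp add: e_def[abs_def])
  have c1: "((\<lambda>l. (1 - l) powr (1 - p) * z) \<longlongrightarrow> z) (at_right 0)" for z :: real
    by (rule tendsto_eq_intros | simp)+
  have small: "eventually (\<lambda>l::real. 0 < l \<and> l < 1) (at_right 0)"
    using eventually_at_right_less by (auto simp: eventually_at_right[of 0 1] intro: exI[of _ 1])
  have "A \<longlonglongrightarrow> a"
  proof (rule order_tendstoI)
    fix c assume "a < c"
    then have "eventually (\<lambda>l. (1 - l) powr (1 - p) * a < c) (at_right 0)"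
      using order_tendstoD(2)[OF c1] by blast
    then obtain l where l: "0 < l" "l < 1" "(1 - l) powr (1 - p) * a < c"
      using eventually_happens'[OF trivial_limit_at_right_real eventually_conj[OF small]] by blast
    have "(\<lambda>k. (1 - l) powr (1 - p) * a + l powr (1 - p) * e k) \<longlonglongrightarrow> (1 - l) powr (1 - p) * a + l powr (1 - p) * 0"
      by (intro tendsto_intros e0)
    then have "eventually (\<lambda>k. (1 - l) powr (1 - p) * a + l powr (1 - p) * e k < c) sequentially"
      by (rule order_tendstoD) (use l in simp)
    then show "eventually (\<lambda>k. A k < c) sequentially"
      by eventually_elim (use up[OF l(1,2)] in \<open>auto intro: le_less_trans\<close>)
  next
    fix c assume "c < a"
    then have "eventually (\<lambda>l. (1 - l) powr (1 - p) * c < a) (at_right 0)"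
      using order_tendstoD(2)[OF c1] by blast
    then obtain l where l: "0 < l" "l < 1" "(1 - l) powr (1 - p) * c < a"
      using eventually_happens'[OF trivial_limit_at_right_real eventually_conj[OF small]] by blast
    have "(\<lambda>k. (1 - l) powr (1 - p) * c + l powr (1 - p) * e k) \<longlonglongrightarrow> (1 - l) powr (1 - p) * c + l powr (1 - p) * 0"
      by (intro tendsto_intros e0)
    then have "eventually (\<lambda>k. (1 - l) powr (1 - p) * c + l powr (1 - p) * e k < a) sequentially"
      by (rule order_tendstoD) (use l in simp)
    then show "eventually (\<lambda>k. c < A k) sequentially"
    proof eventually_elim
      case (elim k)
      then have "(1 - l) powr (1 - p) * c < (1 - l) powr (1 - p) * A k" using lo[OF l(1,2), of k] by linarith
      then show ?case using l by (simp add: mult_less_cancel_left)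
    qed
  qed
  then show ?thesis by (simp add: A_def[abs_def] a_def)
qed

text \<open>Up to the factor \<open>p\<close>, the derivative of \<open>Lp_pow p M\<close> at
  \<open>G\<close> in the direction \<open>V\<close>. For fixed \<open>G\<close> it is linear in
  \<open>V\<close>, which makes it the supply of bounded functionals for testing weak
  convergence.\<close>

definition Lp_pairing :: "real \<Rightarrow> 'a measure \<Rightarrow> ('a \<Rightarrow> 'b::euclidean_space) \<Rightarrow> ('a \<Rightarrow> 'b) \<Rightarrow> real" where
  "Lp_pairing p M G V = (LINT x|M. norm (G x) powr (p - 2) * inner (G x) (V x))"

lemma Lp_pairing_integrable:
  assumes "in_Lp p M G" "in_Lp p M V" "1 < p"
  shows "integrable M (\<lambda>x. norm (G x) powr (p - 2) * inner (G x) (V x))"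
proof -
  note [measurable] = in_LpD(1)[OF assms(1)] in_LpD(1)[OF assms(2)]
  have "integrable M (\<lambda>x. norm (G x) powr p + norm (V x) powr p)"
    using in_LpD(2)[OF assms(1)] in_LpD(2)[OF assms(2)] by auto
  then show ?thesis
    by (rule Bochner_Integration.integrable_bound) (use norm_powr_inner_le[OF assms(3)] in auto)
qed

lemma Lp_pairing_tangent:
  assumes "in_Lp p M G" "in_Lp p M V" "1 < p"
  shows "Lp_pow p M G + p * (Lp_pairing p M G V - Lp_pairing p M G G) \<le> Lp_pow p M V"
proof -
  have G: "norm (G x) powr (p - 2) * inner (G x) (G x) = norm (G x) powr p" for x
    using assms(3) by (cases "G x = 0") (auto simp: dot_square_norm powr_diff powr_numeral power2_eq_square)
  have "(LINT x|M. norm (G x) powr p + p * (norm (G x) powr (p - 2) * inner (G x) (V x) - norm (G x) powr p)) \<le> Lp_pow p M V"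
    unfolding Lp_pow_def using in_LpD(2)[OF assms(1)] in_LpD(2)[OF assms(2)]
    by (intro integral_mono norm_powr_tangent assms Bochner_Integration.integrable_add integrable_mult_right
       Bochner_Integration.integrable_diff Lp_pairing_integrable)
  also have "(LINT x|M. norm (G x) powr p + p * (norm (G x) powr (p - 2) * inner (G x) (V x) - norm (G x) powr p)) =
     Lp_pow p M G + p * (Lp_pairing p M G V - Lp_pow p M G)"
    using in_LpD(2)[OF assms(1)] Lp_pairing_integrable[OF assms]
    by (simp add: Lp_pow_def Lp_pairing_def)
  finally show ?thesis by (simp add: Lp_pairing_def G flip: Lp_pow_def)
qed

text \<open>A Hoelder-type bound without the dual exponent: the inhomogeneous estimate
  \<open>b\<close> is applied to \<open>V\<close> scaled to norm 1, whence the summand 1 in the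
  constant. If the norm of \<open>V\<close> is 0, then \<open>V\<close> vanishes a.e. and so does
  the pairing.\<close>

lemma Lp_pairing_bound:
  assumes "in_Lp p M G" "in_Lp p M V" "1 < p"
  shows "\<bar>Lp_pairing p M G V\<bar> \<le> (Lp_pow p M G + 1) * Lp_pow p M V powr (1 / p)"
proof -
  have b: "\<bar>Lp_pairing p M G W\<bar> \<le> Lp_pow p M G + Lp_pow p M W" if "in_Lp p M W" for W
  proof -
    have "\<bar>Lp_pairing p M G W\<bar> \<le> (LINT x|M. norm (G x) powr p + norm (W x) powr p)"
      unfolding Lp_pairing_def
      using in_LpD(2)[OF assms(1)] in_LpD(2)[OF that] norm_powr_inner_le[OF assms(3)]
      by (intro integral_abs_bound[THEN order_trans] integral_mono)
         (auto intro!: Lp_pairing_integrable assms that)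
    then show ?thesis using in_LpD(2)[OF assms(1)] in_LpD(2)[OF that] by (simp add: Lp_pow_def)
  qed
  show ?thesis
  proof (cases "Lp_pow p M V = 0")
    case True
    then have "AE x in M. V x = 0"
      using in_LpD(2)[OF assms(2)] assms(3) unfolding Lp_pow_def
      by (subst (asm) integral_nonneg_eq_0_iff_AE) auto
    then have "Lp_pairing p M G V = 0"
      unfolding Lp_pairing_def by (intro integral_eq_zero_AE) auto
    then show ?thesis by simp
  next
    case False
    then have pos: "Lp_pow p M V > 0" using Lp_pow_nonneg[of p M V] by linarith
    define r where "r = Lp_pow p M V powr (1 / p)"
    have r: "r > 0" "r powr p = Lp_pow p M V" using pos assms(3) by (auto simp: r_def powr_powr)
    have "\<bar>Lp_pairing p M G (\<lambda>x. (1/r) *\<^sub>R V x)\<bar> \<le> Lp_pow p M G + \<bar>1/r\<bar> powr p * Lp_pow p M V"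
      using b[OF in_Lp_scaleR(1)[OF assms(2), of "1/r"]] in_Lp_scaleR(2)[OF assms(2), of "1/r"] by simp
    also have "\<bar>1/r\<bar> powr p * Lp_pow p M V = 1" using r pos by (simp add: powr_divide)
    also have "Lp_pairing p M G (\<lambda>x. (1/r) *\<^sub>R V x) = Lp_pairing p M G V / r"
      by (simp add: Lp_pairing_def)
    finally have "\<bar>Lp_pairing p M G V\<bar> / r \<le> Lp_pow p M G + 1" using r by (simp add: abs_div)
    then show ?thesis using r by (simp add: field_simps r_def)
  qed
qed

text \<open>Jensen's inequality for \<open>f / w\<close> and the measure with density
  \<open>w\<close>. The tangent of the p-th power at the mean \<open>m\<close> is multiplied by
  \<open>w\<close> and integrated; its linear part integrates to 0. Since division by 0 yields 0,
  the assumption \<open>fw\<close> is what makes \<open>w x * (f x / w x) = f x\<close> hold where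
  the weight vanishes.\<close>

lemma jensen_powr:
  fixes f w :: "'a \<Rightarrow> real"
  assumes p: "1 < p" and w: "integrable M w" "\<And>x. 0 \<le> w x" and f: "integrable M f"
    and fw: "\<And>x. w x = 0 \<Longrightarrow> f x = 0"
    and fp: "integrable M (\<lambda>x. w x * (\<bar>f x\<bar> / w x) powr p)"
    and pos: "0 < (LINT x|M. w x)"
  shows "\<bar>LINT x|M. f x\<bar> powr p \<le> (LINT x|M. w x) powr (p - 1) * (LINT x|M. w x * (\<bar>f x\<bar> / w x) powr p)"
proof -
  define W where "W = (LINT x|M. w x)"
  define I where "I = (LINT x|M. \<bar>f x\<bar>)"
  define m where "m = I / W"
  have W: "W > 0" using pos by (simp add: W_def)
  have I: "I \<ge> 0" by (auto simp: I_def)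
  have m: "m \<ge> 0" using I W by (simp add: m_def)
  have pt: "m powr p * w x + p * m powr (p - 1) * (\<bar>f x\<bar> - m * w x) \<le> w x * (\<bar>f x\<bar> / w x) powr p" for x
  proof -
    have "w x * (m powr p + p * (m powr (p - 1) * (\<bar>f x\<bar> / w x - m))) \<le> w x * (\<bar>f x\<bar> / w x) powr p"
      using w(2)[of x] p m by (intro mult_left_mono powr_tangent) auto
    also have "w x * (m powr p + p * (m powr (p - 1) * (\<bar>f x\<bar> / w x - m))) =
       m powr p * w x + p * m powr (p - 1) * (\<bar>f x\<bar> - m * w x)"
      using fw[of x] by (cases "w x = 0") (auto simp: field_simps)
    finally show ?thesis .
  qed
  have "(LINT x|M. m powr p * w x + p * m powr (p - 1) * (\<bar>f x\<bar> - m * w x)) \<le>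
      (LINT x|M. w x * (\<bar>f x\<bar> / w x) powr p)"
    using w(1) f fp by (intro integral_mono pt) auto
  also have "(LINT x|M. m powr p * w x + p * m powr (p - 1) * (\<bar>f x\<bar> - m * w x)) =
      m powr p * W + p * m powr (p - 1) * (I - m * W)"
    using w(1) f by (simp add: W_def I_def)
  also have "I - m * W = 0" using W by (simp add: m_def)
  finally have 1: "m powr p * W \<le> (LINT x|M. w x * (\<bar>f x\<bar> / w x) powr p)" by simp
  have "\<bar>LINT x|M. f x\<bar> powr p \<le> I powr p"
    unfolding I_def using p by (intro powr_mono2 integral_abs_bound) auto
  also have "I = m * W" using W by (simp add: m_def)
  also have "(m * W) powr p = W powr (p - 1) * (m powr p * W)"
    using W m by (simp add: powr_mult powr_diff)
  also have "\<dots> \<le> W powr (p - 1) * (LINT x|M. w x * (\<bar>f x\<bar> / w x) powr p)"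
    using 1 by (intro mult_left_mono) auto
  finally show ?thesis unfolding W_def .
qed

section \<open>Test functions\<close>

text \<open>The polynomial factor makes the family closed under differentiation: all derivatives of
  the standard profile, which is \<open>Q = 1\<close>, have this shape.\<close>

definition bump_profile :: "real poly \<Rightarrow> real \<Rightarrow> real" where
  "bump_profile Q t = (if 0 < t then poly Q (1 / t) * exp (- (1 / t)) else 0)"

lemma poly_times_exp_minus_tendsto_0:
  fixes Q :: "real poly"
  shows "((\<lambda>y. y ^ n * poly Q y * exp (- y)) \<longlongrightarrow> 0) at_top"
proof (induction Q arbitrary: n)
  case 0
  then show ?case by simp
next
  case (pCons a Q)
  have "((\<lambda>y. a * (y ^ n / exp y) + y ^ Suc n * poly Q y * exp (- y)) \<longlongrightarrow> a * 0 + 0) at_top"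
    by (intro tendsto_intros tendsto_power_div_exp_0 pCons.IH)
  then show ?case by (simp add: algebra_simps exp_minus field_simps)
qed

text \<open>In the variable \<open>y = 1 / t\<close> the derivative is \<open>- y\<^sup>2\<close>
  times that in \<open>y\<close>, and it turns \<open>Q(y) exp (- y)\<close> into
  \<open>y\<^sup>2 (Q - Q')(y) exp (- y)\<close>. At 0 the right difference quotient is
  \<open>y * Q(y) * exp (- y)\<close>, which tends to 0 as \<open>y\<close> tends to
  infinity.\<close>

lemma bump_profile_deriv:
  "(bump_profile Q has_real_derivative bump_profile ([:0, 0, 1:] * (Q - pderiv Q)) t) (at t)"
proof (cases t "0 :: real" rule: linorder_cases)
  case less
  have "((\<lambda>t. 0) has_real_derivative 0) (at t)" by simp
  then have "(bump_profile Q has_real_derivative 0) (at t)"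
    by (rule DERIV_cong_ev[THEN iffD1, rotated -1])
       (use less eventually_nhds_in_open[of "{..<0}" t] in \<open>auto elim!: eventually_mono simp: bump_profile_def\<close>)
  then show ?thesis using less by (simp add: bump_profile_def)
next
  case greater
  have "((\<lambda>t. poly Q (1 / t) * exp (- (1 / t))) has_real_derivative
      bump_profile ([:0, 0, 1:] * (Q - pderiv Q)) t) (at t)"
    using greater
    by (auto intro!: derivative_eq_intros DERIV_chain2[OF poly_DERIV]
        simp: bump_profile_def field_simps power2_eq_square)
  then show ?thesis
    by (rule DERIV_cong_ev[THEN iffD1, rotated -1])
       (use greater eventually_nhds_in_open[of "{0<..}" t] in \<open>auto elim!: eventually_mono simp: bump_profile_def\<close>)
next
  case equal
  have "((\<lambda>h. bump_profile Q h / h) \<longlongrightarrow> 0) (at_right 0)"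
  proof -
    have "((\<lambda>y. y ^ 1 * poly Q y * exp (- y)) \<longlongrightarrow> 0) at_top" by (rule poly_times_exp_minus_tendsto_0)
    then have "((\<lambda>h. inverse h * poly Q (inverse h) * exp (- inverse h)) \<longlongrightarrow> 0) (at_right (0::real))"
      using filterlim_inverse_at_top_right filterlim_compose by fastforce
    then show ?thesis
      by (rule Lim_transform_eventually)
         (use eventually_at_right_less[of "0::real"] in \<open>auto elim!: eventually_mono simp: bump_profile_def field_simps\<close>)
  qed
  moreover have "((\<lambda>h. bump_profile Q h / h) \<longlongrightarrow> 0) (at_left 0)"
    by (rule Lim_transform_eventually[OF tendsto_const])
       (auto simp: eventually_at_filter bump_profile_def)
  ultimately have "((\<lambda>h. bump_profile Q h / h) \<longlongrightarrow> 0) (at 0)"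
    by (rule filterlim_split_at_real[rotated])
  then show ?thesis using equal by (simp add: DERIV_def bump_profile_def)
qed

text \<open>A class of functions closed under partial derivatives, hence consisting of smooth functions.\<close>

inductive bump_algebra :: "(real^'n::finite \<Rightarrow> real) \<Rightarrow> bool" where
  const: "bump_algebra (\<lambda>x. c)"
| add: "bump_algebra f \<Longrightarrow> bump_algebra g \<Longrightarrow> bump_algebra (\<lambda>x. f x + g x)"
| mult: "bump_algebra f \<Longrightarrow> bump_algebra g \<Longrightarrow> bump_algebra (\<lambda>x. f x * g x)"
| profile: "bump_algebra (\<lambda>x. bump_profile Q (a * x $ j + b))"

lemma bump_algebra_deriv:
  "bump_algebra f \<Longrightarrow> \<exists>f'. (\<forall>x. (f has_derivative f' x) (at x)) \<and> (\<forall>i. bump_algebra (\<lambda>x. f' x (axis i 1)))"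
proof (induction rule: bump_algebra.induct)
  case (const c)
  then show ?case by (intro exI[of _ "\<lambda>x h. 0"]) (auto intro: bump_algebra.const)
next
  case (add f g)
  then obtain f' g' where "\<And>x. (f has_derivative f' x) (at x)" "\<And>i. bump_algebra (\<lambda>x. f' x (axis i 1))"
    "\<And>x. (g has_derivative g' x) (at x)" "\<And>i. bump_algebra (\<lambda>x. g' x (axis i 1))" by blast
  then show ?case
    by (intro exI[of _ "\<lambda>x h. f' x h + g' x h"]) (auto intro!: bump_algebra.add derivative_intros)
next
  case (mult f g)
  then obtain f' g' where *: "\<And>x. (f has_derivative f' x) (at x)" "\<And>i. bump_algebra (\<lambda>x. f' x (axis i 1))"
    "\<And>x. (g has_derivative g' x) (at x)" "\<And>i. bump_algebra (\<lambda>x. g' x (axis i 1))" by blast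
  then show ?case using mult.hyps
    by (intro exI[of _ "\<lambda>x h. f x * g' x h + f' x h * g x"])
       (auto intro!: bump_algebra.add bump_algebra.mult has_derivative_mult)
next
  case (profile Q a j b)
  let ?Q = "[:0, 0, 1:] * (Q - pderiv Q)"
  have 1: "((\<lambda>x. a * x $ j + b) has_derivative (\<lambda>h. a * h $ j)) (at x)" for x
    by (auto intro!: derivative_eq_intros bounded_linear_imp_has_derivative bounded_linear_vec_nth)
  have "((\<lambda>x. bump_profile Q (a * x $ j + b)) has_derivative
      (\<lambda>h. (a * h $ j) * bump_profile ?Q (a * x $ j + b))) (at x)" for x
    using has_derivative_compose[OF 1, of "bump_profile Q", OF bump_profile_deriv[unfolded has_field_derivative_def]]
    by (simp add: mult.commute)
  then show ?case
    by (intro exI[of _ "\<lambda>x h. (a * h $ j) * bump_profile ?Q (a * x $ j + b)"])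
       (auto intro!: bump_algebra.mult bump_algebra.const bump_algebra.profile)
qed

lemma bump_algebra_C_k: "bump_algebra f \<Longrightarrow> C_k k f"
proof (induction k arbitrary: f)
  case 0
  then obtain f' where f': "\<And>x. (f has_derivative f' x) (at x)"
    using bump_algebra_deriv by blast
  then show ?case
    by (auto intro!: continuous_at_imp_continuous_on has_derivative_continuous)
next
  case (Suc k)
  then obtain f' where f': "\<And>x. (f has_derivative f' x) (at x)" "\<And>i. bump_algebra (\<lambda>x. f' x (axis i 1))"
    using bump_algebra_deriv by blast
  have "frechet_derivative f (at x) = f' x" for x using f'(1) frechet_derivative_at by metis
  then have "pderivative i f = (\<lambda>x. f' x (axis i 1))" for i
    by (auto simp: pderivative_def)
  then show ?case using f' Suc.IH by (auto simp: differentiable_def)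
qed

lemma bump_algebra_prod:
  "finite I \<Longrightarrow> (\<And>i. i \<in> I \<Longrightarrow> bump_algebra (f i)) \<Longrightarrow> bump_algebra (\<lambda>x. \<Prod>i\<in>I. f i x)"
  by (induction rule: finite_induct) (auto intro: bump_algebra.intros)

text \<open>Each face of the box contributes one profile, positive exactly on the inner side of that
  face; the slope \<open>Suc k\<close> lets the product tend to the indicator of the open box. The
  arguments are written as a slope times a coordinate plus a constant so that rule
  \<open>bump_algebra.profile\<close> applies.\<close>

definition box_bump :: "nat \<Rightarrow> real^'n \<Rightarrow> real^'n \<Rightarrow> real^'n \<Rightarrow> real" where
  "box_bump k a b x = (\<Prod>i\<in>UNIV. bump_profile 1 (real (Suc k) * x $ i + (- real (Suc k) * a $ i)) *
     bump_profile 1 (- real (Suc k) * x $ i + real (Suc k) * b $ i))"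

lemma box_bump_range: "0 \<le> box_bump k a b x" "box_bump k a b x \<le> 1"
  unfolding box_bump_def by (auto intro!: prod_nonneg prod_le_1 mult_le_one simp: bump_profile_def)

lemma box_bump_zero: "x \<notin> box a b \<Longrightarrow> box_bump k a b x = 0"
proof -
  assume "x \<notin> box a b"
  then obtain i where "x $ i \<le> a $ i \<or> b $ i \<le> x $ i" by (auto simp: mem_box_cart not_less)
  then have "real (Suc k) * x $ i + (- real (Suc k) * a $ i) \<le> 0 \<or> - real (Suc k) * x $ i + real (Suc k) * b $ i \<le> 0"
    by (auto simp: mult_left_mono simp del: of_nat_Suc)
  then show ?thesis unfolding box_bump_def
    by (intro prod_zero) (auto intro!: exI[of _ i] simp: bump_profile_def simp del: of_nat_Suc)
qed

lemma box_bump_C0_infinity: "box_bump k a b \<in> C0_infinity UNIV"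
proof -
  have "bump_algebra (box_bump k a b)"
    unfolding box_bump_def[abs_def]
    by (intro bump_algebra_prod bump_algebra.mult bump_algebra.profile) auto
  then have "smooth (box_bump k a b)" by (auto simp: smooth_def bump_algebra_C_k)
  moreover have "closure {x. box_bump k a b x \<noteq> 0} \<subseteq> cbox a b"
    using box_bump_zero box_subset_cbox by (intro closure_minimal) (blast, auto)
  then have "compact (closure {x. box_bump k a b x \<noteq> 0})"
    by (meson bounded_cbox bounded_subset closed_closure compact_eq_bounded_closed)
  ultimately show ?thesis by (auto simp: C0_infinity_def)
qed

lemma box_bump_tendsto: "(\<lambda>k. box_bump k a b x) \<longlonglongrightarrow> indicator (box a b) x"
proof (cases "x \<in> box a b")
  case True
  have h: "(\<lambda>k. bump_profile 1 (real (Suc k) * c)) \<longlonglongrightarrow> 1" if "0 < c" for c :: real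
  proof -
    have "(\<lambda>k. exp (- (inverse (real (Suc k)) * inverse c))) \<longlonglongrightarrow> exp (- (0 * inverse c))"
      by (intro tendsto_intros LIMSEQ_inverse_real_of_nat)
    then show ?thesis using that by (simp add: bump_profile_def field_simps del: of_nat_Suc)
  qed
  have "(\<lambda>k. \<Prod>i\<in>UNIV. bump_profile 1 (real (Suc k) * (x $ i - a $ i)) *
     bump_profile 1 (real (Suc k) * (b $ i - x $ i))) \<longlonglongrightarrow> (\<Prod>i\<in>(UNIV::'a set). 1 * 1)"
    using True by (intro tendsto_prod tendsto_mult h) (auto simp: mem_box_cart)
  then show ?thesis using True by (simp add: box_bump_def algebra_simps del: of_nat_Suc)
qed (simp add: box_bump_zero)

section \<open>Uniqueness of weak gradients\<close>

text \<open>Restrictions to balls are measurable because they are integrable, and they converge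
  pointwise to the function.\<close>

lemma locally_integrable_borel_measurable:
  fixes g :: "real^'n::finite \<Rightarrow> 'b::{banach, second_countable_topology}"
  assumes "locally_integrable g"
  shows "g \<in> borel_measurable borel"
proof (rule borel_measurable_LIMSEQ_metric)
  show "(\<lambda>x. indicator (cball 0 (real k)) x *\<^sub>R g x) \<in> borel_measurable borel" for k
    using assms by (auto simp: locally_integrable_def set_integrable_def intro: borel_measurable_integrable
      dest!: spec[of _ "cball 0 (real k)"] borel_measurable_integrable)
  fix x :: "real^'n"
  obtain n where n: "norm x \<le> real n" using real_arch_simple by blast
  show "(\<lambda>k. indicator (cball 0 (real k)) x *\<^sub>R g x) \<longlonglongrightarrow> g x"
    by (rule tendsto_eventually[OF eventually_sequentiallyI[of n]]) (use n in \<open>auto simp: indicator_def\<close>)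
qed

lemma C0_infinityD:
  assumes "\<phi> \<in> C0_infinity \<Omega>"
  shows "C_k k \<phi>" "\<phi> differentiable (at x)" "continuous_on UNIV (pderivative i \<phi>)"
    "continuous_on UNIV \<phi>" "compact (closure {x. \<phi> x \<noteq> 0})" "closure {x. \<phi> x \<noteq> 0} \<subseteq> \<Omega>"
proof -
  show C: "C_k k \<phi>" for k using assms by (auto simp: C0_infinity_def smooth_def)
  show "\<phi> differentiable (at x)" "continuous_on UNIV (pderivative i \<phi>)" using C[of "Suc 0"] by auto
  show "continuous_on UNIV \<phi>" using C[of 0] by auto
  show "compact (closure {x. \<phi> x \<noteq> 0})" "closure {x. \<phi> x \<noteq> 0} \<subseteq> \<Omega>"
    using assms by (auto simp: C0_infinity_def)
qed

lemma locally_integrable_mult_test: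
  fixes g :: "real^'n::finite \<Rightarrow> real"
  assumes g: "locally_integrable g" and f: "continuous_on UNIV f"
    and K: "compact K" "\<And>x. x \<notin> K \<Longrightarrow> f x = 0"
  shows "integrable lborel (\<lambda>x. g x * f x)"
proof -
  have [measurable]: "g \<in> borel_measurable borel" "f \<in> borel_measurable borel"
    using locally_integrable_borel_measurable[OF g] borel_measurable_continuous_onI[OF f] by auto
  obtain B where B: "\<And>x. x \<in> K \<Longrightarrow> norm (f x) \<le> B"
    using compact_imp_bounded[OF compact_continuous_image[OF continuous_on_subset[OF f] K(1)]]
    by (auto simp: bounded_iff)
  have "integrable lborel (\<lambda>x. \<bar>B\<bar> *\<^sub>R (indicator K x *\<^sub>R g x))"
    using g K by (intro integrable_scaleR_right) (auto simp: locally_integrable_def set_integrable_def)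
  then show ?thesis
  proof (rule Bochner_Integration.integrable_bound)
    show "AE x in lborel. norm (g x * f x) \<le> norm (\<bar>B\<bar> *\<^sub>R indicat_real K x *\<^sub>R g x)"
    proof (rule AE_I2)
      fix x
      show "norm (g x * f x) \<le> norm (\<bar>B\<bar> *\<^sub>R indicat_real K x *\<^sub>R g x)"
      proof (cases "x \<in> K")
        case True
        then have "\<bar>f x\<bar> \<le> \<bar>B\<bar>" using B[of x] by auto
        then show ?thesis using True by (simp add: abs_mult mult.commute mult_mono)
      qed (simp add: K)
    qed
  qed simp
qed

text \<open>The fundamental lemma of the calculus of variations. Approximating indicators by
  \<open>box_bump\<close> shows that the integral of \<open>g\<close> over every open box vanishes;
  boxes form an intersection-stable generator of the Borel sets, so the measures defined by the
  positive and the negative part of \<open>g\<close> coincide.\<close>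

lemma locally_integrable_test_zero_imp_AE_zero:
  fixes g :: "real^'n::finite \<Rightarrow> real"
  assumes g: "locally_integrable g"
    and z: "\<And>\<phi>. \<phi> \<in> C0_infinity UNIV \<Longrightarrow> (LINT x|lborel. g x * \<phi> x) = 0"
  shows "AE x in lborel. g x = 0"
proof -
  have [measurable]: "g \<in> borel_measurable borel"
    using locally_integrable_borel_measurable[OF g] .
  have li: "integrable lborel (\<lambda>x. indicator K x * g x)" if "compact K" for K
    using g that by (auto simp: locally_integrable_def set_integrable_def)
  have ib: "integrable lborel (\<lambda>x. indicator (box a b) x * g x)" for a b
    by (rule Bochner_Integration.integrable_bound[OF li[of "cbox a b"]])
       (use box_subset_cbox[of a b] in \<open>auto simp: indicator_def\<close>)
  have box0: "(LINT x|lborel. indicator (box a b) x * g x) = 0" for a b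
  proof -
    have "(\<lambda>k. LINT x|lborel. g x * box_bump k a b x) \<longlonglongrightarrow> (LINT x|lborel. indicator (box a b) x * g x)"
    proof (rule integral_dominated_convergence[where w = "\<lambda>x. \<bar>indicator (box a b) x * g x\<bar>"])
      show "(\<lambda>x. g x * box_bump i a b x) \<in> borel_measurable lborel" for i
        using C0_infinityD(4)[OF box_bump_C0_infinity, of i a b] borel_measurable_continuous_onI
        by (intro borel_measurable_times) auto
      show "AE x in lborel. (\<lambda>i. g x * box_bump i a b x) \<longlonglongrightarrow> indicat_real (box a b) x * g x"
        by (intro AE_I2) (subst mult.commute, intro tendsto_mult tendsto_const box_bump_tendsto)
      show "AE x in lborel. norm (g x * box_bump i a b x) \<le> \<bar>indicat_real (box a b) x * g x\<bar>" for i
        using box_bump_range[of i a b] box_bump_zero[of _ a b i]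
        by (auto simp: abs_mult indicator_def intro!: mult_left_le)
    qed (use ib in auto)
    then have "(\<lambda>k::nat. 0) \<longlonglongrightarrow> (LINT x|lborel. indicator (box a b) x * g x)"
      by (simp only: z[OF box_bump_C0_infinity])
    then show ?thesis by (rule LIMSEQ_unique) simp
  qed
  \<comment> \<open>\<open>ennreal\<close> cuts negative values off at 0, so the two densities are
    the positive and the negative part of \<open>g\<close>.\<close>
  define P where "P = density lborel (\<lambda>x. ennreal (g x))"
  define N where "N = density lborel (\<lambda>x. ennreal (- g x))"
  have em: "emeasure P (box a b) = emeasure N (box a b)" "emeasure P (box a b) \<noteq> \<infinity>" for a b
  proof -
    have pi: "integrable lborel (\<lambda>x. indicator (box a b) x * max 0 (g x))"
      by (rule Bochner_Integration.integrable_bound[OF ib[of a b]]) (auto simp: indicator_def)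
    have ni: "integrable lborel (\<lambda>x. indicator (box a b) x * max 0 (- g x))"
      by (rule Bochner_Integration.integrable_bound[OF ib[of a b]]) (auto simp: indicator_def)
    have 1: "emeasure P (box a b) = ennreal (LINT x|lborel. indicator (box a b) x * max 0 (g x))"
      unfolding P_def
      by (subst emeasure_density, simp, simp, subst nn_integral_eq_integral[symmetric, OF pi])
         (auto intro!: nn_integral_cong simp: indicator_def max_def ennreal_neg)
    have 2: "emeasure N (box a b) = ennreal (LINT x|lborel. indicator (box a b) x * max 0 (- g x))"
      unfolding N_def
      by (subst emeasure_density, simp, simp, subst nn_integral_eq_integral[symmetric, OF ni])
         (auto intro!: nn_integral_cong simp: indicator_def max_def ennreal_neg)
    have "(LINT x|lborel. indicator (box a b) x * max 0 (g x)) - (LINT x|lborel. indicator (box a b) x * max 0 (- g x)) =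
      (LINT x|lborel. indicator (box a b) x * g x)"
      by (subst Bochner_Integration.integral_diff[symmetric, OF pi ni], rule Bochner_Integration.integral_cong)
        (auto simp: max_def indicator_def)
    then show "emeasure P (box a b) = emeasure N (box a b)" "emeasure P (box a b) \<noteq> \<infinity>"
      using 1 2 box0 by auto
  qed
  have "P = N"
  proof (rule measure_eqI_generator_eq[where E = "range (\<lambda>(a, b). box a b)" and \<Omega> = UNIV
      and A = "\<lambda>n. box (- (real n *\<^sub>R One)) (real n *\<^sub>R One)"])
    show "Int_stable (range (\<lambda>(a, b). box a b :: (real^'n) set))"
      by (auto simp: Int_stable_def box_Int_box)
    show "sets P = sigma_sets UNIV (range (\<lambda>(a, b). box a b))" "sets N = sigma_sets UNIV (range (\<lambda>(a, b). box a b))"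
      by (auto simp: P_def N_def borel_eq_box)
    show "(\<Union>i. box (- (real i *\<^sub>R One)) (real i *\<^sub>R One)) = (UNIV :: (real^'n) set)"
      by (rule UN_box_eq_UNIV)
  qed (use em in auto)
  \<comment> \<open>At most one of the two truncated values is nonzero, so their equality forces
    \<open>g x = 0\<close>.\<close>
  then have "AE x in lborel. ennreal (g x) = ennreal (- g x)"
    unfolding P_def N_def by (subst (asm) sigma_finite_measure.density_unique_iff[OF sigma_finite_lborel]) auto
  then show ?thesis
    by eventually_elim (smt (verit) ennreal_eq_0_iff ennreal_neg)
qed

lemma locally_integrable_nth:
  fixes g :: "real^'n::finite \<Rightarrow> real^'n"
  assumes "locally_integrable g"
  shows "locally_integrable (\<lambda>x. g x $ i)"
  unfolding locally_integrable_def set_integrable_def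
proof (intro allI impI)
  fix K :: "(real^'n) set" assume "compact K"
  then have "integrable lborel (\<lambda>x. indicator K x *\<^sub>R g x)"
    using assms by (auto simp: locally_integrable_def set_integrable_def)
  then have "integrable lborel (\<lambda>x. (indicator K x *\<^sub>R g x) $ i)"
    by (rule integrable_bounded_linear[OF bounded_linear_vec_nth])
  then show "integrable lborel (\<lambda>x. indicator K x *\<^sub>R g x $ i)" by simp
qed

lemma locally_integrable_add_scaleR:
  fixes f g :: "real^'n::finite \<Rightarrow> 'b::{banach, second_countable_topology}"
  assumes "locally_integrable f" "locally_integrable g"
  shows "locally_integrable (\<lambda>x. a *\<^sub>R f x + b *\<^sub>R g x)"
  unfolding locally_integrable_def
proof (intro allI impI)
  fix K :: "(real^'n) set" assume "compact K"
  then have "set_integrable lborel K f" "set_integrable lborel K g"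
    using assms by (auto simp: locally_integrable_def)
  then show "set_integrable lborel K (\<lambda>x. a *\<^sub>R f x + b *\<^sub>R g x)"
    by (intro set_integral_add(1) set_integrable_scaleR_right)
qed

lemma test_support:
  assumes "\<phi> \<in> C0_infinity \<Omega>" "x \<notin> closure {x. \<phi> x \<noteq> 0}"
  shows "\<phi> x = 0" "pderivative i \<phi> x = 0"
proof -
  show "\<phi> x = 0" using assms(2) closure_subset[of "{x. \<phi> x \<noteq> 0}"] by blast
  have "((\<lambda>x. 0) has_derivative (\<lambda>h. 0)) (at x)" by simp
  then have "(\<phi> has_derivative (\<lambda>h. 0)) (at x)"
    by (rule has_derivative_transform_within_open[where s = "- closure {x. \<phi> x \<noteq> 0}"])
       (use assms closure_subset[of "{x. \<phi> x \<noteq> 0}"] in auto)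
  then show "pderivative i \<phi> x = 0" by (metis pderivative_def frechet_derivative_at)
qed

lemma has_weak_gradient_unique:
  assumes "has_weak_gradient u g" "has_weak_gradient u h"
  shows "AE x in lborel. g x = h x"
proof -
  have gi: "locally_integrable (\<lambda>x. g x $ i)" and hi: "locally_integrable (\<lambda>x. h x $ i)" for i
    using assms by (auto simp: has_weak_gradient_def intro: locally_integrable_nth)
  have "AE x in lborel. g x $ i - h x $ i = 0" for i
  proof (rule locally_integrable_test_zero_imp_AE_zero)
    show "locally_integrable (\<lambda>x. g x $ i - h x $ i)"
      using locally_integrable_add_scaleR[OF gi[of i] hi[of i], of 1 "-1"] by simp
    fix \<phi> :: "real^'a \<Rightarrow> real" assume \<phi>: "\<phi> \<in> C0_infinity UNIV"
    note test = C0_infinityD(4,5)[OF \<phi>] test_support(1)[OF \<phi>]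
    have "integrable lborel (\<lambda>x. g x $ i * \<phi> x)" "integrable lborel (\<lambda>x. h x $ i * \<phi> x)"
      using locally_integrable_mult_test[OF gi test] locally_integrable_mult_test[OF hi test] by auto
    moreover have "(LINT x|lborel. g x $ i * \<phi> x) = (LINT x|lborel. h x $ i * \<phi> x)"
      using assms \<phi> by (simp add: has_weak_gradient_def)
    ultimately show "(LINT x|lborel. (g x $ i - h x $ i) * \<phi> x) = 0"
      by (simp add: left_diff_distrib)
  qed
  then have "AE x in lborel. \<forall>i\<in>UNIV. g x $ i - h x $ i = 0"
    by (intro AE_finite_allI) auto
  then show ?thesis by eventually_elim (simp add: vec_eq_iff)
qed

lemma weak_gradient_works:
  assumes "has_weak_gradient u g"
  shows "has_weak_gradient u (weak_gradient u)" "AE x in lborel. weak_gradient u x = g x"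
proof -
  show "has_weak_gradient u (weak_gradient u)"
    unfolding weak_gradient_def using assms by (rule someI[of "has_weak_gradient u"])
  then show "AE x in lborel. weak_gradient u x = g x" using assms by (rule has_weak_gradient_unique)
qed

lemma has_weak_gradient_linear:
  assumes "has_weak_gradient u g" "has_weak_gradient v h"
  shows "has_weak_gradient (\<lambda>x. a * u x + b * v x) (\<lambda>x. a *\<^sub>R g x + b *\<^sub>R h x)"
  unfolding has_weak_gradient_def
proof (intro conjI ballI allI)
  have li: "locally_integrable u" "locally_integrable v" "locally_integrable g" "locally_integrable h"
    using assms by (auto simp: has_weak_gradient_def)
  show "locally_integrable (\<lambda>x. a * u x + b * v x)"
    using locally_integrable_add_scaleR[OF li(1,2), of a b] by simp
  show "locally_integrable (\<lambda>x. a *\<^sub>R g x + b *\<^sub>R h x)"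
    by (rule locally_integrable_add_scaleR[OF li(3,4)])
  fix \<phi> :: "real^'a \<Rightarrow> real" and i :: 'a assume \<phi>: "\<phi> \<in> C0_infinity UNIV"
  note t = C0_infinityD(4,5)[OF \<phi>] test_support(1)[OF \<phi>]
  note d = C0_infinityD(3,5)[OF \<phi>] test_support(2)[OF \<phi>]
  have "(LINT x|lborel. (a * u x + b * v x) * pderivative i \<phi> x) =
     a * (LINT x|lborel. u x * pderivative i \<phi> x) + b * (LINT x|lborel. v x * pderivative i \<phi> x)"
    using locally_integrable_mult_test[OF li(1) d] locally_integrable_mult_test[OF li(2) d]
    by (simp add: distrib_right mult.assoc)
  also have "\<dots> = - (a * (LINT x|lborel. g x $ i * \<phi> x) + b * (LINT x|lborel. h x $ i * \<phi> x))"
    using assms \<phi> by (simp add: has_weak_gradient_def)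
  also have "a * (LINT x|lborel. g x $ i * \<phi> x) + b * (LINT x|lborel. h x $ i * \<phi> x) =
     (LINT x|lborel. (a *\<^sub>R g x + b *\<^sub>R h x) $ i * \<phi> x)"
    using locally_integrable_mult_test[OF locally_integrable_nth[OF li(3)] t]
      locally_integrable_mult_test[OF locally_integrable_nth[OF li(4)] t]
    by (simp add: distrib_right mult.assoc)
  finally show "(LINT x|lborel. (a * u x + b * v x) * pderivative i \<phi> x) =
    - (LINT x|lborel. (a *\<^sub>R g x + b *\<^sub>R h x) $ i * \<phi> x)" .
qed

section \<open>Test functions belong to the Sobolev spaces\<close>

definition grad :: "(real^'n::finite \<Rightarrow> real) \<Rightarrow> real^'n \<Rightarrow> real^'n" where
  "grad f x = (\<chi> i. pderivative i f x)"

lemma grad_nth [simp]: "grad f x $ i = pderivative i f x"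
  by (simp add: grad_def)

lemma has_derivative_grad:
  assumes "\<phi> \<in> C0_infinity \<Omega>"
  shows "(\<phi> has_derivative (\<lambda>h. inner (grad \<phi> x) h)) (at x)"
proof -
  let ?D = "frechet_derivative \<phi> (at x)"
  have D: "(\<phi> has_derivative ?D) (at x)"
    using C0_infinityD(2)[OF assms] frechet_derivative_works by blast
  then have lin: "linear ?D" by (simp add: has_derivative_linear)
  have "?D h = inner (grad \<phi> x) h" for h
  proof -
    have "?D h = ?D (\<Sum>i\<in>UNIV. h $ i *\<^sub>R axis i 1)"
      using basis_expansion[of h] by (simp add: scalar_mult_eq_scaleR)
    also have "\<dots> = (\<Sum>i\<in>UNIV. h $ i * ?D (axis i 1))"
      by (simp add: linear_sum[OF lin] linear_cmul[OF lin])
    finally show ?thesis by (simp add: inner_vec_def pderivative_def mult.commute)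
  qed
  then have "?D = (\<lambda>h. inner (grad \<phi> x) h)" by auto
  then show ?thesis using D by simp
qed

lemma continuous_on_grad: "\<phi> \<in> C0_infinity \<Omega> \<Longrightarrow> continuous_on UNIV (grad \<phi>)"
  unfolding grad_def[abs_def] by (intro continuous_on_vec_lambda C0_infinityD(3))

lemma test_support_ball:
  assumes "\<phi> \<in> C0_infinity \<Omega>"
  obtains R where "0 < R" "\<And>x. R \<le> norm x \<Longrightarrow> \<phi> x = 0" "\<And>x. R \<le> norm x \<Longrightarrow> grad \<phi> x = 0"
proof -
  have "bounded (closure {x. \<phi> x \<noteq> 0})" by (rule compact_imp_bounded[OF C0_infinityD(5)[OF assms]])
  then obtain R where R: "0 < R" "\<forall>x\<in>closure {x. \<phi> x \<noteq> 0}. norm x < R"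
    unfolding bounded_pos_less by blast
  then have "x \<notin> closure {x. \<phi> x \<noteq> 0}" if "R \<le> norm x" for x using that not_less by blast
  then have "\<phi> x = 0" "grad \<phi> x = 0" if "R \<le> norm x" for x
    using test_support[OF assms, of x] that unfolding vec_eq_iff by auto
  then show ?thesis by (rule that[OF R(1)])
qed

lemma continuous_vanishing_bounded:
  fixes f :: "real^'n::finite \<Rightarrow> 'b::real_normed_vector"
  assumes "continuous_on UNIV f" "\<And>x. R \<le> norm x \<Longrightarrow> f x = 0"
  obtains B where "0 < B" "\<And>x. norm (f x) \<le> B"
proof -
  have "bounded (f ` cball 0 R)"
    by (intro compact_imp_bounded compact_continuous_image continuous_on_subset[OF assms(1)]) auto
  then obtain B where B: "0 < B" "\<And>x. x \<in> cball 0 R \<Longrightarrow> norm (f x) \<le> B"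
    by (auto simp: bounded_pos)
  have "norm (f x) \<le> B" for x
    using B assms(2)[of x] by (cases "norm x \<le> R") auto
  then show ?thesis using that B by blast
qed

lemma test_bounds:
  assumes "\<phi> \<in> C0_infinity \<Omega>"
  obtains L where "0 < L" "\<And>x. \<bar>\<phi> x\<bar> \<le> L" "\<And>x. norm (grad \<phi> x) \<le> L"
    "\<And>x y. \<bar>\<phi> x - \<phi> y\<bar> \<le> L * norm (x - y)"
proof -
  obtain R where R: "0 < R" "\<And>x. R \<le> norm x \<Longrightarrow> \<phi> x = 0" "\<And>x. R \<le> norm x \<Longrightarrow> grad \<phi> x = 0"
    by (rule test_support_ball[OF assms]) blast
  obtain B1 where B1: "0 < B1" "\<And>x. norm (\<phi> x) \<le> B1"
    using continuous_vanishing_bounded[OF C0_infinityD(4)[OF assms] R(2)] by blast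
  obtain B2 where B2: "0 < B2" "\<And>x. norm (grad \<phi> x) \<le> B2"
    using continuous_vanishing_bounded[OF continuous_on_grad[OF assms] R(3)] by blast
  have lip: "\<bar>\<phi> x - \<phi> y\<bar> \<le> B2 * norm (x - y)" for x y
  proof -
    have "norm (\<phi> x - \<phi> y) \<le> B2 * norm (x - y)"
    proof (rule differentiable_bound[where S = UNIV and f' = "\<lambda>x h. inner (grad \<phi> x) h"])
      show "onorm (inner (grad \<phi> z)) \<le> B2" for z
      proof (rule onorm_le)
        fix h
        have "norm (inner (grad \<phi> z) h) \<le> norm (grad \<phi> z) * norm h"
          using Cauchy_Schwarz_ineq2 by simp
        also have "\<dots> \<le> B2 * norm h" using B2 by (intro mult_right_mono) auto
        finally show "norm (inner (grad \<phi> z) h) \<le> B2 * norm h" .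
      qed
    qed (use has_derivative_grad[OF assms] in auto)
    then show ?thesis by simp
  qed
  show ?thesis
  proof (rule that[of "B1 + B2"])
    show "\<bar>\<phi> x\<bar> \<le> B1 + B2" "norm (grad \<phi> x) \<le> B1 + B2" for x using B1(2)[of x] B2(2)[of x] B1(1) B2(1) by auto
    show "\<bar>\<phi> x - \<phi> y\<bar> \<le> (B1 + B2) * norm (x - y)" for x y
    proof -
      have "B2 * norm (x - y) \<le> (B1 + B2) * norm (x - y)" using B1(1) by (intro mult_right_mono) auto
      then show ?thesis using lip[of x y] by linarith
    qed
  qed (use B1 B2 in auto)
qed

lemma integrable_bounded_vanishing:
  fixes f :: "real^'n::finite \<Rightarrow> 'b::{banach, second_countable_topology}"
  assumes "f \<in> borel_measurable borel" "\<And>x. norm (f x) \<le> B" "\<And>x. R \<le> norm x \<Longrightarrow> f x = 0"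
  shows "integrable lborel f"
proof (rule Bochner_Integration.integrable_bound[where f = "\<lambda>x. B * indicator (cball 0 \<bar>R\<bar>) x"])
  show "integrable lborel (\<lambda>x. B * indicat_real (cball 0 \<bar>R\<bar>) (x::real^'n))"
    using emeasure_lborel_cball_finite[of "0::real^'n" "\<bar>R\<bar>"] by (intro integrable_mult_right integrable_real_indicator) auto
  show "AE x in lborel. norm (f x) \<le> norm (B * indicat_real (cball 0 \<bar>R\<bar>) x)"
  proof (rule AE_I2)
    fix x :: "real^'n"
    show "norm (f x) \<le> norm (B * indicat_real (cball 0 \<bar>R\<bar>) x)"
      using assms(2)[of x] assms(3)[of x] norm_ge_zero[of "f x"] by (cases "norm x \<le> \<bar>R\<bar>") auto
  qed
qed (use assms in simp)

lemma integral_translation: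
  fixes f :: "real^'n::finite \<Rightarrow> real"
  assumes "f \<in> borel_measurable borel"
  shows "(LINT x|lborel. f (x + c)) = (LINT x|lborel. f x)"
proof -
  have "(LINT x|lborel. f x) = (LINT x|distr lborel borel ((+) c). f x)" by (simp add: lborel_distr_plus)
  also have "\<dots> = (LINT x|lborel. f (c + x))" using assms by (subst integral_distr) auto
  finally show ?thesis by (simp add: add.commute)
qed

text \<open>By translation invariance every difference quotient in the direction \<open>v\<close>
  has integral 0. The Lipschitz bound and the bounded support give a common integrable majorant, so
  the integral of the limit is 0 as well.\<close>

lemma integral_derivative_eq_0:
  fixes f :: "real^'n::finite \<Rightarrow> real"
  assumes f': "\<And>x. (f has_derivative f' x) (at x)"
    and lip: "\<And>x y. \<bar>f x - f y\<bar> \<le> L * norm (x - y)"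
    and R: "\<And>x. R \<le> norm x \<Longrightarrow> f x = 0"
  shows "(LINT x|lborel. f' x v) = 0"
proof -
  define c where "c k = inverse (real (Suc k))" for k
  have c: "0 < c k" "c k \<le> 1" for k by (auto simp: c_def field_simps)
  have c0: "c \<longlonglongrightarrow> 0" using LIMSEQ_inverse_real_of_nat by (simp add: c_def[abs_def])
  define q where "q k x = (f (x + c k *\<^sub>R v) - f x) / c k" for k x
  have cont: "continuous_on UNIV f"
    using f' by (auto intro!: continuous_at_imp_continuous_on has_derivative_continuous)
  have [measurable]: "f \<in> borel_measurable borel"
    by (rule borel_measurable_continuous_onI[OF cont])
  obtain B where B: "\<And>x. norm (f x) \<le> B" using continuous_vanishing_bounded[OF cont R] by blast
  have fi: "integrable lborel f" by (rule integrable_bounded_vanishing[OF _ B R]) auto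
  have "integrable lborel (\<lambda>x. f (x + c k *\<^sub>R v))" for k
  proof (rule integrable_bounded_vanishing[where R = "R + norm (c k *\<^sub>R v)", OF _ B])
    fix x :: "real^'n" assume "R + norm (c k *\<^sub>R v) \<le> norm x"
    then show "f (x + c k *\<^sub>R v) = 0"
      using norm_triangle_ineq4[of "x + c k *\<^sub>R v" "c k *\<^sub>R v"] by (intro R) simp
  qed simp
  then have q0: "(LINT x|lborel. q k x) = 0" for k
    using fi integral_translation[of f "c k *\<^sub>R v"] by (simp add: q_def)
  have lim: "(\<lambda>k. q k x) \<longlonglongrightarrow> f' x v" for x
  proof -
    have "((\<lambda>t. f (x + t *\<^sub>R v)) has_derivative (\<lambda>t. f' x (t *\<^sub>R v))) (at 0)"
      by (rule has_derivative_compose[where f = "\<lambda>t. x + t *\<^sub>R v" and g = f and g' = "f' x"])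
         (auto intro!: derivative_eq_intros f')
    moreover have "f' x (t *\<^sub>R v) = f' x v * t" for t
      using linear_cmul[OF has_derivative_linear[OF f'[of x]]] by simp
    ultimately have "((\<lambda>t. f (x + t *\<^sub>R v)) has_real_derivative f' x v) (at 0)"
      by (simp add: has_field_derivative_def)
    then have "((\<lambda>t. (f (x + t *\<^sub>R v) - f x) / t) \<longlongrightarrow> f' x v) (at 0)"
      by (simp add: DERIV_def)
    moreover have "filterlim c (at 0) sequentially"
      using c0 c(1) by (auto simp: filterlim_at less_imp_neq[symmetric] intro!: always_eventually)
    ultimately show ?thesis unfolding q_def by (rule filterlim_compose)
  qed
  \<comment> \<open>As \<open>c k\<close> is at most 1, all difference quotients vanish outside the
    ball of this radius.\<close>
  define W where "W = R + norm v"
  have bd: "norm (q k x) \<le> \<bar>L\<bar> * norm v * indicator (cball 0 W) x" for k x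
  proof (cases "norm x \<le> W")
    case True
    have "\<bar>f (x + c k *\<^sub>R v) - f x\<bar> \<le> \<bar>L\<bar> * (c k * norm v)"
    proof -
      have "\<bar>f (x + c k *\<^sub>R v) - f x\<bar> \<le> L * norm (c k *\<^sub>R v)" using lip[of "x + c k *\<^sub>R v" x] by simp
      also have "\<dots> \<le> \<bar>L\<bar> * norm (c k *\<^sub>R v)" by (intro mult_right_mono) auto
      finally show ?thesis using c[of k] by simp
    qed
    then show ?thesis using True c[of k] by (simp add: q_def abs_div field_simps)
  next
    case False
    have "norm (c k *\<^sub>R v) \<le> norm v" using c[of k] by (simp add: mult_left_le_one_le)
    moreover have "norm x \<le> norm (x + c k *\<^sub>R v) + norm (c k *\<^sub>R v)"
      using norm_triangle_ineq4[of "x + c k *\<^sub>R v" "c k *\<^sub>R v"] by simp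
    ultimately have "R \<le> norm (x + c k *\<^sub>R v)" "R \<le> norm x" using False norm_ge_zero[of v] unfolding W_def by linarith+
    then show ?thesis using False R by (simp add: q_def)
  qed
  have "(\<lambda>k. LINT x|lborel. q k x) \<longlonglongrightarrow> (LINT x|lborel. f' x v)"
  proof (rule integral_dominated_convergence[where w = "\<lambda>x. \<bar>L\<bar> * norm v * indicator (cball 0 W) x"])
    show qm: "q k \<in> borel_measurable lborel" for k unfolding q_def by measurable
    then show "(\<lambda>x. f' x v) \<in> borel_measurable lborel"
      by (rule borel_measurable_LIMSEQ_real[OF lim]) 
    show "integrable lborel (\<lambda>x. \<bar>L\<bar> * norm v * indicat_real (cball 0 W) (x::real^'n))"
      using emeasure_lborel_cball_finite[of "0::real^'n" W] by (intro integrable_mult_right integrable_real_indicator) auto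
  qed (use lim bd in auto)
  then have "(\<lambda>k::nat. 0) \<longlonglongrightarrow> (LINT x|lborel. f' x v)" by (simp only: q0)
  then show ?thesis by (rule LIMSEQ_unique) simp
qed

lemma locally_integrable_continuous:
  fixes f :: "real^'n::finite \<Rightarrow> 'b::{banach, second_countable_topology}"
  assumes "continuous_on UNIV f"
  shows "locally_integrable f"
  unfolding locally_integrable_def set_integrable_def
  using continuous_on_subset[OF assms] by (auto intro!: borel_integrable_compact)

text \<open>Integration by parts: a partial derivative of the product of \<phi> and \<psi> has
  integral 0.\<close>

lemma test_has_weak_gradient:
  assumes \<phi>: "\<phi> \<in> C0_infinity \<Omega>"
  shows "has_weak_gradient \<phi> (grad \<phi>)"
  unfolding has_weak_gradient_def
proof (intro conjI ballI allI)
  show li: "locally_integrable \<phi>" "locally_integrable (grad \<phi>)"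
    using C0_infinityD(4)[OF \<phi>] continuous_on_grad[OF \<phi>] by (auto intro: locally_integrable_continuous)
  fix \<psi> :: "real^'a \<Rightarrow> real" and i :: 'a assume \<psi>: "\<psi> \<in> C0_infinity UNIV"
  obtain L where L: "0 < L" "\<And>x. \<bar>\<phi> x\<bar> \<le> L" "\<And>x y. \<bar>\<phi> x - \<phi> y\<bar> \<le> L * norm (x - y)"
    using test_bounds[OF \<phi>] by metis
  obtain M where M: "0 < M" "\<And>x. \<bar>\<psi> x\<bar> \<le> M" "\<And>x y. \<bar>\<psi> x - \<psi> y\<bar> \<le> M * norm (x - y)"
    using test_bounds[OF \<psi>] by metis
  obtain R where R: "\<And>x. R \<le> norm x \<Longrightarrow> \<phi> x = 0" using test_support_ball[OF \<phi>] by metis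
  have "(LINT x|lborel. \<phi> x * inner (grad \<psi> x) (axis i 1) + inner (grad \<phi> x) (axis i 1) * \<psi> x) = 0"
  proof (rule integral_derivative_eq_0[where f = "\<lambda>x. \<phi> x * \<psi> x" and L = "2 * L * M" and R = R])
    show "((\<lambda>x. \<phi> x * \<psi> x) has_derivative (\<lambda>h. \<phi> x * inner (grad \<psi> x) h + inner (grad \<phi> x) h * \<psi> x)) (at x)" for x
      by (intro has_derivative_mult has_derivative_grad[OF \<phi>] has_derivative_grad[OF \<psi>])
    show "\<bar>\<phi> x * \<psi> x - \<phi> y * \<psi> y\<bar> \<le> 2 * L * M * norm (x - y)" for x y
    proof -
      have "\<phi> x * \<psi> x - \<phi> y * \<psi> y = \<phi> x * (\<psi> x - \<psi> y) + (\<phi> x - \<phi> y) * \<psi> y" by (simp add: algebra_simps)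
      then have "\<bar>\<phi> x * \<psi> x - \<phi> y * \<psi> y\<bar> \<le> \<bar>\<phi> x\<bar> * \<bar>\<psi> x - \<psi> y\<bar> + \<bar>\<phi> x - \<phi> y\<bar> * \<bar>\<psi> y\<bar>"
        using abs_triangle_ineq by (simp add: abs_mult[symmetric])
      also have "\<dots> \<le> L * (M * norm (x - y)) + (L * norm (x - y)) * M"
        by (intro add_mono mult_mono L M) (use L(1) M(1) in auto)
      finally show ?thesis by (simp add: algebra_simps)
    qed
  qed (use R in auto)
  moreover have "integrable lborel (\<lambda>x. \<phi> x * pderivative i \<psi> x)"
    by (rule locally_integrable_mult_test[OF li(1) C0_infinityD(3,5)[OF \<psi>] test_support(2)[OF \<psi>]])
  moreover have "integrable lborel (\<lambda>x. grad \<phi> x $ i * \<psi> x)"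
    by (rule locally_integrable_mult_test[OF locally_integrable_nth[OF li(2)] C0_infinityD(4,5)[OF \<psi>] test_support(1)[OF \<psi>]])
  ultimately show "(LINT x|lborel. \<phi> x * pderivative i \<psi> x) = - (LINT x|lborel. grad \<phi> x $ i * \<psi> x)"
    by (simp add: inner_axis)
qed

section \<open>Finiteness of the Gagliardo seminorm of test functions\<close>

lemma nn_integral_affine:
  fixes f :: "real^'n::finite \<Rightarrow> ennreal"
  assumes "f \<in> borel_measurable borel" "c \<noteq> 0"
  shows "(\<integral>\<^sup>+x. f x \<partial>lborel) = ennreal (\<bar>c\<bar> ^ CARD('n)) * (\<integral>\<^sup>+x. f (t + c *\<^sub>R x) \<partial>lborel)"
  using assms by (subst lborel_affine[of c t]) (simp_all add: nn_integral_density nn_integral_distr nn_integral_cmult ennreal_power)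

text \<open>A dyadic form of integration in polar coordinates: a radial function is majorised by
  heights \<open>d j\<close> on balls of radius \<open>r j\<close>. Since the volume of a ball is
  proportional to \<open>r j ^ CARD('n)\<close>, the assumption on \<open>d j\<close> makes the
  layers a convergent geometric series.\<close>

lemma nn_integral_suminf_cball_finite:
  assumes q: "q < 0" and C: "0 \<le> C" and e: "\<And>j. r j = 2 powr e j"
    and d: "\<And>j::nat. 0 \<le> d j" "\<And>j. d j * r j ^ CARD('n) \<le> C * 2 powr (q * real j)"
  shows "(\<integral>\<^sup>+x. (\<Sum>j. ennreal (d j) * indicator (cball (0::real^'n::finite) (r j)) x) \<partial>lborel) < \<infinity>"
proof -
  have V: "0 \<le> unit_ball_vol (real CARD('n))" by simp
  have [measurable]: "cball (0::real^'n) (r j) \<in> sets borel" for j by (rule borel_closed) auto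
  have "(\<integral>\<^sup>+x. (\<Sum>j. ennreal (d j) * indicator (cball (0::real^'n) (r j)) x) \<partial>lborel) =
     (\<Sum>j. ennreal (d j) * emeasure lborel (cball (0::real^'n) (r j)))"
    by (subst nn_integral_suminf) (measurable, simp add: nn_integral_cmult_indicator)
  also have "\<dots> \<le> (\<Sum>j. ennreal (unit_ball_vol (real CARD('n)) * C * (2 powr q) ^ j))"
  proof (rule suminf_le)
    fix j
    have "ennreal (d j) * emeasure lborel (cball (0::real^'n) (r j)) =
        ennreal (unit_ball_vol (real CARD('n)) * (d j * r j ^ CARD('n)))"
      using d(1)[of j] by (subst emeasure_cball) (auto simp: e ennreal_mult'[symmetric] mult_ac)
    also have "\<dots> \<le> ennreal (unit_ball_vol (real CARD('n)) * (C * 2 powr (q * real j)))"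
      using d(2)[of j] by (intro ennreal_leI mult_left_mono V)
    finally show "ennreal (d j) * emeasure lborel (cball (0::real^'n) (r j)) \<le>
        ennreal (unit_ball_vol (real CARD('n)) * C * (2 powr q) ^ j)"
      by (simp add: powr_power mult_ac)
  qed auto
  also have "\<dots> < \<infinity>"
  proof -
    have "2 powr q < (1::real)" using q by (simp add: powr_less_one)
    then have "summable (\<lambda>j. unit_ball_vol (real CARD('n)) * C * (2 powr q) ^ j)"
      by (intro summable_mult summable_geometric) auto
    then have "(\<Sum>j. ennreal (unit_ball_vol (real CARD('n)) * C * (2 powr q) ^ j)) \<noteq> top"
      using C V by (intro ennreal_suminf_neq_top) auto
    then show ?thesis by (simp add: less_top)
  qed
  finally show ?thesis .
qed

lemma dyadic_interval:
  fixes x :: real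
  assumes "1 \<le> x"
  obtains j :: nat where "2 powr j \<le> x" "x \<le> 2 powr (real j + 1)"
proof -
  define j where "j = nat \<lfloor>log 2 x\<rfloor>"
  have "0 \<le> log 2 x" using assms by simp
  then have "real j \<le> log 2 x" "log 2 x \<le> real j + 1" by (auto simp: j_def)
  then show ?thesis using that[of j] assms by (simp add: le_log_iff log_le_iff)
qed

text \<open>This kernel majorises the Gagliardo integrand of a test function, whose increments are
  at most \<open>L * norm z\<close> and at most \<open>2 * L\<close>. It is integrable at 0 because
  \<open>p * (1 - s) > 0\<close> and at infinity because \<open>p * s > 0\<close>; these two numbers
  are the decay rates of the dyadic series.\<close>

lemma gagliardo_kernel_finite:
  fixes p s :: real
  assumes "1 < p" "0 < s" "s < 1"
  shows "(\<integral>\<^sup>+z. ennreal (min (norm z) 2 powr p / norm z powr (real CARD('n) + p * s)) \<partial>(lborel :: (real^'n::finite) measure)) < \<infinity>"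
proof -
  define N where "N = real CARD('n)"
  define a where "a = N + p * s"
  have a: "0 < a" using assms by (simp add: a_def N_def add_nonneg_pos)
  \<comment> \<open>\<open>d1 j\<close> bounds the kernel for norms between
    \<open>2 powr (- (j + 1))\<close> and \<open>2 powr (- j)\<close>, and \<open>d2 j\<close>
    bounds it for norms between \<open>2 powr j\<close> and \<open>2 powr (j + 1)\<close>. The radii
    are the outer ones of these layers.\<close>
  define r1 where "r1 j = 2 powr (- real j)" for j :: nat
  define d1 where "d1 j = 2 powr (- p * real j) * 2 powr (a * (real j + 1))" for j :: nat
  define r2 where "r2 j = 2 powr (real j + 1)" for j :: nat
  define d2 where "d2 j = 2 powr p * 2 powr (- a * real j)" for j :: nat
  define S1 where "S1 z = (\<Sum>j. ennreal (d1 j) * indicator (cball (0::real^'n) (r1 j)) z)" for z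
  define S2 where "S2 z = (\<Sum>j. ennreal (d2 j) * indicator (cball (0::real^'n) (r2 j)) z)" for z
  have pw: "(2 powr e) ^ n = 2 powr (e * real n)" for e :: real and n by (simp add: powr_power mult.commute)
  have tm: "ennreal (d j) \<le> (\<Sum>j. ennreal (d j) * indicator (cball (0::real^'n) (r j)) z)"
    if "norm z \<le> r j" for d r z and j :: nat
  proof -
    have "ennreal (d j) = (\<Sum>j\<in>{j}. ennreal (d j) * indicator (cball (0::real^'n) (r j)) z)" using that by simp
    also have "\<dots> \<le> (\<Sum>j. ennreal (d j) * indicator (cball (0::real^'n) (r j)) z)"
      by (rule sum_le_suminf) auto
    finally show ?thesis .
  qed
  have le: "ennreal (min (norm z) 2 powr p / norm z powr a) \<le> S1 z + S2 z" for z
  proof (cases "norm z \<ge> 1")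
    case True
    then obtain j :: nat where j: "2 powr j \<le> norm z" "norm z \<le> 2 powr (real j + 1)" by (rule dyadic_interval)
    have "min (norm z) 2 powr p / norm z powr a \<le> 2 powr p / (2 powr real j) powr a"
      using assms a j(1) by (intro frac_le powr_mono2) auto
    also have "\<dots> = d2 j" by (simp add: d2_def powr_powr powr_minus field_simps)
    finally have "ennreal (min (norm z) 2 powr p / norm z powr a) \<le> ennreal (d2 j)" by (rule ennreal_leI)
    also have "\<dots> \<le> S2 z" unfolding S2_def by (rule tm) (use j in \<open>simp add: r2_def\<close>)
    also have "S2 z \<le> S1 z + S2 z" by simp
    finally show ?thesis .
  next
    case False
    show ?thesis
    proof (cases "z = 0")
      case nz: False
      then have "1 \<le> 1 / norm z" using False by simp
      then obtain j :: nat where j: "2 powr j \<le> 1 / norm z" "1 / norm z \<le> 2 powr (real j + 1)" by (rule dyadic_interval)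
      have j1: "norm z \<le> 2 powr (- real j)" "2 powr (- (real j + 1)) \<le> norm z"
        using j nz by (simp_all only: powr_minus) (simp_all add: field_simps)
      have "min (norm z) 2 powr p / norm z powr a \<le> (2 powr (- real j)) powr p / (2 powr (- (real j + 1))) powr a"
        using assms a j1 by (intro frac_le powr_mono2) auto
      also have "\<dots> = d1 j" unfolding powr_powr d1_def
        by (simp add: powr_diff powr_minus field_simps flip: powr_add)
      finally have "ennreal (min (norm z) 2 powr p / norm z powr a) \<le> ennreal (d1 j)" by (rule ennreal_leI)
      also have "\<dots> \<le> S1 z" unfolding S1_def by (rule tm) (use j1 in \<open>simp add: r1_def\<close>)
      also have "S1 z \<le> S1 z + S2 z" by simp
      finally show ?thesis .
    qed simp
  qed
  have f1: "(\<integral>\<^sup>+z. S1 z \<partial>lborel) < \<infinity>" unfolding S1_def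
  proof (rule nn_integral_suminf_cball_finite[where q = "- p * (1 - s)" and C = "2 powr a"])
    show "d1 j * r1 j ^ CARD('n) \<le> 2 powr a * 2 powr (- p * (1 - s) * real j)" for j
      unfolding d1_def r1_def pw powr_add[symmetric]
      by (simp add: a_def N_def algebra_simps)
  qed (use assms in \<open>auto simp: r1_def d1_def\<close>)
  have f2: "(\<integral>\<^sup>+z. S2 z \<partial>lborel) < \<infinity>" unfolding S2_def
  proof (rule nn_integral_suminf_cball_finite[where q = "- p * s" and C = "2 powr (p + N)"])
    show "d2 j * r2 j ^ CARD('n) \<le> 2 powr (p + N) * 2 powr (- p * s * real j)" for j
      unfolding d2_def r2_def pw powr_add[symmetric]
      by (simp add: a_def N_def algebra_simps)
  qed (use assms in \<open>auto simp: r2_def d2_def\<close>)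
  have "(\<integral>\<^sup>+z. ennreal (min (norm z) 2 powr p / norm z powr a) \<partial>(lborel :: (real^'n) measure)) \<le>
      (\<integral>\<^sup>+z. S1 z \<partial>lborel) + (\<integral>\<^sup>+z. S2 z \<partial>lborel)"
  proof -
    have [measurable]: "cball (0::real^'n) r \<in> sets borel" for r by (rule borel_closed) auto
    have [measurable]: "S1 \<in> borel_measurable lborel" "S2 \<in> borel_measurable lborel"
      unfolding S1_def[abs_def] S2_def[abs_def] by measurable
    show ?thesis by (subst nn_integral_add[symmetric], simp, simp) (rule nn_integral_mono, rule le)
  qed
  also have "\<dots> < \<infinity>" using f1 f2 by simp
  finally show ?thesis by (simp add: a_def N_def)
qed

abbreviation "lborel2 \<equiv> lborel \<Otimes>\<^sub>M lborel"

lemma gagliardo_integrand_measurable [measurable]: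
  fixes u :: "real^'n::finite \<Rightarrow> real"
  assumes [measurable]: "u \<in> borel_measurable borel"
  shows "gagliardo_integrand p s u \<in> borel_measurable lborel2"
  unfolding gagliardo_integrand_def case_prod_beta by measurable

text \<open>The integrand vanishes unless \<open>x\<close> or \<open>y\<close> lies in a ball
  \<open>B\<close> that contains the support. By Tonelli and translation invariance each of these
  two parts contributes at most the volume of \<open>B\<close> times the integral of the kernel, up
  to the factor \<open>L powr p\<close>.\<close>

lemma test_gagliardo_integrable:
  fixes \<phi> :: "real^'n::finite \<Rightarrow> real"
  assumes \<phi>: "\<phi> \<in> C0_infinity \<Omega>" and ps: "1 < p" "0 < s" "s < 1"
  shows "integrable lborel2 (gagliardo_integrand p s \<phi>)"
proof -
  have [measurable]: "\<phi> \<in> borel_measurable borel"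
    using C0_infinityD(4)[OF \<phi>] by (rule borel_measurable_continuous_onI)
  obtain L where L: "0 < L" "\<And>x. \<bar>\<phi> x\<bar> \<le> L" "\<And>x y. \<bar>\<phi> x - \<phi> y\<bar> \<le> L * norm (x - y)"
    using test_bounds[OF \<phi>] by metis
  obtain R where R: "0 < R" "\<And>x. R \<le> norm x \<Longrightarrow> \<phi> x = 0" using test_support_ball[OF \<phi>] by metis
  define k where "k z = ennreal (min (norm z) 2 powr p / norm z powr (real CARD('n) + p * s))" for z :: "real^'n"
  define B where "B = cball (0::real^'n) R"
  have [measurable]: "k \<in> borel_measurable borel" unfolding k_def[abs_def] by measurable
  have [measurable]: "B \<in> sets borel" by (auto simp: B_def)
  define J where "J = (\<integral>\<^sup>+z. k z \<partial>lborel)"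
  have J: "J < \<infinity>" unfolding J_def k_def by (rule gagliardo_kernel_finite[OF ps])
  have le: "ennreal (gagliardo_integrand p s \<phi> (x, y)) \<le>
      ennreal (L powr p) * (indicator B x * k (x - y)) + ennreal (L powr p) * (indicator B y * k (x - y))" for x y
  proof (cases "x \<in> B \<or> y \<in> B")
    case True
    have "\<bar>\<phi> x - \<phi> y\<bar> \<le> L * min (norm (x - y)) 2"
      using L(2)[of x] L(2)[of y] L(3)[of x y] by (auto simp: min_def)
    then have "\<bar>\<phi> x - \<phi> y\<bar> powr p \<le> (L * min (norm (x - y)) 2) powr p"
      using ps by (intro powr_mono2) auto
    also have "\<dots> = L powr p * min (norm (x - y)) 2 powr p" using L(1) by (subst powr_mult) auto
    finally have "gagliardo_integrand p s \<phi> (x, y) \<le>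
       L powr p * (min (norm (x - y)) 2 powr p / norm (x - y) powr (real CARD('n) + p * s))"
      by (simp add: gagliardo_integrand_def divide_right_mono)
    then have "ennreal (gagliardo_integrand p s \<phi> (x, y)) \<le> ennreal (L powr p) * k (x - y)"
      by (simp add: k_def ennreal_mult'[symmetric] ennreal_leI)
    then show ?thesis using True by (auto simp: indicator_def intro: order_trans)
  next
    case False
    then have "\<phi> x = 0" "\<phi> y = 0" using R by (auto simp: B_def)
    then show ?thesis by (simp add: gagliardo_integrand_def)
  qed
  have in1: "(\<integral>\<^sup>+y. k (x - y) \<partial>lborel) = J" for x
    using nn_integral_affine[of k "-1" x] by (simp add: J_def)
  have in2: "(\<integral>\<^sup>+x. k (x - y) \<partial>lborel) = J" for y
    using nn_integral_affine[of k 1 "- y"] by (simp add: J_def)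
  have i1: "(\<integral>\<^sup>+z. indicator B (fst z) * k (fst z - snd z) \<partial>lborel2) = emeasure lborel B * J"
    by (subst lborel.nn_integral_fst[symmetric]) (auto simp: nn_integral_cmult in1 nn_integral_multc)
  have i2: "(\<integral>\<^sup>+z. indicator B (snd z) * k (fst z - snd z) \<partial>lborel2) = emeasure lborel B * J"
    by (subst lborel_pair.nn_integral_snd[symmetric]) (auto simp: nn_integral_cmult in2 nn_integral_multc)
  have fin: "emeasure lborel B * J < \<infinity>"
    using J emeasure_lborel_cball_finite[of "0::real^'n" R] by (auto simp: B_def ennreal_mult_less_top)
  have "(\<integral>\<^sup>+z. ennreal (gagliardo_integrand p s \<phi> z) \<partial>lborel2) \<le>
     (\<integral>\<^sup>+z. ennreal (L powr p) * (indicator B (fst z) * k (fst z - snd z)) +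
       ennreal (L powr p) * (indicator B (snd z) * k (fst z - snd z)) \<partial>lborel2)"
    using le by (intro nn_integral_mono) (metis prod.collapse)
  also have "\<dots> = ennreal (L powr p) * (emeasure lborel B * J) + ennreal (L powr p) * (emeasure lborel B * J)"
    by (simp add: nn_integral_add nn_integral_cmult i1 i2)
  also have "\<dots> < \<infinity>" using fin by (auto simp: ennreal_mult_less_top)
  finally have "(\<integral>\<^sup>+z. ennreal (gagliardo_integrand p s \<phi> z) \<partial>lborel2) < \<infinity>" .
  moreover have "norm (gagliardo_integrand p s \<phi> z) = gagliardo_integrand p s \<phi> z" for z
    by (auto simp: gagliardo_integrand_def case_prod_beta)
  ultimately show ?thesis by (intro integrableI_bounded) auto
qed

section \<open>Hardy's inequality for test functions\<close>

lemma ennreal_Lp_pow: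
  assumes "in_Lp p M f"
  shows "ennreal (Lp_pow p M f) = (\<integral>\<^sup>+x. ennreal (norm (f x) powr p) \<partial>M)"
  unfolding Lp_pow_def using in_LpD(2)[OF assms] by (subst nn_integral_eq_integral) auto

lemma in_LpI_nn:
  assumes "f \<in> borel_measurable M" "(\<integral>\<^sup>+x. ennreal (norm (f x) powr p) \<partial>M) \<le> ennreal c" "0 \<le> c"
  shows "in_Lp p M f" "Lp_pow p M f \<le> c"
proof -
  have [measurable]: "f \<in> borel_measurable M" by fact
  have "integrable M (\<lambda>x. norm (f x) powr p)"
    using assms(2) by (intro integrableI_bounded) (auto simp: less_top[symmetric] top_unique)
  then show f: "in_Lp p M f" using assms by (auto simp: in_Lp_def)
  have "ennreal (Lp_pow p M f) \<le> ennreal c" using ennreal_Lp_pow[OF f] assms(2) by simp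
  then show "Lp_pow p M f \<le> c" using assms(3) by simp
qed

text \<open>For \<open>a = N / p\<close> the bound \<open>1 / (a - 1)\<close> is
  \<open>p / (N - p)\<close>, the p-th root of \<open>hardy_opt\<close>; it does not depend on
  \<open>T\<close>.\<close>

lemma integral_powr_minus_le:
  fixes a T :: real
  assumes a: "1 < a" and T: "1 < T"
  shows "integrable lborel (\<lambda>t. indicator {1..T} t * t powr (- a))"
    and "0 < (LINT t|lborel. indicator {1..T} t * t powr (- a))"
    and "(LINT t|lborel. indicator {1..T} t * t powr (- a)) \<le> 1 / (a - 1)"
proof -
  have c: "continuous_on {1..T} (\<lambda>t. t powr (- a))"
    by (intro continuous_intros) auto
  show "integrable lborel (\<lambda>t. indicator {1..T} t * t powr (- a))"
    using borel_integrable_compact[OF _ c] by simp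
  have "(LINT t|lborel. indicator {1..T} t *\<^sub>R t powr (- a)) =
      - (T powr (1 - a)) / (a - 1) - (- (1 powr (1 - a)) / (a - 1))"
  proof (rule integral_FTC_atLeastAtMost[OF _ _ c])
    fix t :: real assume t: "1 \<le> t" "t \<le> T"
    have "((\<lambda>t. - (t powr (1 - a)) / (a - 1)) has_real_derivative - ((1 - a) * t powr (1 - a - 1)) / (a - 1)) (at t)"
      using t a by (auto intro!: derivative_eq_intros)
    also have "- ((1 - a) * t powr (1 - a - 1)) / (a - 1) = t powr (- a)" using a by (simp add: field_simps)
    finally show "((\<lambda>t. - (t powr (1 - a)) / (a - 1)) has_vector_derivative t powr (- a)) (at t within {1..T})"
      by (simp add: has_real_derivative_iff_has_vector_derivative has_vector_derivative_at_within)
  qed (use T in auto)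
  then have W: "(LINT t|lborel. indicator {1..T} t * t powr (- a)) = (1 - T powr (1 - a)) / (a - 1)"
    using a by (simp add: diff_divide_distrib)
  have "T powr (1 - a) < 1" using a T by (simp add: powr_less_one)
  then show "0 < (LINT t|lborel. indicator {1..T} t * t powr (- a))" using W a by simp
  show "(LINT t|lborel. indicator {1..T} t * t powr (- a)) \<le> 1 / (a - 1)"
    using W a by (simp add: divide_right_mono)
qed

text \<open>Jensen's inequality for the derivative of \<phi> along the ray through \<open>x\<close>,
  with weight \<open>t powr (- a)\<close> on \<open>[1, T]\<close>. The right-hand side is a
  nonnegative integral so that Tonelli's theorem can be applied after integrating over
  \<open>x\<close>.\<close>

lemma test_ray_bound:
  fixes \<phi> :: "real^'n::finite \<Rightarrow> real"
  assumes \<phi>: "\<phi> \<in> C0_infinity \<Omega>" and p: "1 < p" and a: "1 < a" and T: "1 < T"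
  defines "W \<equiv> (LINT t|lborel. indicator {1..T} t * t powr (- a))"
  shows "ennreal (\<bar>\<phi> (T *\<^sub>R x) - \<phi> x\<bar> powr p / norm x powr p) \<le> ennreal (W powr (p - 1)) *
    (\<integral>\<^sup>+t. indicator {1..T} t * ennreal (t powr (a * (p - 1)) * norm (grad \<phi> (t *\<^sub>R x)) powr p) \<partial>lborel)"
proof (cases "x = 0")
  case False
  note W = integral_powr_minus_le[OF a T]
  define g where "g t = inner (grad \<phi> (t *\<^sub>R x)) x" for t
  have cg: "continuous_on A (\<lambda>t. grad \<phi> (t *\<^sub>R x))" for A
    by (rule continuous_on_compose2[OF continuous_on_grad[OF \<phi>]]) (auto intro!: continuous_intros)
  have ch: "continuous_on {1..T} (\<lambda>t. t powr (a * (p - 1)) * norm (grad \<phi> (t *\<^sub>R x)) powr p)"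
    using p by (intro continuous_intros continuous_on_powr' cg) auto
  have ck: "continuous_on {1..T} (\<lambda>t. t powr (a * (p - 1)) * \<bar>g t\<bar> powr p)"
    using p unfolding g_def by (intro continuous_intros continuous_on_powr' cg) auto
  have F: "(LINT t|lborel. indicator {1..T} t *\<^sub>R g t) = \<phi> (T *\<^sub>R x) - \<phi> (1 *\<^sub>R x)"
  proof (rule integral_FTC_atLeastAtMost)
    fix t
    have "((\<lambda>t. \<phi> (t *\<^sub>R x)) has_derivative (\<lambda>h. inner (grad \<phi> (t *\<^sub>R x)) (h *\<^sub>R x))) (at t)"
      by (rule has_derivative_compose[where f = "\<lambda>t. t *\<^sub>R x" and g = \<phi> and g' = "inner (grad \<phi> (t *\<^sub>R x))"])
         (auto intro!: derivative_eq_intros has_derivative_grad[OF \<phi>])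
    then show "((\<lambda>t. \<phi> (t *\<^sub>R x)) has_vector_derivative g t) (at t within {1..T})"
      by (simp add: has_vector_derivative_def g_def has_derivative_at_withinI)
    show "continuous_on {1..T} g" unfolding g_def by (intro continuous_intros cg)
  qed (use T in auto)
  define w where "w t = indicator {1..T} t * t powr (- a)" for t :: real
  define f where "f t = indicator {1..T} t * g t" for t :: real
  have wf: "w t * (\<bar>f t\<bar> / w t) powr p = indicator {1..T} t * (t powr (a * (p - 1)) * \<bar>g t\<bar> powr p)" for t
  proof (cases "t \<in> {1..T}")
    case True
    then have t: "0 < t" by auto
    have "w t * (\<bar>f t\<bar> / w t) powr p = t powr (- a) * (\<bar>g t\<bar> * t powr a) powr p"
      using True t by (simp add: w_def f_def powr_minus divide_inverse)
    also have "\<dots> = (t powr (- a) * t powr (a * p)) * \<bar>g t\<bar> powr p"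
      using t by (simp add: powr_mult powr_powr)
    also have "t powr (- a) * t powr (a * p) = t powr (a * (p - 1))"
      by (simp add: powr_add[symmetric] algebra_simps)
    finally show ?thesis using True by simp
  qed (simp add: w_def)
  have "\<bar>\<phi> (T *\<^sub>R x) - \<phi> x\<bar> powr p \<le> W powr (p - 1) * (LINT t|lborel. w t * (\<bar>f t\<bar> / w t) powr p)"
  proof -
    have "\<bar>LINT t|lborel. f t\<bar> powr p \<le> (LINT t|lborel. w t) powr (p - 1) * (LINT t|lborel. w t * (\<bar>f t\<bar> / w t) powr p)"
    proof (rule jensen_powr[OF p])
      show "integrable lborel w" "0 < integral\<^sup>L lborel w" using W(1,2) by (auto simp: w_def[abs_def])
      have "continuous_on {1..T} g" unfolding g_def by (intro continuous_intros cg)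
      then show "integrable lborel f" using borel_integrable_compact[of "{1..T}" g] by (simp add: f_def[abs_def])
      show "integrable lborel (\<lambda>t. w t * (\<bar>f t\<bar> / w t) powr p)"
        unfolding wf using borel_integrable_compact[OF _ ck] by simp
    qed (auto simp: w_def f_def indicator_def)
    then show ?thesis using F by (simp add: W_def w_def f_def)
  qed
  also have "\<dots> \<le> W powr (p - 1) * (LINT t|lborel. norm x powr p * (indicator {1..T} t * (t powr (a * (p - 1)) * norm (grad \<phi> (t *\<^sub>R x)) powr p)))"
  proof (intro mult_left_mono integral_mono)
    fix t
    have "\<bar>g t\<bar> powr p \<le> (norm (grad \<phi> (t *\<^sub>R x)) * norm x) powr p"
      unfolding g_def using p by (intro powr_mono2 Cauchy_Schwarz_ineq2) auto
    then show "w t * (\<bar>f t\<bar> / w t) powr p \<le> norm x powr p * (indicator {1..T} t * (t powr (a * (p - 1)) * norm (grad \<phi> (t *\<^sub>R x)) powr p))"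
      unfolding wf by (cases "t \<in> {1..T}") (auto simp: powr_mult mult_ac intro!: mult_left_mono)
  qed (use borel_integrable_compact[OF _ ck] borel_integrable_compact[OF _ ch] in \<open>auto simp: wf\<close>)
  finally have "\<bar>\<phi> (T *\<^sub>R x) - \<phi> x\<bar> powr p / norm x powr p \<le>
      W powr (p - 1) * (LINT t|lborel. indicator {1..T} t * (t powr (a * (p - 1)) * norm (grad \<phi> (t *\<^sub>R x)) powr p))"
    using False by (simp add: field_simps)
  then have "ennreal (\<bar>\<phi> (T *\<^sub>R x) - \<phi> x\<bar> powr p / norm x powr p) \<le>
      ennreal (W powr (p - 1)) * ennreal (LINT t|lborel. indicator {1..T} t * (t powr (a * (p - 1)) * norm (grad \<phi> (t *\<^sub>R x)) powr p))"
    by (subst ennreal_mult'[symmetric]) (auto intro: ennreal_leI)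
  also have "ennreal (LINT t|lborel. indicator {1..T} t * (t powr (a * (p - 1)) * norm (grad \<phi> (t *\<^sub>R x)) powr p)) =
     (\<integral>\<^sup>+t. ennreal (indicator {1..T} t * (t powr (a * (p - 1)) * norm (grad \<phi> (t *\<^sub>R x)) powr p)) \<partial>lborel)"
    using borel_integrable_compact[OF _ ch] by (subst nn_integral_eq_integral) auto
  also have "\<dots> = (\<integral>\<^sup>+t. indicator {1..T} t * ennreal (t powr (a * (p - 1)) * norm (grad \<phi> (t *\<^sub>R x)) powr p) \<partial>lborel)"
    by (intro nn_integral_cong) (auto simp: indicator_def)
  finally show ?thesis .
qed simp

text \<open>The reciprocal of \<open>hardy_const\<close>: Hardy's inequality is proved with the
  constant on the gradient side.\<close>

definition hardy_opt :: "'n::finite itself \<Rightarrow> real \<Rightarrow> real" where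
  "hardy_opt _ p = (p / (real CARD('n) - p)) powr p"

text \<open>Only points \<open>t *\<^sub>R x\<close> with \<open>t\<close> in \<open>[1, T]\<close>
  are visited, so only the gradient on \<open>F\<close> enters. With \<open>F = UNIV\<close> this
  leads to the global inequality, with concentric balls to the local one.\<close>

lemma hardy_dilation:
  fixes \<phi> :: "real^'n::finite \<Rightarrow> real"
  assumes \<phi>: "\<phi> \<in> C0_infinity \<Omega>" and p: "1 < p" "p < real CARD('n)" and T: "1 < T"
    and [measurable]: "E \<in> sets borel" "F \<in> sets borel"
    and EF: "\<And>x t. x \<in> E \<Longrightarrow> 1 \<le> t \<Longrightarrow> t \<le> T \<Longrightarrow> t *\<^sub>R x \<in> F"
  shows "(\<integral>\<^sup>+x. ennreal (\<bar>indicator E x / norm x * (\<phi> (T *\<^sub>R x) - \<phi> x)\<bar> powr p) \<partial>lborel) \<le>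
    ennreal (hardy_opt TYPE('n) p) * (\<integral>\<^sup>+x. ennreal (norm (indicator F x *\<^sub>R grad \<phi> x) powr p) \<partial>lborel)"
proof -
  define N where "N = real CARD('n)"
  define a where "a = N / p"
  have a: "1 < a" using p by (simp add: a_def N_def)
  define W where "W = (LINT t|lborel. indicator {1..T} t * t powr (- a))"
  note Wf = integral_powr_minus_le[OF a T, folded W_def]
  have [measurable]: "\<phi> \<in> borel_measurable borel" "grad \<phi> \<in> borel_measurable borel"
    using C0_infinityD(4)[OF \<phi>] continuous_on_grad[OF \<phi>] by (auto intro: borel_measurable_continuous_onI)
  define G where "G = (\<integral>\<^sup>+x. ennreal (norm (indicator F x *\<^sub>R grad \<phi> x) powr p) \<partial>lborel)"
  define h where "h x = ennreal (norm (indicator F x *\<^sub>R grad \<phi> x) powr p)" for x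
  have [measurable]: "h \<in> borel_measurable borel" unfolding h_def[abs_def] by measurable
  have inner: "(\<integral>\<^sup>+x. h (t *\<^sub>R x) \<partial>lborel) = ennreal (t powr (- N)) * G" if "1 \<le> t" for t
  proof -
    have "G = ennreal (t ^ CARD('n)) * (\<integral>\<^sup>+x. h (t *\<^sub>R x) \<partial>lborel)"
      using nn_integral_affine[of h t 0] that by (simp add: G_def h_def)
    then have "ennreal (t powr (- N)) * G = ennreal (t powr (- N) * t ^ CARD('n)) * (\<integral>\<^sup>+x. h (t *\<^sub>R x) \<partial>lborel)"
      using that by (simp add: ennreal_mult' mult.assoc)
    also have "t powr (- N) * t ^ CARD('n) = 1"
      using that by (simp add: N_def powr_minus powr_realpow)
    finally show ?thesis by simp
  qed
  have "(\<integral>\<^sup>+x. ennreal (\<bar>indicator E x / norm x * (\<phi> (T *\<^sub>R x) - \<phi> x)\<bar> powr p) \<partial>lborel) \<le>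
    (\<integral>\<^sup>+x. ennreal (W powr (p - 1)) *
      (\<integral>\<^sup>+t. indicator {1..T} t * (ennreal (t powr (a * (p - 1))) * h (t *\<^sub>R x)) \<partial>lborel) \<partial>lborel)"
  proof (rule nn_integral_mono)
    fix x :: "real^'n"
    show "ennreal (\<bar>indicator E x / norm x * (\<phi> (T *\<^sub>R x) - \<phi> x)\<bar> powr p) \<le> ennreal (W powr (p - 1)) *
      (\<integral>\<^sup>+t. indicator {1..T} t * (ennreal (t powr (a * (p - 1))) * h (t *\<^sub>R x)) \<partial>lborel)"
    proof (cases "x \<in> E")
      case True
      then have "ennreal (\<bar>indicator E x / norm x * (\<phi> (T *\<^sub>R x) - \<phi> x)\<bar> powr p) =
         ennreal (\<bar>\<phi> (T *\<^sub>R x) - \<phi> x\<bar> powr p / norm x powr p)"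
        by (simp add: abs_div powr_divide)
      also have "\<dots> \<le> ennreal (W powr (p - 1)) *
        (\<integral>\<^sup>+t. indicator {1..T} t * ennreal (t powr (a * (p - 1)) * norm (grad \<phi> (t *\<^sub>R x)) powr p) \<partial>lborel)"
        unfolding W_def by (rule test_ray_bound[OF \<phi> p(1) a T])
      also have "(\<integral>\<^sup>+t. indicator {1..T} t * ennreal (t powr (a * (p - 1)) * norm (grad \<phi> (t *\<^sub>R x)) powr p) \<partial>lborel) =
         (\<integral>\<^sup>+t. indicator {1..T} t * (ennreal (t powr (a * (p - 1))) * h (t *\<^sub>R x)) \<partial>lborel)"
        using EF[OF True] by (intro nn_integral_cong) (auto simp: indicator_def h_def ennreal_mult')
      finally show ?thesis .
    qed simp
  qed
  also have "\<dots> = ennreal (W powr (p - 1)) *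
      (\<integral>\<^sup>+x. (\<integral>\<^sup>+t. indicator {1..T} t * (ennreal (t powr (a * (p - 1))) * h (t *\<^sub>R x)) \<partial>lborel) \<partial>lborel)"
    by (intro nn_integral_cmult) measurable
  also have "(\<integral>\<^sup>+x. (\<integral>\<^sup>+t. indicator {1..T} t * (ennreal (t powr (a * (p - 1))) * h (t *\<^sub>R x)) \<partial>lborel) \<partial>lborel) =
     (\<integral>\<^sup>+t. (\<integral>\<^sup>+x. indicator {1..T} t * (ennreal (t powr (a * (p - 1))) * h (t *\<^sub>R x)) \<partial>lborel) \<partial>lborel)"
    by (intro lborel_pair.Fubini') measurable
  also have "\<dots> = (\<integral>\<^sup>+t. ennreal (indicator {1..T} t * t powr (- a)) * G \<partial>lborel)"
  proof (intro nn_integral_cong)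
    fix t :: real
    show "(\<integral>\<^sup>+x. indicator {1..T} t * (ennreal (t powr (a * (p - 1))) * h (t *\<^sub>R x)) \<partial>lborel) =
       ennreal (indicator {1..T} t * t powr (- a)) * G"
    proof (cases "t \<in> {1..T}")
      case True
      have "(\<integral>\<^sup>+x. indicator {1..T} t * (ennreal (t powr (a * (p - 1))) * h (t *\<^sub>R x)) \<partial>lborel) =
        ennreal (t powr (a * (p - 1))) * (ennreal (t powr (- N)) * G)"
        using True by (simp add: nn_integral_cmult inner)
      also have "\<dots> = ennreal (t powr (a * (p - 1)) * t powr (- N)) * G"
        by (simp add: ennreal_mult' mult.assoc)
      also have "t powr (a * (p - 1)) * t powr (- N) = t powr (- a)"
        using p by (simp add: powr_add[symmetric] a_def field_simps)
      finally show ?thesis using True by simp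
    qed simp
  qed
  also have "\<dots> = ennreal W * G"
    using Wf(1) by (simp add: nn_integral_multc W_def nn_integral_eq_integral)
  also have "ennreal (W powr (p - 1)) * (ennreal W * G) = ennreal (W powr (p - 1) * W) * G"
    by (simp add: ennreal_mult' mult.assoc)
  also have "W powr (p - 1) * W = W powr p" using Wf(2) by (simp add: powr_diff)
  also have "ennreal (W powr p) * G \<le> ennreal (hardy_opt TYPE('n) p) * G"
  proof (intro mult_right_mono ennreal_leI)
    have "1 / (a - 1) = p / (N - p)" using p by (simp add: a_def field_simps N_def)
    then have "W \<le> p / (N - p)" using Wf(3) by simp
    then show "W powr p \<le> hardy_opt TYPE('n) p"
      unfolding hardy_opt_def N_def[symmetric] using p Wf(2) by (intro powr_mono2) auto
  qed simp
  finally show ?thesis unfolding G_def .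
qed

lemma test_in_Lp:
  assumes \<phi>: "\<phi> \<in> C0_infinity \<Omega>" and p: "1 < p"
  shows "in_Lp p lborel \<phi>" "in_Lp p lborel (grad \<phi>)"
proof -
  obtain L where L: "0 < L" "\<And>x. \<bar>\<phi> x\<bar> \<le> L" "\<And>x. norm (grad \<phi> x) \<le> L" using test_bounds[OF \<phi>] by metis
  obtain R where R: "\<And>x. R \<le> norm x \<Longrightarrow> \<phi> x = 0" "\<And>x. R \<le> norm x \<Longrightarrow> grad \<phi> x = 0" using test_support_ball[OF \<phi>] by metis
  have [measurable]: "\<phi> \<in> borel_measurable borel" "grad \<phi> \<in> borel_measurable borel"
    using C0_infinityD(4)[OF \<phi>] continuous_on_grad[OF \<phi>] by (auto intro: borel_measurable_continuous_onI)
  have "integrable lborel (\<lambda>x. norm (\<phi> x) powr p)"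
    by (rule integrable_bounded_vanishing[where B = "L powr p" and R = R]) (use L R p in \<open>auto intro!: powr_mono2\<close>)
  then show "in_Lp p lborel \<phi>" by (simp add: in_Lp_def)
  have "integrable lborel (\<lambda>x. norm (grad \<phi> x) powr p)"
    by (rule integrable_bounded_vanishing[where B = "L powr p" and R = R]) (use L R p in \<open>auto intro!: powr_mono2\<close>)
  then show "in_Lp p lborel (grad \<phi>)" by (simp add: in_Lp_def)
qed

lemma in_Lp_indicator:
  assumes "in_Lp p lborel g" "F \<in> sets borel" "1 < p"
  shows "in_Lp p lborel (\<lambda>x. indicator F x *\<^sub>R g x)"
    "Lp_pow p lborel (\<lambda>x. indicator F x *\<^sub>R g x) \<le> Lp_pow p lborel g"
proof -
  have [measurable]: "g \<in> borel_measurable borel" "F \<in> sets borel" using assms by (auto simp: in_Lp_def)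
  show "in_Lp p lborel (\<lambda>x. indicator F x *\<^sub>R g x)"
    "Lp_pow p lborel (\<lambda>x. indicator F x *\<^sub>R g x) \<le> Lp_pow p lborel g"
    by (rule in_Lp_bounded[OF assms(1) _ _ assms(3)]; auto simp: indicator_def)+
qed

text \<open>Away from the origin a single large \<open>T\<close> moves all points of
  \<open>E\<close> out of the support, so the increment of \<phi> is just its value. The constant
  does not depend on \<eta>, which permits removing the cutoff later.\<close>

lemma hardy_test_outside:
  fixes \<phi> :: "real^'n::finite \<Rightarrow> real"
  assumes \<phi>: "\<phi> \<in> C0_infinity \<Omega>" and p: "1 < p" "p < real CARD('n)" and \<eta>: "0 < \<eta>"
    and [measurable]: "E \<in> sets borel" and E: "\<And>x. x \<in> E \<Longrightarrow> \<eta> \<le> norm x"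
  shows "in_Lp p lborel (\<lambda>x. indicator E x / norm x * \<phi> x)"
    "Lp_pow p lborel (\<lambda>x. indicator E x / norm x * \<phi> x) \<le> hardy_opt TYPE('n) p * Lp_pow p lborel (grad \<phi>)"
proof -
  obtain R where R: "0 < R" "\<And>x. R \<le> norm x \<Longrightarrow> \<phi> x = 0" using test_support_ball[OF \<phi>] by metis
  have [measurable]: "\<phi> \<in> borel_measurable borel"
    using C0_infinityD(4)[OF \<phi>] by (auto intro: borel_measurable_continuous_onI)
  \<comment> \<open>\<open>T * \<eta>\<close> is at least the support radius \<open>R\<close>, and
    the summand 2 ensures \<open>1 < T\<close>.\<close>
  define T where "T = R / \<eta> + 2"
  have T: "1 < T" using R(1) \<eta> by (simp add: T_def add_pos_pos)
  have z: "\<phi> (T *\<^sub>R x) = 0" if "x \<in> E" for x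
  proof (rule R(2))
    have "R \<le> T * \<eta>" using \<eta> by (simp add: T_def field_simps)
    also have "\<dots> \<le> T * norm x" using E[OF that] T by (intro mult_left_mono) auto
    finally show "R \<le> norm (T *\<^sub>R x)" using T by simp
  qed
  have "(\<integral>\<^sup>+x. ennreal (norm (indicator E x / norm x * \<phi> x) powr p) \<partial>lborel) =
    (\<integral>\<^sup>+x. ennreal (\<bar>indicator E x / norm x * (\<phi> (T *\<^sub>R x) - \<phi> x)\<bar> powr p) \<partial>lborel)"
    using z by (intro nn_integral_cong) (auto simp: indicator_def)
  also have "\<dots> \<le> ennreal (hardy_opt TYPE('n) p) * (\<integral>\<^sup>+x. ennreal (norm (indicator UNIV x *\<^sub>R grad \<phi> x) powr p) \<partial>lborel)"
    by (rule hardy_dilation[OF \<phi> p T]) auto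
  also have "\<dots> = ennreal (hardy_opt TYPE('n) p * Lp_pow p lborel (grad \<phi>))"
    by (simp add: ennreal_Lp_pow[OF test_in_Lp(2)[OF \<phi> p(1)], symmetric] ennreal_mult' hardy_opt_def)
  finally have le: "(\<integral>\<^sup>+x. ennreal (norm (indicator E x / norm x * \<phi> x) powr p) \<partial>lborel) \<le> \<dots>" .
  show "in_Lp p lborel (\<lambda>x. indicator E x / norm x * \<phi> x)"
    "Lp_pow p lborel (\<lambda>x. indicator E x / norm x * \<phi> x) \<le> hardy_opt TYPE('n) p * Lp_pow p lborel (grad \<phi>)"
    using in_LpI_nn[OF _ le] by (auto simp: hardy_opt_def)
qed

text \<open>On \<open>E\<close> the function is split into \<open>\<phi> x - \<phi> (T x)\<close>
  and \<open>\<phi> (T x)\<close>. The first part sees only the gradient in the ball of radius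
  \<open>T * \<delta>\<close>. For the second part the substitution \<open>y = T x\<close> gives
  \<open>T powr p\<close> from the weight and \<open>T powr (- N)\<close> from the volume, and the
  global inequality bounds what remains.\<close>

lemma hardy_test_local:
  fixes \<phi> :: "real^'n::finite \<Rightarrow> real"
  assumes \<phi>: "\<phi> \<in> C0_infinity \<Omega>" and p: "1 < p" "p < real CARD('n)" and \<eta>: "0 < \<eta>" and T: "1 < T"
    and l: "0 < l" "l < 1" and \<delta>: "0 < \<delta>"
  defines "E \<equiv> {x. \<eta> \<le> norm x \<and> norm x < \<delta>}"
  shows "Lp_pow p lborel (\<lambda>x. indicator E x / norm x * \<phi> x) \<le>
    (1 - l) powr (1 - p) * (hardy_opt TYPE('n) p * Lp_pow p lborel (\<lambda>x. indicator (ball 0 (T * \<delta>)) x *\<^sub>R grad \<phi> x)) +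
    l powr (1 - p) * (T powr (p - real CARD('n)) * (hardy_opt TYPE('n) p * Lp_pow p lborel (grad \<phi>)))"
proof -
  have [measurable]: "E \<in> sets borel" unfolding E_def by measurable
  have [measurable]: "\<phi> \<in> borel_measurable borel"
    using C0_infinityD(4)[OF \<phi>] by (auto intro: borel_measurable_continuous_onI)
  define f where "f x = indicator E x / norm x * (\<phi> x - \<phi> (T *\<^sub>R x))" for x
  define g where "g x = indicator E x / norm x * \<phi> (T *\<^sub>R x)" for x
  define H where "H = hardy_opt TYPE('n) p"
  have H: "0 \<le> H" by (simp add: H_def hardy_opt_def)
  have [measurable]: "f \<in> borel_measurable borel" "g \<in> borel_measurable borel"
    unfolding f_def[abs_def] g_def[abs_def] by measurable
  note ind = in_Lp_indicator(1)[OF test_in_Lp(2)[OF \<phi> p(1)] _ p(1), of "ball 0 (T * \<delta>)"]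
  have "(\<integral>\<^sup>+x. ennreal (norm (f x) powr p) \<partial>lborel) = (\<integral>\<^sup>+x. ennreal (\<bar>indicator E x / norm x * (\<phi> (T *\<^sub>R x) - \<phi> x)\<bar> powr p) \<partial>lborel)"
    unfolding f_def by (intro nn_integral_cong) (simp add: abs_mult abs_minus_commute)
  also have "\<dots> \<le> ennreal (hardy_opt TYPE('n) p) *
      (\<integral>\<^sup>+x. ennreal (norm (indicator (ball 0 (T * \<delta>)) x *\<^sub>R grad \<phi> x) powr p) \<partial>lborel)"
  proof (rule hardy_dilation[OF \<phi> p T])
    fix x :: "real^'n" and t assume x: "x \<in> E" and t: "1 \<le> t" "t \<le> T"
    have "t * norm x \<le> T * norm x" using t by (intro mult_right_mono) auto
    also have "\<dots> < T * \<delta>" using x T by (auto simp: E_def)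
    finally show "t *\<^sub>R x \<in> ball 0 (T * \<delta>)" using t by simp
  qed auto
  also have "\<dots> = ennreal (H * Lp_pow p lborel (\<lambda>x. indicator (ball 0 (T * \<delta>)) x *\<^sub>R grad \<phi> x))"
    using ind by (simp add: ennreal_Lp_pow H_def ennreal_mult' hardy_opt_def)
  finally have f: "in_Lp p lborel f" "Lp_pow p lborel f \<le> H * Lp_pow p lborel (\<lambda>x. indicator (ball 0 (T * \<delta>)) x *\<^sub>R grad \<phi> x)"
    using H by (auto intro!: in_LpI_nn)
  define E' where "E' = {x::real^'n. T * \<eta> \<le> norm x \<and> norm x < T * \<delta>}"
  have [measurable]: "E' \<in> sets borel" unfolding E'_def by measurable
  define k where "k y = ennreal (norm (indicator E' y / norm y * \<phi> y) powr p)" for y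
  have [measurable]: "k \<in> borel_measurable borel" unfolding k_def[abs_def] by measurable
  have out: "in_Lp p lborel (\<lambda>x. indicator E' x / norm x * \<phi> x)"
    "Lp_pow p lborel (\<lambda>x. indicator E' x / norm x * \<phi> x) \<le> H * Lp_pow p lborel (grad \<phi>)"
    unfolding H_def using T \<eta> by (intro hardy_test_outside[OF \<phi> p, of "T * \<eta>"]; auto simp: E'_def)+
  have gk: "ennreal (norm (g x) powr p) = ennreal (T powr p) * k (T *\<^sub>R x)" for x
  proof -
    have "T *\<^sub>R x \<in> E' \<longleftrightarrow> x \<in> E" using T by (auto simp: E_def E'_def)
    then have "norm (g x) powr p = T powr p * norm (indicator E' (T *\<^sub>R x) / norm (T *\<^sub>R x) * \<phi> (T *\<^sub>R x)) powr p"
      using T by (cases "x \<in> E") (auto simp: g_def powr_mult[symmetric] abs_mult)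
    then show ?thesis by (simp add: k_def ennreal_mult')
  qed
  have "(\<integral>\<^sup>+x. ennreal (norm (g x) powr p) \<partial>lborel) = ennreal (T powr p) * (\<integral>\<^sup>+x. k (T *\<^sub>R x) \<partial>lborel)"
    unfolding gk by (intro nn_integral_cmult) measurable
  also have "\<dots> = ennreal (T powr (p - real CARD('n))) * (ennreal (T ^ CARD('n)) * (\<integral>\<^sup>+x. k (T *\<^sub>R x) \<partial>lborel))"
  proof -
    have "T powr p = T powr (p - real CARD('n)) * T ^ CARD('n)"
      using T by (simp add: powr_diff powr_realpow)
    then show ?thesis using T by (simp add: ennreal_mult' mult.assoc)
  qed
  also have "ennreal (T ^ CARD('n)) * (\<integral>\<^sup>+x. k (T *\<^sub>R x) \<partial>lborel) = (\<integral>\<^sup>+x. k x \<partial>lborel)"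
    using nn_integral_affine[of k T 0] T by simp
  also have "(\<integral>\<^sup>+x. k x \<partial>lborel) \<le> ennreal (H * Lp_pow p lborel (grad \<phi>))"
    unfolding k_def ennreal_Lp_pow[OF out(1), symmetric] by (intro ennreal_leI out)
  finally have "(\<integral>\<^sup>+x. ennreal (norm (g x) powr p) \<partial>lborel) \<le> ennreal (T powr (p - real CARD('n)) * (H * Lp_pow p lborel (grad \<phi>)))"
    by (simp add: ennreal_mult' mult_left_mono)
  then have g: "in_Lp p lborel g" "Lp_pow p lborel g \<le> T powr (p - real CARD('n)) * (H * Lp_pow p lborel (grad \<phi>))"
    using H by (auto intro!: in_LpI_nn)
  have "(\<lambda>x. indicator E x / norm x * \<phi> x) = (\<lambda>x. f x + g x)"
    by (auto simp: f_def g_def right_diff_distrib)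
  then have "Lp_pow p lborel (\<lambda>x. indicator E x / norm x * \<phi> x) \<le>
     (1 - l) powr (1 - p) * Lp_pow p lborel f + l powr (1 - p) * Lp_pow p lborel g"
    using in_Lp_add(2)[OF f(1) g(1) p(1) l] by simp
  also have "\<dots> \<le> (1 - l) powr (1 - p) * (H * Lp_pow p lborel (\<lambda>x. indicator (ball 0 (T * \<delta>)) x *\<^sub>R grad \<phi> x)) +
    l powr (1 - p) * (T powr (p - real CARD('n)) * (H * Lp_pow p lborel (grad \<phi>)))"
    by (intro add_mono mult_left_mono f g) auto
  finally show ?thesis by (simp add: H_def)
qed

section \<open>Functions of finite norm\<close>

text \<open>It is linear in \<open>u\<close>, and the p-th power of its L^p norm on the product
  space is the Gagliardo energy. The nonlocal energy can thus be handled exactly like the gradient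
  energy, as the norm of a linear image.\<close>

definition gagliardo_quotient :: "real \<Rightarrow> real \<Rightarrow> (real^'n::finite \<Rightarrow> real) \<Rightarrow> (real^'n) \<times> (real^'n) \<Rightarrow> real" where
  "gagliardo_quotient p s u = (\<lambda>(x, y). (u x - u y) / norm (x - y) powr (real CARD('n) / p + s))"

lemma gagliardo_quotient_measurable [measurable]:
  fixes u :: "real^'n::finite \<Rightarrow> real"
  assumes [measurable]: "u \<in> borel_measurable borel"
  shows "gagliardo_quotient p s u \<in> borel_measurable lborel2"
  unfolding gagliardo_quotient_def case_prod_beta by measurable

lemma gagliardo_quotient_linear:
  "gagliardo_quotient p s (\<lambda>x. a * u x + b * v x) z = a * gagliardo_quotient p s u z + b * gagliardo_quotient p s v z"
  by (auto simp: gagliardo_quotient_def case_prod_beta add_divide_distrib[symmetric] algebra_simps)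

lemma gagliardo_quotient_powr:
  "0 < p \<Longrightarrow> norm (gagliardo_quotient p s u z) powr p = gagliardo_integrand p s u z"
  by (auto simp: gagliardo_quotient_def gagliardo_integrand_def case_prod_beta abs_div powr_divide powr_powr algebra_simps)

lemma in_Lp_gagliardo_quotient:
  assumes "0 < p" "u \<in> borel_measurable borel"
  shows "in_Lp p lborel2 (gagliardo_quotient p s u) \<longleftrightarrow>
      integrable lborel2 (gagliardo_integrand p s u)"
    "Lp_pow p lborel2 (gagliardo_quotient p s u) = gagliardo p s u"
  unfolding in_Lp_def Lp_pow_def gagliardo_def gagliardo_quotient_powr[OF assms(1)] using assms(2) by auto

lemma gagliardo_nonneg: "0 \<le> gagliardo p s u"
  unfolding gagliardo_def by (intro integral_nonneg_AE) (auto simp: gagliardo_integrand_def)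

text \<open>The space \<open>X_space\<close> without the requirement of being approximable by test functions: unlike
  \<open>X_space\<close> itself, it is evidently closed under differences.\<close>

definition X_finite :: "real \<Rightarrow> real \<Rightarrow> (real^'n::finite) set \<Rightarrow> (real^'n \<Rightarrow> real) set" where
  "X_finite p s \<Omega> = {u.
     u \<in> borel_measurable borel \<and>
     (AE x in lborel. x \<notin> \<Omega> \<longrightarrow> u x = 0) \<and>
     (\<exists>g. has_weak_gradient u g) \<and>
     integrable lborel (\<lambda>x. norm (weak_gradient u x) powr p) \<and>
     integrable lborel2 (gagliardo_integrand p s u)}"

locale X_setting =
  fixes \<Omega> :: "(real^'n::finite) set" and p s :: real
  assumes p: "1 < p" "p < real CARD('n)" and s: "0 < s" "s < 1"
    and \<Omega>: "open \<Omega>" "bounded \<Omega>"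
begin

abbreviation "X \<equiv> X_space p s \<Omega>"
abbreviation "XF \<equiv> X_finite p s \<Omega>"
abbreviation "norm_pow f \<equiv> Lp_pow p lborel f"
abbreviation "Lp f \<equiv> in_Lp p lborel f"
abbreviation "energy v \<equiv> gagliardo p s v"
abbreviation "G v \<equiv> norm_pow (weak_gradient v)"

lemma X_subset_XF: "X \<subseteq> XF"
  by (auto simp: X_space_def X_finite_def)

lemma XF_D:
  assumes "v \<in> XF"
  shows "v \<in> borel_measurable borel" "AE x in lborel. x \<notin> \<Omega> \<longrightarrow> v x = 0"
    "has_weak_gradient v (weak_gradient v)" "Lp (weak_gradient v)"
    "in_Lp p lborel2 (gagliardo_quotient p s v)"
    "Lp_pow p lborel2 (gagliardo_quotient p s v) = energy v"
proof -
  show m: "v \<in> borel_measurable borel" "AE x in lborel. x \<notin> \<Omega> \<longrightarrow> v x = 0"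
    using assms by (auto simp: X_finite_def)
  show w: "has_weak_gradient v (weak_gradient v)"
    using assms weak_gradient_works(1) by (auto simp: X_finite_def)
  then have "weak_gradient v \<in> borel_measurable borel"
    by (auto simp: has_weak_gradient_def intro: locally_integrable_borel_measurable)
  then show "Lp (weak_gradient v)" using assms by (auto simp: X_finite_def in_Lp_def)
  show "in_Lp p lborel2 (gagliardo_quotient p s v)"
    "Lp_pow p lborel2 (gagliardo_quotient p s v) = energy v"
    using assms p in_Lp_gagliardo_quotient[OF _ m(1), of p s] by (auto simp: X_finite_def)
qed

lemma X_norm_powr: "X_norm p s v powr p = G v + energy v"
proof -
  have "0 \<le> G v + energy v" using gagliardo_nonneg[of p s v] by simp
  then show ?thesis using p by (simp add: X_norm_def powr_powr Lp_pow_def)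
qed

lemma X_norm_nonneg: "0 \<le> X_norm p s v"
  by (simp add: X_norm_def)

text \<open>The gradient identity holds only a.e., because \<open>weak_gradient\<close> picks an
  arbitrary representative.\<close>

lemma XF_linear:
  assumes "u \<in> XF" "v \<in> XF"
  shows "(\<lambda>x. a * u x + b * v x) \<in> XF"
    "AE x in lborel. weak_gradient (\<lambda>x. a * u x + b * v x) x = a *\<^sub>R weak_gradient u x + b *\<^sub>R weak_gradient v x"
proof -
  let ?w = "\<lambda>x. a * u x + b * v x"
  note u = XF_D[OF assms(1)] and v = XF_D[OF assms(2)]
  note wg = has_weak_gradient_linear[OF u(3) v(3), of a b]
  show ae: "AE x in lborel. weak_gradient ?w x = a *\<^sub>R weak_gradient u x + b *\<^sub>R weak_gradient v x"
    by (rule weak_gradient_works(2)[OF wg])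
  have wm: "weak_gradient ?w \<in> borel_measurable borel"
    using weak_gradient_works(1)[OF wg] by (auto simp: has_weak_gradient_def intro: locally_integrable_borel_measurable)
  have wl: "Lp (\<lambda>x. a *\<^sub>R weak_gradient u x + b *\<^sub>R weak_gradient v x)"
    by (intro in_Lp_add in_Lp_scaleR u v p)
  have "Lp (weak_gradient ?w)"
    by (rule in_Lp_cong_AE[OF wl]) (use wm ae in auto)
  then have 1: "integrable lborel (\<lambda>x. norm (weak_gradient ?w x) powr p)" by (rule in_LpD)
  have m: "?w \<in> borel_measurable borel" using u(1) v(1) by measurable
  have "in_Lp p lborel2 (\<lambda>z. a *\<^sub>R gagliardo_quotient p s u z + b *\<^sub>R gagliardo_quotient p s v z)"
    by (intro in_Lp_add in_Lp_scaleR u v p)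
  then have "in_Lp p lborel2 (gagliardo_quotient p s ?w)"
    by (simp add: gagliardo_quotient_linear[abs_def])
  then have 2: "integrable lborel2 (gagliardo_integrand p s ?w)"
    using p in_Lp_gagliardo_quotient(1)[OF _ m, of p s] by auto
  have "AE x in lborel. x \<notin> \<Omega> \<longrightarrow> ?w x = 0" using u(2) v(2) by eventually_elim auto
  then show "?w \<in> XF" using 1 2 m wg by (auto simp: X_finite_def)
qed

lemma XF_diff:
  assumes "u \<in> XF" "v \<in> XF"
  shows "(\<lambda>x. u x - v x) \<in> XF"
    "AE x in lborel. weak_gradient (\<lambda>x. u x - v x) x = weak_gradient u x - weak_gradient v x"
  using XF_linear[OF assms, of 1 "-1"] by auto

lemma test_XF:
  assumes "\<phi> \<in> C0_infinity \<Omega>"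
  shows "\<phi> \<in> XF" "AE x in lborel. weak_gradient \<phi> x = grad \<phi> x"
proof -
  note wg = test_has_weak_gradient[OF assms]
  show ae: "AE x in lborel. weak_gradient \<phi> x = grad \<phi> x" by (rule weak_gradient_works(2)[OF wg])
  have "weak_gradient \<phi> \<in> borel_measurable borel"
    using weak_gradient_works(1)[OF wg] by (auto simp: has_weak_gradient_def intro: locally_integrable_borel_measurable)
  then have "Lp (weak_gradient \<phi>)"
    using ae by (intro in_Lp_cong_AE[OF test_in_Lp(2)[OF assms p(1)]]) auto
  then have "integrable lborel (\<lambda>x. norm (weak_gradient \<phi> x) powr p)" by (rule in_LpD)
  moreover have "\<phi> \<in> borel_measurable borel" using C0_infinityD(4)[OF assms] by (rule borel_measurable_continuous_onI)
  moreover have "\<phi> x = 0" if "x \<notin> \<Omega>" for x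
    using test_support(1)[OF assms, of x] C0_infinityD(6)[OF assms] that by auto
  ultimately show "\<phi> \<in> XF"
    using wg test_gagliardo_integrable[OF assms p(1) s] by (auto simp: X_finite_def)
qed

text \<open>A fractional Poincare inequality: on a ball at positive distance from \<open>\<Omega>\<close> the function
  vanishes, so that \<open>\<bar>v x\<bar> = \<bar>v x - v y\<bar>\<close> for all \<open>y\<close> in that ball.\<close>

lemma XF_Lp_bound:
  obtains C where "0 < C" "\<And>v. v \<in> XF \<Longrightarrow> Lp v"
    "\<And>v. v \<in> XF \<Longrightarrow> norm_pow v \<le> C * energy v"
proof -
  obtain r where r: "0 < r" "\<And>x. x \<in> \<Omega> \<Longrightarrow> norm x \<le> r" using \<Omega>(2) by (auto simp: bounded_pos)
  obtain e :: "real^'n" where e: "norm e = 1" using norm_axis_1 by blast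
  \<comment> \<open>The unit ball \<open>B\<close> around \<open>c\<close> avoids the ball of radius
    \<open>r\<close> that contains \<Omega>. Points of \<open>B\<close> have norm at most
    \<open>r + 3\<close>, so their distance to points of \<Omega> is at most
    \<open>r + (r + 3) = D\<close>.\<close>
  define c where "c = (r + 2) *\<^sub>R e"
  have c: "norm c = r + 2" using e r by (simp add: c_def)
  define B where "B = ball c 1"
  define D where "D = 2 * r + 3"
  define a where "a = real CARD('n) + p * s"
  have a: "0 < a" using p s by (simp add: a_def add_nonneg_pos)
  have B: "norm (x - y) \<le> D \<and> y \<notin> \<Omega>" if "x \<in> \<Omega>" "y \<in> B" for x y
  proof -
    have "norm (c - y) < 1" using that by (simp add: B_def dist_norm)
    then have "norm y \<le> r + 3" "r + 1 < norm y"
      using norm_triangle_ineq4[of c "c - y"] norm_triangle_ineq[of "c - y" y] c by auto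
    then show ?thesis using r(2)[OF that(1)] r(2)[of y] norm_triangle_ineq4[of x y] by (auto simp: D_def)
  qed
  define V where "V = unit_ball_vol (real CARD('n))"
  have V: "0 < V" by (simp add: V_def)
  have eV: "emeasure lborel B = ennreal V" unfolding B_def by (subst emeasure_ball) (auto simp: V_def)
  have [measurable]: "B \<in> sets borel" by (auto simp: B_def)
  have main: "Lp v \<and> norm_pow v \<le> D powr a / V * energy v" if v: "v \<in> XF" for v
  proof -
    note [measurable] = XF_D(1)[OF v]
    have gi: "integrable lborel2 (gagliardo_integrand p s v)" using v by (auto simp: X_finite_def)
    have "ennreal V * (\<integral>\<^sup>+x. ennreal (norm (v x) powr p) \<partial>lborel) =
       (\<integral>\<^sup>+x. (\<integral>\<^sup>+y. indicator B y * ennreal (norm (v x) powr p) \<partial>lborel) \<partial>lborel)"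
      by (subst nn_integral_cmult[symmetric]) (auto simp: nn_integral_multc eV)
    also have "\<dots> \<le> (\<integral>\<^sup>+x. (\<integral>\<^sup>+y. ennreal (D powr a) * ennreal (gagliardo_integrand p s v (x, y)) \<partial>lborel) \<partial>lborel)"
    proof (rule nn_integral_mono_AE)
      show "AE x in lborel. (\<integral>\<^sup>+y. indicator B y * ennreal (norm (v x) powr p) \<partial>lborel) \<le>
         (\<integral>\<^sup>+y. ennreal (D powr a) * ennreal (gagliardo_integrand p s v (x, y)) \<partial>lborel)"
        using XF_D(2)[OF v]
      proof eventually_elim
        case (elim x)
        show ?case
        proof (rule nn_integral_mono_AE)
          show "AE y in lborel. indicator B y * ennreal (norm (v x) powr p) \<le>
            ennreal (D powr a) * ennreal (gagliardo_integrand p s v (x, y))"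
            using XF_D(2)[OF v]
          proof eventually_elim
            case y: (elim y)
            show ?case
            proof (cases "v x \<noteq> 0 \<and> y \<in> B")
              case True
              then have x: "x \<in> \<Omega>" using elim by auto
              have n: "norm (x - y) \<le> D" "v y = 0" "x \<noteq> y" using B[OF x, of y] True y x by auto
              have "norm (x - y) powr a \<le> D powr a" using n(1) a by (intro powr_mono2) auto
              then have "\<bar>v x\<bar> powr p * norm (x - y) powr a \<le> D powr a * \<bar>v x\<bar> powr p"
                by (metis mult.commute mult_left_mono powr_ge_zero)
              then have "\<bar>v x\<bar> powr p \<le> D powr a * gagliardo_integrand p s v (x, y)"
                using n by (simp add: gagliardo_integrand_def pos_le_divide_eq flip: a_def)
              then have "ennreal (\<bar>v x\<bar> powr p) \<le> ennreal (D powr a * gagliardo_integrand p s v (x, y))" by (rule ennreal_leI)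
              then show ?thesis using True by (simp add: ennreal_mult')
            qed (use p in auto)
          qed
        qed
      qed
    qed
    also have "\<dots> = ennreal (D powr a) * (\<integral>\<^sup>+z. ennreal (gagliardo_integrand p s v z) \<partial>lborel2)"
      by (subst lborel.nn_integral_fst) (auto simp: nn_integral_cmult)
    also have "(\<integral>\<^sup>+z. ennreal (gagliardo_integrand p s v z) \<partial>lborel2) = ennreal (energy v)"
      using gi unfolding gagliardo_def by (intro nn_integral_eq_integral) (auto simp: gagliardo_integrand_def)
    finally have "ennreal (1 / V) * (ennreal V * (\<integral>\<^sup>+x. ennreal (norm (v x) powr p) \<partial>lborel)) \<le>
        ennreal (1 / V) * (ennreal (D powr a) * ennreal (energy v))" by (rule mult_left_mono) simp
    also have "ennreal (1 / V) * (ennreal V * (\<integral>\<^sup>+x. ennreal (norm (v x) powr p) \<partial>lborel)) =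
       (\<integral>\<^sup>+x. ennreal (norm (v x) powr p) \<partial>lborel)"
      using V by (simp add: mult.assoc[symmetric] ennreal_mult'[symmetric])
    also have "ennreal (1 / V) * (ennreal (D powr a) * ennreal (energy v)) = ennreal (D powr a / V * energy v)"
      using V gagliardo_nonneg[of p s v] by (simp add: ennreal_mult'[symmetric])
    finally show ?thesis using V gagliardo_nonneg[of p s v] by (auto intro!: in_LpI_nn)
  qed
  have "0 < D powr a / V" using V r by (simp add: D_def)
  then show ?thesis by (rule that) (use main in auto)
qed

lemma XF_in_Lp: "v \<in> XF \<Longrightarrow> Lp v"
  by (meson XF_Lp_bound)

text \<open>The norm controls gradients directly and the functions themselves through the fractional
  Poincare inequality. Both convergences are needed to carry Hardy's inequality over from test
  functions.\<close>

lemma X_approx: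
  assumes u: "u \<in> X"
  obtains \<phi> where "\<And>k. \<phi> k \<in> C0_infinity \<Omega>"
    "(\<lambda>k. norm_pow (\<lambda>x. grad (\<phi> k) x - weak_gradient u x)) \<longlonglongrightarrow> 0"
    "(\<lambda>k. norm_pow (\<lambda>x. \<phi> k x - u x)) \<longlonglongrightarrow> 0"
proof -
  have uF: "u \<in> XF" using u X_subset_XF by auto
  obtain \<phi> where \<phi>: "\<And>k. \<phi> k \<in> C0_infinity \<Omega>" "(\<lambda>k. X_norm p s (\<lambda>x. u x - \<phi> k x)) \<longlonglongrightarrow> 0"
    using u by (auto simp: X_space_def)
  let ?w = "\<lambda>k x. u x - \<phi> k x"
  have w: "?w k \<in> XF" "AE x in lborel. weak_gradient (?w k) x = weak_gradient u x - grad (\<phi> k) x" for k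
  proof -
    show "?w k \<in> XF" using XF_diff[OF uF test_XF(1)[OF \<phi>(1)]] by auto
    show "AE x in lborel. weak_gradient (?w k) x = weak_gradient u x - grad (\<phi> k) x"
      using XF_diff(2)[OF uF test_XF(1)[OF \<phi>(1)], of k] test_XF(2)[OF \<phi>(1), of k] by eventually_elim simp
  qed
  have "(\<lambda>k. X_norm p s (?w k) powr p) \<longlonglongrightarrow> 0 powr p"
    by (rule tendsto_powr'[OF \<phi>(2) tendsto_const]) (use p in \<open>auto intro!: always_eventually X_norm_nonneg\<close>)
  then have lim: "(\<lambda>k. G (?w k) + energy (?w k)) \<longlonglongrightarrow> 0" by (simp add: X_norm_powr)
  obtain C where C: "0 < C" "\<And>v. v \<in> XF \<Longrightarrow> norm_pow v \<le> C * energy v" using XF_Lp_bound by metis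
  have 1: "(\<lambda>k. norm_pow (\<lambda>x. grad (\<phi> k) x - weak_gradient u x)) \<longlonglongrightarrow> 0"
  proof (rule tendsto_sandwich[OF _ _ tendsto_const lim])
    have "norm_pow (\<lambda>x. grad (\<phi> k) x - weak_gradient u x) = G (?w k)" for k
      unfolding Lp_pow_def
    proof (rule integral_cong_AE)
      show "AE x in lborel. norm (grad (\<phi> k) x - weak_gradient u x) powr p = norm (weak_gradient (?w k) x) powr p"
        using w(2)[of k] by eventually_elim (simp add: norm_minus_commute)
    qed (use in_LpD(1)[OF XF_D(4)[OF w(1)]] in_LpD(1)[OF XF_D(4)[OF uF]] in_LpD(1)[OF test_in_Lp(2)[OF \<phi>(1) p(1)]] in auto)
    then show "\<forall>\<^sub>F k in sequentially. norm_pow (\<lambda>x. grad (\<phi> k) x - weak_gradient u x) \<le> G (?w k) + energy (?w k)"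
      by (auto intro!: always_eventually gagliardo_nonneg)
  qed auto
  have 2: "(\<lambda>k. norm_pow (\<lambda>x. \<phi> k x - u x)) \<longlonglongrightarrow> 0"
  proof (rule tendsto_sandwich[OF _ _ tendsto_const])
    have "norm_pow (\<lambda>x. \<phi> k x - u x) = norm_pow (?w k)" for k
      unfolding Lp_pow_def by (simp add: abs_minus_commute)
    also have "norm_pow (?w k) \<le> C * (G (?w k) + energy (?w k))" for k
      using C(2)[OF w(1), of k] C(1) by (simp add: distrib_left add_increasing)
    finally show "\<forall>\<^sub>F k in sequentially. norm_pow (\<lambda>x. \<phi> k x - u x) \<le> C * (G (?w k) + energy (?w k))" by simp
    show "(\<lambda>k. C * (G (?w k) + energy (?w k))) \<longlonglongrightarrow> 0" using tendsto_mult_left[OF lim, of C] by simp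
  qed auto
  show ?thesis by (rule that[OF \<phi>(1) 1 2])
qed

lemma in_Lp_mult_bounded:
  fixes m :: "real^'n \<Rightarrow> real" and f :: "real^'n \<Rightarrow> 'b::euclidean_space"
  assumes "Lp f" "m \<in> borel_measurable borel" "\<And>x. \<bar>m x\<bar> \<le> B"
  shows "Lp (\<lambda>x. m x *\<^sub>R f x)" "norm_pow (\<lambda>x. m x *\<^sub>R f x) \<le> B powr p * norm_pow f"
proof -
  have B: "0 \<le> B" using assms(3)[of undefined] by linarith
  have [measurable]: "f \<in> borel_measurable borel" "m \<in> borel_measurable borel" using assms by (auto simp: in_Lp_def)
  note * = in_Lp_bounded[OF in_Lp_scaleR(1)[OF assms(1), of B], of "\<lambda>x. m x *\<^sub>R f x", OF _ _ p(1)]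
  have ae: "AE x in lborel. norm (m x *\<^sub>R f x) \<le> norm (B *\<^sub>R f x)"
    using assms(3) B by (intro AE_I2) (auto intro!: mult_right_mono)
  show "Lp (\<lambda>x. m x *\<^sub>R f x)" "norm_pow (\<lambda>x. m x *\<^sub>R f x) \<le> B powr p * norm_pow f"
    using *[OF _ ae] in_Lp_scaleR(2)[OF assms(1), of B] B by auto
qed

lemma Lp_conv_mult:
  fixes m :: "real^'n \<Rightarrow> real" and f :: "real^'n \<Rightarrow> 'b::euclidean_space"
  assumes F: "\<And>k. Lp (F k)" and f: "Lp f" and m: "m \<in> borel_measurable borel" "\<And>x. \<bar>m x\<bar> \<le> B"
    and lim: "(\<lambda>k. norm_pow (\<lambda>x. F k x - f x)) \<longlonglongrightarrow> 0"
  shows "(\<lambda>k. norm_pow (\<lambda>x. m x *\<^sub>R F k x)) \<longlonglongrightarrow> norm_pow (\<lambda>x. m x *\<^sub>R f x)"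
proof (rule Lp_conv_pow[OF p(1)])
  show "Lp (\<lambda>x. m x *\<^sub>R F k x)" "Lp (\<lambda>x. m x *\<^sub>R f x)" for k
    by (intro in_Lp_mult_bounded(1)[OF _ m] F f)+
  show "(\<lambda>k. norm_pow (\<lambda>x. m x *\<^sub>R F k x - m x *\<^sub>R f x)) \<longlonglongrightarrow> 0"
  proof (rule tendsto_sandwich[OF _ _ tendsto_const])
    show "(\<lambda>k. B powr p * norm_pow (\<lambda>x. F k x - f x)) \<longlonglongrightarrow> 0" using tendsto_mult_left[OF lim, of "B powr p"] by simp
    show "\<forall>\<^sub>F k in sequentially. norm_pow (\<lambda>x. m x *\<^sub>R F k x - m x *\<^sub>R f x) \<le> B powr p * norm_pow (\<lambda>x. F k x - f x)"
      using in_Lp_mult_bounded(2)[OF in_Lp_diff(1)[OF F f p(1)] m] by (simp add: scaleR_diff_right)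
  qed auto
qed

text \<open>Gradients of the approximating test functions vanish outside \<Omega> and converge in
  L^p. This identifies the gradient integral over \<Omega> in the functional with the one over the
  whole space in the norm.\<close>

lemma weak_gradient_zero_outside:
  assumes u: "u \<in> X"
  shows "AE x in lborel. x \<notin> \<Omega> \<longrightarrow> weak_gradient u x = 0"
proof -
  have uF: "u \<in> XF" using u X_subset_XF by auto
  obtain \<phi> where \<phi>: "\<And>k. \<phi> k \<in> C0_infinity \<Omega>"
    "(\<lambda>k. norm_pow (\<lambda>x. grad (\<phi> k) x - weak_gradient u x)) \<longlonglongrightarrow> 0" by (rule X_approx[OF u]) blast
  have [measurable]: "\<Omega> \<in> sets borel" using \<Omega>(1) by auto
  note i = in_Lp_mult_bounded(1)[OF XF_D(4)[OF uF], of "indicator (- \<Omega>)" 1]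
  have "(\<lambda>k. norm_pow (\<lambda>x. indicator (- \<Omega>) x *\<^sub>R grad (\<phi> k) x)) \<longlonglongrightarrow> norm_pow (\<lambda>x. indicator (- \<Omega>) x *\<^sub>R weak_gradient u x)"
    by (rule Lp_conv_mult[OF test_in_Lp(2)[OF \<phi>(1) p(1)] XF_D(4)[OF uF] _ _ \<phi>(2), of _ 1]) (auto simp: indicator_def)
  moreover have "indicator (- \<Omega>) x *\<^sub>R grad (\<phi> k) x = 0" for k x
  proof (cases "x \<in> \<Omega>")
    case False
    then have "x \<notin> closure {x. \<phi> k x \<noteq> 0}" using C0_infinityD(6)[OF \<phi>(1)] by blast
    then show ?thesis using test_support(2)[OF \<phi>(1)] by (simp add: vec_eq_iff)
  qed simp
  ultimately have "(\<lambda>k::nat. norm_pow (\<lambda>x::real^'n. 0 :: real^'n)) \<longlonglongrightarrow> norm_pow (\<lambda>x. indicator (- \<Omega>) x *\<^sub>R weak_gradient u x)"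
    by simp
  then have "norm_pow (\<lambda>x. indicator (- \<Omega>) x *\<^sub>R weak_gradient u x) = 0"
    by (rule LIMSEQ_unique) (simp add: Lp_pow_def)
  then have "AE x in lborel. norm (indicator (- \<Omega>) x *\<^sub>R weak_gradient u x) powr p = 0"
    using in_LpD(2)[OF i] unfolding Lp_pow_def by (subst (asm) integral_nonneg_eq_0_iff_AE) (auto simp: indicator_def)
  then show ?thesis by eventually_elim (auto simp: indicator_def)
qed

lemma inverse_weight_bound:
  fixes x :: "real^'n"
  assumes "\<And>x::real^'n. x \<in> E \<Longrightarrow> \<eta> \<le> norm x" "0 < \<eta>"
  shows "\<bar>indicator E x / norm x\<bar> \<le> 1 / \<eta>"
proof (cases "x \<in> E")
  case True
  then show ?thesis using assms(1)[OF True] assms(2) by (simp add: frac_le)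
qed (use assms in simp)

lemma hardy_X_outside:
  assumes u: "u \<in> X" and \<eta>: "0 < \<eta>" and E[measurable]: "E \<in> sets borel" "\<And>x. x \<in> E \<Longrightarrow> \<eta> \<le> norm x"
  shows "Lp (\<lambda>x. indicator E x / norm x * u x)"
    "norm_pow (\<lambda>x. indicator E x / norm x * u x) \<le> hardy_opt TYPE('n) p * G u"
proof -
  have uF: "u \<in> XF" using u X_subset_XF by auto
  obtain \<phi> where \<phi>: "\<And>k. \<phi> k \<in> C0_infinity \<Omega>"
    "(\<lambda>k. norm_pow (\<lambda>x. grad (\<phi> k) x - weak_gradient u x)) \<longlonglongrightarrow> 0"
    "(\<lambda>k. norm_pow (\<lambda>x. \<phi> k x - u x)) \<longlonglongrightarrow> 0" by (rule X_approx[OF u]) blast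
  have m: "(\<lambda>x::real^'n. indicator E x / norm x) \<in> borel_measurable borel" by measurable
  note mb = inverse_weight_bound[OF E(2) \<eta>]
  show "Lp (\<lambda>x. indicator E x / norm x * u x)"
    using in_Lp_mult_bounded(1)[OF XF_in_Lp[OF uF] m mb] by simp
  have "(\<lambda>k. norm_pow (\<lambda>x. indicator E x / norm x * \<phi> k x)) \<longlonglongrightarrow> norm_pow (\<lambda>x. indicator E x / norm x * u x)"
    using Lp_conv_mult[OF test_in_Lp(1)[OF \<phi>(1) p(1)] XF_in_Lp[OF uF] m mb \<phi>(3)] by simp
  moreover have "(\<lambda>k. hardy_opt TYPE('n) p * norm_pow (grad (\<phi> k))) \<longlonglongrightarrow> hardy_opt TYPE('n) p * G u"
    by (intro tendsto_mult_left Lp_conv_pow[OF p(1) test_in_Lp(2)[OF \<phi>(1) p(1)] XF_D(4)[OF uF] \<phi>(2)])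
  ultimately show "norm_pow (\<lambda>x. indicator E x / norm x * u x) \<le> hardy_opt TYPE('n) p * G u"
    by (rule LIMSEQ_le) (use hardy_test_outside(2)[OF \<phi>(1) p \<eta> E] in auto)
qed

text \<open>The weight \<open>1 / norm x\<close> is unbounded, so it cannot be multiplied into an
  L^p limit. Estimates are therefore passed to the limit with the weight cut off at \<eta>, and
  monotone convergence removes the cutoff because \<open>c\<close> is the same for all
  \<eta>.\<close>

lemma Lp_weight_exhaust:
  fixes v :: "real^'n \<Rightarrow> real"
  assumes [measurable]: "v \<in> borel_measurable borel" "F \<in> sets borel" and c: "0 \<le> c"
    and i: "\<And>\<eta>. 0 < \<eta> \<Longrightarrow> Lp (\<lambda>x. indicator (F \<inter> {x. \<eta> \<le> norm x}) x / norm x * v x)"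
    and le: "\<And>\<eta>. 0 < \<eta> \<Longrightarrow> norm_pow (\<lambda>x. indicator (F \<inter> {x. \<eta> \<le> norm x}) x / norm x * v x) \<le> c"
  shows "Lp (\<lambda>x. indicator F x / norm x * v x)" "norm_pow (\<lambda>x. indicator F x / norm x * v x) \<le> c"
proof -
  define h where "h k x = ennreal (norm (indicator (F \<inter> {x. inverse (real (Suc k)) \<le> norm x}) x / norm x * v x) powr p)" for k and x :: "real^'n"
  have mono: "inverse (real (Suc (Suc k))) \<le> inverse (real (Suc k))" for k by (rule le_imp_inverse_le) auto
  have "(\<lambda>k. \<integral>\<^sup>+x. h k x \<partial>lborel) \<longlonglongrightarrow> (\<integral>\<^sup>+x. ennreal (norm (indicator F x / norm x * v x) powr p) \<partial>lborel)"
  proof (rule nn_integral_LIMSEQ)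
    show "incseq h"
      using order_trans[OF mono] by (intro incseq_SucI le_funI) (auto simp: h_def indicator_def)
    show "h k \<in> borel_measurable lborel" for k unfolding h_def[abs_def] by measurable
    fix x :: "real^'n"
    show "(\<lambda>k. h k x) \<longlonglongrightarrow> ennreal (norm (indicator F x / norm x * v x) powr p)"
    \<comment> \<open>At the origin division by \<open>norm x\<close> yields 0, so all terms are
      0.\<close>
    proof (cases "x = 0")
      case False
      then have "eventually (\<lambda>k. inverse (real (Suc k)) < norm x) sequentially"
        using order_tendstoD(2)[OF LIMSEQ_inverse_real_of_nat] by simp
      then show ?thesis
        by (intro tendsto_eventually, elim eventually_mono) (auto simp: h_def indicator_def)
    qed (use p in \<open>simp add: h_def\<close>)
  qed
  moreover have "(\<integral>\<^sup>+x. h k x \<partial>lborel) \<le> ennreal c" for k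
  proof -
    have "0 < inverse (real (Suc k))" by simp
    from ennreal_Lp_pow[OF i[OF this]] le[OF this] show ?thesis
      unfolding h_def by (metis ennreal_leI)
  qed
  ultimately have "(\<integral>\<^sup>+x. ennreal (norm (indicator F x / norm x * v x) powr p) \<partial>lborel) \<le> ennreal c"
    by (intro LIMSEQ_le_const2) auto
  from in_LpI_nn[OF _ this c] show "Lp (\<lambda>x. indicator F x / norm x * v x)" "norm_pow (\<lambda>x. indicator F x / norm x * v x) \<le> c"
    by auto
qed

lemma hardy_X:
  assumes u: "u \<in> X"
  shows "Lp (\<lambda>x. u x / norm x)" "norm_pow (\<lambda>x. u x / norm x) \<le> hardy_opt TYPE('n) p * G u"
proof -
  have uF: "u \<in> XF" using u X_subset_XF by auto
  have "0 \<le> hardy_opt TYPE('n) p * G u" by (simp add: hardy_opt_def)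
  note * = Lp_weight_exhaust[OF XF_D(1)[OF uF] _ this, of UNIV, simplified]
  have E: "{x::real^'n. \<eta> \<le> norm x} \<in> sets borel" for \<eta> by measurable
  show "Lp (\<lambda>x. u x / norm x)" "norm_pow (\<lambda>x. u x / norm x) \<le> hardy_opt TYPE('n) p * G u"
    by (rule *; use hardy_X_outside[OF u _ E] in simp)+
qed

lemma hardy_X_local:
  assumes u: "u \<in> X" and T: "1 < T" and l: "0 < l" "l < 1" and \<delta>: "0 < \<delta>"
  shows "norm_pow (\<lambda>x. indicator (ball 0 \<delta>) x / norm x * u x) \<le>
    (1 - l) powr (1 - p) * (hardy_opt TYPE('n) p * norm_pow (\<lambda>x. indicator (ball 0 (T * \<delta>)) x *\<^sub>R weak_gradient u x)) +
    l powr (1 - p) * (T powr (p - real CARD('n)) * (hardy_opt TYPE('n) p * G u))" (is "_ \<le> ?c")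
proof -
  have uF: "u \<in> XF" using u X_subset_XF by auto
  have H: "0 \<le> hardy_opt TYPE('n) p" by (simp add: hardy_opt_def)
  have c: "0 \<le> ?c" using H by auto
  obtain \<phi> where \<phi>: "\<And>k. \<phi> k \<in> C0_infinity \<Omega>"
    "(\<lambda>k. norm_pow (\<lambda>x. grad (\<phi> k) x - weak_gradient u x)) \<longlonglongrightarrow> 0"
    "(\<lambda>k. norm_pow (\<lambda>x. \<phi> k x - u x)) \<longlonglongrightarrow> 0" by (rule X_approx[OF u]) blast
  show ?thesis
  proof (rule Lp_weight_exhaust(2)[OF XF_D(1)[OF uF] _ c])
    fix \<eta> :: real assume \<eta>: "0 < \<eta>"
    define E where "E = ball 0 \<delta> \<inter> {x::real^'n. \<eta> \<le> norm x}"
    have [measurable]: "E \<in> sets borel" unfolding E_def by measurable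
    have E: "\<eta> \<le> norm x" if "x \<in> E" for x using that by (simp add: E_def)
    have E': "E = {x. \<eta> \<le> norm x \<and> norm x < \<delta>}" by (auto simp: E_def)
    have m: "(\<lambda>x::real^'n. indicator E x / norm x) \<in> borel_measurable borel" by measurable
    note mb = inverse_weight_bound[OF E \<eta>]
    show "Lp (\<lambda>x. indicator (ball 0 \<delta> \<inter> {x. \<eta> \<le> norm x}) x / norm x * u x)"
      unfolding E_def[symmetric] by (rule hardy_X_outside(1)[OF u \<eta> _ E]) simp_all
    have "(\<lambda>k. norm_pow (\<lambda>x. indicator E x / norm x * \<phi> k x)) \<longlonglongrightarrow> norm_pow (\<lambda>x. indicator E x / norm x * u x)"
      using Lp_conv_mult[OF test_in_Lp(1)[OF \<phi>(1) p(1)] XF_in_Lp[OF uF] m mb \<phi>(3)] by simp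
    moreover have "(\<lambda>k. (1 - l) powr (1 - p) * (hardy_opt TYPE('n) p * norm_pow (\<lambda>x. indicator (ball 0 (T * \<delta>)) x *\<^sub>R grad (\<phi> k) x)) +
        l powr (1 - p) * (T powr (p - real CARD('n)) * (hardy_opt TYPE('n) p * norm_pow (grad (\<phi> k))))) \<longlonglongrightarrow> ?c"
      by (intro tendsto_add tendsto_mult_left Lp_conv_pow[OF p(1) test_in_Lp(2)[OF \<phi>(1) p(1)] XF_D(4)[OF uF] \<phi>(2)]
          Lp_conv_mult[OF test_in_Lp(2)[OF \<phi>(1) p(1)] XF_D(4)[OF uF] _ _ \<phi>(2), of _ 1])
         (auto simp: indicator_def)
    ultimately show "norm_pow (\<lambda>x. indicator (ball 0 \<delta> \<inter> {x. \<eta> \<le> norm x}) x / norm x * u x) \<le> ?c"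
      unfolding E_def[symmetric]
      by (rule LIMSEQ_le) (use hardy_test_local[OF \<phi>(1) p \<eta> T l \<delta>] in \<open>auto simp: E'\<close>)
  qed simp
qed

section \<open>Weak convergence\<close>

text \<open>A bounded linear map from \<open>X\<close> into some L^p space. The gradient on a set,
  the Gagliardo quotient and the weighted function are of this kind, so one argument gives the lower
  semicontinuity of all their energies. Measurability and linearity are asked on \<open>XF\<close>,
  where \<open>XF_linear\<close> provides closure under linear combinations; the bounds are asked on
  \<open>X\<close>, where Hardy's inequality is available.\<close>

definition X_operator :: "'a measure \<Rightarrow> ((real^'n \<Rightarrow> real) \<Rightarrow> 'a \<Rightarrow> 'b::euclidean_space) \<Rightarrow> bool" where
  "X_operator M D \<longleftrightarrow>
    (\<forall>v\<in>XF. D v \<in> borel_measurable M) \<and>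
    (\<forall>u\<in>XF. \<forall>v\<in>XF. \<forall>a b. AE z in M. D (\<lambda>x. a * u x + b * v x) z = a *\<^sub>R D u z + b *\<^sub>R D v z) \<and>
    (\<forall>v\<in>X. in_Lp p M (D v)) \<and>
    (\<exists>K\<ge>0. \<forall>v\<in>X. Lp_pow p M (D v) \<le> K * X_norm p s v powr p)"

lemma X_operator_pairing_dual:
  assumes D: "X_operator M D" and g: "in_Lp p M g"
  shows "(\<lambda>v. Lp_pairing p M g (D v)) \<in> X_dual p s \<Omega>"
proof -
  obtain K where K: "0 \<le> K" "\<And>v. v \<in> X \<Longrightarrow> Lp_pow p M (D v) \<le> K * X_norm p s v powr p"
    using D by (auto simp: X_operator_def)
  have [measurable]: "g \<in> borel_measurable M" using g by (rule in_LpD)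
  have lin: "Lp_pairing p M g (D (\<lambda>x. a * u x + b * v x)) = a * Lp_pairing p M g (D u) + b * Lp_pairing p M g (D v)"
    if "u \<in> X" "v \<in> X" for u v a b
  proof -
    have F: "u \<in> XF" "v \<in> XF" using that X_subset_XF by auto
    have [measurable]: "D u \<in> borel_measurable M" "D v \<in> borel_measurable M" "D (\<lambda>x. a * u x + b * v x) \<in> borel_measurable M"
      using D F XF_linear(1)[OF F, of a b] by (auto simp: X_operator_def)
    have i: "in_Lp p M (D u)" "in_Lp p M (D v)" using D that by (auto simp: X_operator_def)
    have "AE z in M. D (\<lambda>x. a * u x + b * v x) z = a *\<^sub>R D u z + b *\<^sub>R D v z" using D F by (auto simp: X_operator_def)
    then have "AE z in M. norm (g z) powr (p - 2) * inner (g z) (D (\<lambda>x. a * u x + b * v x) z) =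
      a * (norm (g z) powr (p - 2) * inner (g z) (D u z)) + b * (norm (g z) powr (p - 2) * inner (g z) (D v z))"
      by eventually_elim (simp add: inner_add_right distrib_left mult_ac)
    then have "Lp_pairing p M g (D (\<lambda>x. a * u x + b * v x)) =
       (LINT z|M. a * (norm (g z) powr (p - 2) * inner (g z) (D u z)) + b * (norm (g z) powr (p - 2) * inner (g z) (D v z)))"
      unfolding Lp_pairing_def by (intro integral_cong_AE) auto
    also have "\<dots> = a * Lp_pairing p M g (D u) + b * Lp_pairing p M g (D v)"
      using Lp_pairing_integrable[OF g i(1) p(1)] Lp_pairing_integrable[OF g i(2) p(1)]
      unfolding Lp_pairing_def by simp
    finally show ?thesis .
  qed
  have bd: "\<bar>Lp_pairing p M g (D v)\<bar> \<le> (Lp_pow p M g + 1) * K powr (1 / p) * X_norm p s v" if "v \<in> X" for v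
  proof -
    have "\<bar>Lp_pairing p M g (D v)\<bar> \<le> (Lp_pow p M g + 1) * Lp_pow p M (D v) powr (1 / p)"
      using D that by (intro Lp_pairing_bound g p) (auto simp: X_operator_def)
    also have "\<dots> \<le> (Lp_pow p M g + 1) * (K * X_norm p s v powr p) powr (1 / p)"
      using p K(2)[OF that] Lp_pow_nonneg[of p M g] by (intro mult_left_mono powr_mono2) auto
    also have "(K * X_norm p s v powr p) powr (1 / p) = K powr (1 / p) * X_norm p s v"
      using K(1) p X_norm_nonneg[of v] by (simp add: powr_mult powr_powr)
    finally show ?thesis by (simp add: mult.assoc)
  qed
  \<comment> \<open>Additivity is \<open>lin\<close> with both coefficients 1, and homogeneity is
    \<open>lin\<close> with second coefficient 0.\<close>
  show ?thesis
    unfolding X_dual_def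
    using lin[of _ _ 1 1] lin[of u u c 0 for u c] bd by (auto intro!: exI[of _ "(Lp_pow p M g + 1) * K powr (1 / p)"])
qed

text \<open>The supporting hyperplane at \<open>D u\<close> lies below the energy, agrees with it at
  \<open>u\<close>, and is continuous along the weakly convergent sequence because the pairing with
  \<open>D u\<close> is a bounded functional.\<close>

lemma X_operator_lsc:
  assumes D: "X_operator M D" and U: "X_weakly_converges p s \<Omega> U u" and e: "0 < e"
  shows "eventually (\<lambda>k. Lp_pow p M (D u) - e \<le> Lp_pow p M (D (U k))) sequentially"
proof -
  have i: "in_Lp p M (D u)" "in_Lp p M (D (U k))" for k using D U by (auto simp: X_operator_def X_weakly_converges_def)
  let ?F = "\<lambda>v. Lp_pairing p M (D u) (D v)"
  have "(\<lambda>k. ?F (U k)) \<longlonglongrightarrow> ?F u"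
    using U X_operator_pairing_dual[OF D i(1)] by (auto simp: X_weakly_converges_def)
  then have "(\<lambda>k. Lp_pow p M (D u) + p * (?F (U k) - ?F u)) \<longlonglongrightarrow> Lp_pow p M (D u) + p * (?F u - ?F u)"
    by (intro tendsto_intros)
  then have "eventually (\<lambda>k. Lp_pow p M (D u) - e < Lp_pow p M (D u) + p * (?F (U k) - ?F u)) sequentially"
    by (rule order_tendstoD) (use e in simp)
  then show ?thesis
  proof eventually_elim
    case (elim k)
    then show ?case using Lp_pairing_tangent[OF i(1) i(2)[of k] p(1)] by linarith
  qed
qed

lemma gradient_operator:
  assumes [measurable]: "F \<in> sets borel"
  shows "X_operator lborel (\<lambda>v x. indicator F x *\<^sub>R weak_gradient v x)"
  unfolding X_operator_def
proof (intro conjI ballI allI)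
  fix v assume v: "v \<in> XF"
  have [measurable]: "weak_gradient v \<in> borel_measurable borel" using in_LpD(1)[OF XF_D(4)[OF v]] by simp
  show "(\<lambda>x. indicator F x *\<^sub>R weak_gradient v x) \<in> borel_measurable lborel" by simp
next
  fix u v :: "real^'n \<Rightarrow> real" and a b assume uv: "u \<in> XF" "v \<in> XF"
  show "AE x in lborel. indicator F x *\<^sub>R weak_gradient (\<lambda>x. a * u x + b * v x) x =
    a *\<^sub>R indicator F x *\<^sub>R weak_gradient u x + b *\<^sub>R indicator F x *\<^sub>R weak_gradient v x"
    using XF_linear(2)[OF uv, of a b] by eventually_elim (simp add: indicator_def)
next
  fix v assume "v \<in> X"
  then show "Lp (\<lambda>x. indicator F x *\<^sub>R weak_gradient v x)"
    using X_subset_XF by (intro in_Lp_indicator XF_D p) auto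
next
  have "norm_pow (\<lambda>x. indicator F x *\<^sub>R weak_gradient v x) \<le> 1 * X_norm p s v powr p" if "v \<in> X" for v
    using in_Lp_indicator(2)[OF XF_D(4) assms p(1), of v] that X_subset_XF gagliardo_nonneg[of p s v]
    by (auto simp: X_norm_powr)
  then show "\<exists>K\<ge>0. \<forall>v\<in>X. norm_pow (\<lambda>x. indicator F x *\<^sub>R weak_gradient v x) \<le> K * X_norm p s v powr p"
    by (intro exI[of _ 1]) auto
qed

lemma gagliardo_operator: "X_operator lborel2 (gagliardo_quotient p s)"
  unfolding X_operator_def
proof (intro conjI ballI allI)
  have "Lp_pow p lborel2 (gagliardo_quotient p s v) \<le> 1 * X_norm p s v powr p" if "v \<in> X" for v
    using XF_D(6)[of v] that X_subset_XF by (auto simp: X_norm_powr)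
  then show "\<exists>K\<ge>0. \<forall>v\<in>X. Lp_pow p lborel2 (gagliardo_quotient p s v) \<le> K * X_norm p s v powr p"
    by (intro exI[of _ 1]) auto
  show "in_Lp p lborel2 (gagliardo_quotient p s v)" if "v \<in> X" for v
    using that X_subset_XF by (intro XF_D) auto
  show "gagliardo_quotient p s v \<in> borel_measurable lborel2" if "v \<in> XF" for v
    using in_LpD(1)[OF XF_D(5)[OF that]] .
qed (auto simp: gagliardo_quotient_linear)

lemma weight_operator:
  assumes [measurable]: "w \<in> borel_measurable borel" and K: "0 \<le> K"
    and i: "\<And>v. v \<in> X \<Longrightarrow> Lp (\<lambda>x. w x * v x)"
    and le: "\<And>v. v \<in> X \<Longrightarrow> norm_pow (\<lambda>x. w x * v x) \<le> K * X_norm p s v powr p"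
  shows "X_operator lborel (\<lambda>v x. w x * v x :: real)"
  unfolding X_operator_def
proof (intro conjI ballI allI)
  fix v assume "v \<in> XF"
  from XF_D(1)[OF this] show "(\<lambda>x. w x * v x) \<in> borel_measurable lborel" by simp
qed (use i le K in \<open>auto simp: algebra_simps\<close>)

section \<open>Ball averages and strong convergence in L^p\<close>

definition ball_average :: "real \<Rightarrow> (real^'n \<Rightarrow> real) \<Rightarrow> real^'n \<Rightarrow> real" where
  "ball_average \<epsilon> v x = (LINT y|lborel. indicator (ball x \<epsilon>) y * v y) / measure lborel (ball x \<epsilon>)"

lemma content_ball_cart: "0 < \<epsilon> \<Longrightarrow> measure lborel (ball (x::real^'n) \<epsilon>) = unit_ball_vol (real CARD('n)) * \<epsilon> ^ CARD('n)"
  by (subst content_ball) auto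

lemma indicator_ball_Lp:
  "Lp (indicator (ball (x::real^'n) \<epsilon>) :: _ \<Rightarrow> real)"
  "norm_pow (indicator (ball (x::real^'n) \<epsilon>) :: _ \<Rightarrow> real) = measure lborel (ball x \<epsilon>)"
proof -
  have *: "norm (indicator (ball x \<epsilon>) y :: real) powr p = indicator (ball x \<epsilon>) y" for y
    by (auto simp: indicator_def)
  show "Lp (indicator (ball x \<epsilon>) :: _ \<Rightarrow> real)"
    unfolding in_Lp_def * using emeasure_lborel_ball_finite[of x \<epsilon>]
    by (intro conjI integrable_real_indicator borel_measurable_indicator) auto
  show "norm_pow (indicator (ball x \<epsilon>) :: _ \<Rightarrow> real) = measure lborel (ball x \<epsilon>)"
    unfolding Lp_pow_def * by simp
qed

text \<open>On an indicator the nonlinear factor of the pairing disappears. Integration over a ball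
  is therefore a pairing, and the bounds for pairings apply to ball averages.\<close>

lemma ball_pairing: "Lp_pairing p lborel (indicator (ball x \<epsilon>)) v = (LINT y|lborel. indicator (ball x \<epsilon>) y * v y)"
  unfolding Lp_pairing_def by (intro Bochner_Integration.integral_cong) (auto simp: indicator_def)

lemma ball_integrable:
  assumes "Lp v"
  shows "integrable lborel (\<lambda>y. indicator (ball (x::real^'n) \<epsilon>) y * v y :: real)"
proof -
  have "integrable lborel (\<lambda>y. norm (indicator (ball x \<epsilon>) y :: real) powr (p - 2) * inner (indicator (ball x \<epsilon>) y) (v y))"
    by (rule Lp_pairing_integrable[OF indicator_ball_Lp(1) assms p(1)])
  moreover have "(\<lambda>y. norm (indicator (ball x \<epsilon>) y :: real) powr (p - 2) * inner (indicator (ball x \<epsilon>) y) (v y)) = (\<lambda>y. indicator (ball x \<epsilon>) y * v y)"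
    by (auto simp: fun_eq_iff indicator_def)
  ultimately show ?thesis by metis
qed

lemma ball_average_measurable:
  assumes [measurable]: "v \<in> borel_measurable borel"
  shows "ball_average \<epsilon> v \<in> borel_measurable borel"
proof (cases "0 < \<epsilon>")
  case True
  have "(\<lambda>x. LINT y|lborel. indicator {z::(real^'n)\<times>(real^'n). dist (fst z) (snd z) < \<epsilon>} (x, y) * v y) \<in> borel_measurable borel"
    by measurable
  moreover have "indicator {z::(real^'n)\<times>(real^'n). dist (fst z) (snd z) < \<epsilon>} (x, y) = (indicator (ball x \<epsilon>) y :: real)" for x y
    by (auto simp: indicator_def)
  ultimately show ?thesis
    unfolding ball_average_def[abs_def] using True by (simp add: content_ball_cart)
qed (simp add: ball_average_def[abs_def] ball_empty)

text \<open>By Jensen, \<open>|v x - ball_average \<epsilon> v x| powr p\<close> is at most the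
  average of \<open>|v x - v y| powr p\<close> over the ball. There the distance is below
  \<epsilon>, so inserting the Gagliardo kernel costs at most
  \<open>\<epsilon> powr (N + p * s)\<close>, and dividing by the volume leaves
  \<open>\<epsilon> powr (p * s)\<close>.\<close>

lemma ball_average_approx:
  assumes v: "v \<in> XF" and \<epsilon>: "0 < \<epsilon>"
  shows "Lp (\<lambda>x. v x - ball_average \<epsilon> v x)"
    "norm_pow (\<lambda>x. v x - ball_average \<epsilon> v x) \<le> \<epsilon> powr (p * s) / unit_ball_vol (real CARD('n)) * energy v"
proof -
  note [measurable] = XF_D(1)[OF v] ball_average_measurable[OF XF_D(1)[OF v]]
  define V where "V = unit_ball_vol (real CARD('n)) * \<epsilon> ^ CARD('n)"
  have V: "0 < V" using \<epsilon> by (simp add: V_def)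
  have mV: "measure lborel (ball (x::real^'n) \<epsilon>) = V" for x using content_ball_cart[OF \<epsilon>] by (simp add: V_def)
  define a where "a = real CARD('n) + p * s"
  have a: "0 < a" using p s by (simp add: a_def add_nonneg_pos)
  have gi: "integrable lborel2 (gagliardo_integrand p s v)" using v by (auto simp: X_finite_def)
  have pt: "ennreal (norm (v x - ball_average \<epsilon> v x) powr p) \<le>
      ennreal (\<epsilon> powr a / V) * (\<integral>\<^sup>+y. ennreal (gagliardo_integrand p s v (x, y)) \<partial>lborel)" for x
  proof -
    let ?B = "ball x \<epsilon>"
    define f where "f y = indicator ?B y * (v x - v y)" for y
    have iB: "integrable lborel (indicator ?B :: _ \<Rightarrow> real)"
      using emeasure_lborel_ball_finite[of x \<epsilon>] by (intro integrable_real_indicator) auto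
    have fi: "integrable lborel f" "(LINT y|lborel. f y) = V * (v x - ball_average \<epsilon> v x)"
      using iB ball_integrable[OF XF_in_Lp[OF v], of x \<epsilon>] V
      by (auto simp: f_def[abs_def] right_diff_distrib ball_average_def mV)
    have "Lp (\<lambda>y. v x *\<^sub>R indicator ?B y - indicator ?B y *\<^sub>R v y)"
      by (intro in_Lp_diff in_Lp_scaleR in_Lp_indicator indicator_ball_Lp XF_in_Lp v p) simp
    moreover have "(\<lambda>y. v x *\<^sub>R indicator ?B y - indicator ?B y *\<^sub>R v y) = f"
      by (auto simp: fun_eq_iff f_def algebra_simps)
    ultimately have "Lp f" by simp
    then have fL: "integrable lborel (\<lambda>y. \<bar>f y\<bar> powr p)"
      using in_LpD(2) by fastforce
    have ff: "indicator ?B y * (\<bar>f y\<bar> / indicator ?B y) powr p = \<bar>f y\<bar> powr p" for y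
      using p by (auto simp: f_def indicator_def)
    have "\<bar>LINT y|lborel. f y\<bar> powr p \<le> (LINT y|lborel. indicator ?B y) powr (p - 1) *
       (LINT y|lborel. indicator ?B y * (\<bar>f y\<bar> / indicator ?B y) powr p)"
    proof (rule jensen_powr[OF p(1) iB _ fi(1)])
      show "f y = 0" if "indicat_real ?B y = 0" for y using that by (simp add: f_def)
      show "integrable lborel (\<lambda>y. indicat_real ?B y * (\<bar>f y\<bar> / indicat_real ?B y) powr p)"
        unfolding ff by (rule fL)
      show "0 < integral\<^sup>L lborel (indicat_real ?B)" using V by (simp add: mV)
    qed simp
    then have "V powr p * \<bar>v x - ball_average \<epsilon> v x\<bar> powr p \<le> V powr (p - 1) * (LINT y|lborel. \<bar>f y\<bar> powr p)"
      using V by (simp add: fi(2) ff mV abs_mult powr_mult)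
    also have "V powr (p - 1) = V powr p / V" using V by (simp add: powr_diff)
    finally have "V powr p * \<bar>v x - ball_average \<epsilon> v x\<bar> powr p \<le> V powr p * ((LINT y|lborel. \<bar>f y\<bar> powr p) / V)" by simp
    then have "\<bar>v x - ball_average \<epsilon> v x\<bar> powr p \<le> (LINT y|lborel. \<bar>f y\<bar> powr p) / V"
      using V by (subst (asm) mult_le_cancel_left_pos) auto
    then have "ennreal (norm (v x - ball_average \<epsilon> v x) powr p) \<le> ennreal (1 / V) * ennreal (LINT y|lborel. \<bar>f y\<bar> powr p)"
      using V by (simp add: ennreal_mult'[symmetric] ennreal_leI)
    also have "ennreal (LINT y|lborel. \<bar>f y\<bar> powr p) = (\<integral>\<^sup>+y. ennreal (\<bar>f y\<bar> powr p) \<partial>lborel)"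
      using fL by (subst nn_integral_eq_integral) auto
    also have "\<dots> \<le> (\<integral>\<^sup>+y. ennreal (\<epsilon> powr a) * ennreal (gagliardo_integrand p s v (x, y)) \<partial>lborel)"
    proof (rule nn_integral_mono)
      fix y
      show "ennreal (\<bar>f y\<bar> powr p) \<le> ennreal (\<epsilon> powr a) * ennreal (gagliardo_integrand p s v (x, y))"
      proof (cases "y \<in> ?B \<and> x \<noteq> y")
        case True
        then have n: "0 < norm (x - y)" "norm (x - y) \<le> \<epsilon>" by (auto simp: dist_norm)
        then have "norm (x - y) powr a \<le> \<epsilon> powr a" using a by (intro powr_mono2) auto
        then have "\<bar>v x - v y\<bar> powr p * norm (x - y) powr a \<le> \<epsilon> powr a * \<bar>v x - v y\<bar> powr p"
          by (metis mult.commute mult_left_mono powr_ge_zero)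
        then have "\<bar>f y\<bar> powr p \<le> \<epsilon> powr a * gagliardo_integrand p s v (x, y)"
          using True n by (simp add: f_def gagliardo_integrand_def pos_le_divide_eq flip: a_def)
        then show ?thesis by (simp add: ennreal_mult'[symmetric] ennreal_leI)
      qed (auto simp: f_def)
    qed
    also have "\<dots> = ennreal (\<epsilon> powr a) * (\<integral>\<^sup>+y. ennreal (gagliardo_integrand p s v (x, y)) \<partial>lborel)"
      by (intro nn_integral_cmult) measurable
    finally show ?thesis
      using V by (simp add: ennreal_mult'[symmetric] mult.assoc[symmetric] mult_left_mono)
  qed
  have "(\<integral>\<^sup>+x. ennreal (norm (v x - ball_average \<epsilon> v x) powr p) \<partial>lborel) \<le>
     (\<integral>\<^sup>+x. ennreal (\<epsilon> powr a / V) * (\<integral>\<^sup>+y. ennreal (gagliardo_integrand p s v (x, y)) \<partial>lborel) \<partial>lborel)"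
    by (intro nn_integral_mono pt)
  also have "\<dots> = ennreal (\<epsilon> powr a / V) * (\<integral>\<^sup>+z. ennreal (gagliardo_integrand p s v z) \<partial>lborel2)"
    by (subst nn_integral_cmult, measurable) (subst lborel.nn_integral_fst, auto)
  also have "(\<integral>\<^sup>+z. ennreal (gagliardo_integrand p s v z) \<partial>lborel2) = ennreal (energy v)"
    using gi unfolding gagliardo_def by (intro nn_integral_eq_integral) (auto simp: gagliardo_integrand_def)
  also have "\<epsilon> powr a / V = \<epsilon> powr (p * s) / unit_ball_vol (real CARD('n))"
    using \<epsilon> by (simp add: a_def V_def powr_add powr_realpow)
  also have "ennreal (\<epsilon> powr (p * s) / unit_ball_vol (real CARD('n))) * ennreal (energy v) =
     ennreal (\<epsilon> powr (p * s) / unit_ball_vol (real CARD('n)) * energy v)"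
    using gagliardo_nonneg[of p s v] by (intro ennreal_mult[symmetric]) auto
  finally show "Lp (\<lambda>x. v x - ball_average \<epsilon> v x)"
    "norm_pow (\<lambda>x. v x - ball_average \<epsilon> v x) \<le> \<epsilon> powr (p * s) / unit_ball_vol (real CARD('n)) * energy v"
    using gagliardo_nonneg[of p s v] by (auto intro!: in_LpI_nn)
qed

text \<open>Compactness of the embedding into $L^p$: ball averages are continuous functionals, so they
  converge pointwise, and the Gagliardo seminorm controls the distance to the ball averages.\<close>

lemma weak_convergence_Lp:
  assumes U: "X_weakly_converges p s \<Omega> U u" and M0: "\<And>k. X_norm p s (U k) \<le> M0"
  shows "(\<lambda>k. norm_pow (\<lambda>x. U k x - u x)) \<longlonglongrightarrow> 0"
proof -
  have UX: "U k \<in> X" "u \<in> X" for k using U by (auto simp: X_weakly_converges_def)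
  have UF: "U k \<in> XF" "u \<in> XF" for k using UX X_subset_XF by auto
  obtain C where C: "0 < C" "\<And>v. v \<in> XF \<Longrightarrow> norm_pow v \<le> C * energy v"
    by (rule XF_Lp_bound) blast
  define w where "w k = (\<lambda>x. U k x - u x)" for k
  have wF: "w k \<in> XF" for k unfolding w_def by (rule XF_diff[OF UF])
  define B1 where "B1 = 2 powr p * (M0 powr p + energy u)"
  have B1: "energy (w k) \<le> B1" for k
  proof -
    have gl: "gagliardo_quotient p s (w k) = (\<lambda>z. gagliardo_quotient p s (U k) z - gagliardo_quotient p s u z)"
      using gagliardo_quotient_linear[of p s 1 "U k" "-1" u] by (auto simp: w_def)
    have "energy (w k) \<le> 2 powr p * (energy (U k) + energy u)"
      using in_Lp_diff(2)[OF XF_D(5)[OF UF(1)] XF_D(5)[OF UF(2)] p(1), of k] XF_D(6)[OF wF, of k]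
        XF_D(6)[OF UF(1), of k] XF_D(6)[OF UF(2)] by (simp add: gl)
    also have "energy (U k) \<le> X_norm p s (U k) powr p" by (simp add: X_norm_powr)
    also have "\<dots> \<le> M0 powr p" using p M0 X_norm_nonneg by (intro powr_mono2) auto
    finally show ?thesis by (simp add: B1_def mult_left_mono)
  qed
  have B1n: "0 \<le> B1" using B1[of 0] gagliardo_nonneg[of p s "w 0"] by linarith
  have wL: "Lp (w k)" "norm_pow (w k) \<le> C * B1" for k
    using XF_in_Lp[OF wF] order_trans[OF C(2)[OF wF, of k] mult_left_mono[OF B1[of k]]] C(1) by auto
  obtain r where r: "0 < r" "\<And>x. x \<in> \<Omega> \<Longrightarrow> norm x \<le> r" using \<Omega>(2) by (auto simp: bounded_pos)
  have avg: "Lp (ball_average \<epsilon> (w k))" "(\<lambda>k. norm_pow (ball_average \<epsilon> (w k))) \<longlonglongrightarrow> 0"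
    if \<epsilon>: "0 < \<epsilon>" for \<epsilon> k
  proof -
    define V where "V = unit_ball_vol (real CARD('n)) * \<epsilon> ^ CARD('n)"
    have V: "0 < V" using \<epsilon> by (simp add: V_def)
    have mV: "measure lborel (ball (x::real^'n) \<epsilon>) = V" for x using content_ball_cart[OF \<epsilon>] by (simp add: V_def)
    have avg_eq: "ball_average \<epsilon> v x = Lp_pairing p lborel (indicator (ball x \<epsilon>)) v / V" for v x
      by (simp add: ball_average_def mV ball_pairing)
    have lim: "(\<lambda>k. ball_average \<epsilon> (w k) x) \<longlonglongrightarrow> 0" for x
    proof -
      \<comment> \<open>The identity, written as multiplication by the weight 1, is bounded from
        \<open>X\<close> to L^p by the Poincare inequality; pairing it with the indicator of a ball
        gives an element of the dual.\<close>
      have "X_operator lborel (\<lambda>v x. 1 * v x :: real)"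
      proof (rule weight_operator[of _ C])
        fix v assume "v \<in> X"
        then have v: "v \<in> XF" using X_subset_XF by auto
        show "Lp (\<lambda>x. 1 * v x)" using XF_in_Lp[OF v] by simp
        have "C * energy v \<le> C * X_norm p s v powr p" using C(1) by (simp add: X_norm_powr)
        then show "norm_pow (\<lambda>x. 1 * v x) \<le> C * X_norm p s v powr p" using C(2)[OF v] by simp
      qed (use C(1) in auto)
      from X_operator_pairing_dual[OF this indicator_ball_Lp(1)[of x \<epsilon>]]
      have "(\<lambda>k. Lp_pairing p lborel (indicator (ball x \<epsilon>)) (U k)) \<longlonglongrightarrow> Lp_pairing p lborel (indicator (ball x \<epsilon>)) u"
        using U by (auto simp: X_weakly_converges_def)
      then have "(\<lambda>k. (Lp_pairing p lborel (indicator (ball x \<epsilon>)) (U k) - Lp_pairing p lborel (indicator (ball x \<epsilon>)) u) / V) \<longlonglongrightarrow>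
        (Lp_pairing p lborel (indicator (ball x \<epsilon>)) u - Lp_pairing p lborel (indicator (ball x \<epsilon>)) u) / V"
        using V by (intro tendsto_intros) auto
      moreover have "Lp_pairing p lborel (indicator (ball x \<epsilon>)) (w k) =
          Lp_pairing p lborel (indicator (ball x \<epsilon>)) (U k) - Lp_pairing p lborel (indicator (ball x \<epsilon>)) u" for k
        using ball_integrable[OF XF_in_Lp[OF UF(1)], of x \<epsilon> k] ball_integrable[OF XF_in_Lp[OF UF(2)], of x \<epsilon>]
        by (simp add: ball_pairing w_def right_diff_distrib)
      ultimately show ?thesis by (simp add: avg_eq)
    qed
    \<comment> \<open>A bound on the averages that is uniform in \<open>k\<close> and
      \<open>x\<close>. Together with the common bounded support in \<open>zero\<close> it supplies
      the majorant for dominated convergence.\<close>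
    define Q where "Q = (V + 1) * (C * B1) powr (1 / p) / V"
    have Q: "\<bar>ball_average \<epsilon> (w k) x\<bar> \<le> Q" for k x
    proof -
      have "\<bar>Lp_pairing p lborel (indicator (ball x \<epsilon>)) (w k)\<bar> \<le> (V + 1) * norm_pow (w k) powr (1 / p)"
        using Lp_pairing_bound[OF indicator_ball_Lp(1) wL(1) p(1), of x \<epsilon> k] by (simp add: indicator_ball_Lp(2) mV)
      also have "\<dots> \<le> (V + 1) * (C * B1) powr (1 / p)"
        using V p wL(2) by (intro mult_left_mono powr_mono2) auto
      finally show ?thesis using V by (simp add: avg_eq Q_def abs_div divide_right_mono)
    qed
    have zero: "ball_average \<epsilon> (w k) x = 0" if "r + \<epsilon> \<le> norm x" for k x
    proof -
      have "(LINT y|lborel. indicator (ball x \<epsilon>) y * w k y) = 0"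
      proof (rule integral_eq_zero_AE)
        show "AE y in lborel. indicator (ball x \<epsilon>) y * w k y = 0"
          using XF_D(2)[OF wF, of k]
        proof eventually_elim
          case (elim y)
          have "y \<notin> \<Omega>" if "dist x y < \<epsilon>"
            using that r(2)[of y] \<open>r + \<epsilon> \<le> norm x\<close> norm_triangle_ineq[of "x - y" y] by (auto simp: dist_norm)
          then show ?case using elim by (auto simp: indicator_def)
        qed
      qed
      then show ?thesis by (simp add: ball_average_def)
    qed
    have m [measurable]: "ball_average \<epsilon> (w k) \<in> borel_measurable borel" for k
      by (rule ball_average_measurable[OF XF_D(1)[OF wF]])
    have bd: "norm (norm (ball_average \<epsilon> (w k) x) powr p) \<le> Q powr p" for k x
      using Q[of k x] p by (auto intro!: powr_mono2)
    have "integrable lborel (\<lambda>x. norm (ball_average \<epsilon> (w k) x) powr p)"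
      by (rule integrable_bounded_vanishing[where B = "Q powr p" and R = "r + \<epsilon>"]) (use bd zero[of _ k] p in auto)
    then show "Lp (ball_average \<epsilon> (w k))" by (simp add: in_Lp_def)
    have "(\<lambda>k. LINT x|lborel. norm (ball_average \<epsilon> (w k) x) powr p) \<longlonglongrightarrow> (LINT x|(lborel :: (real^'n) measure). 0 :: real)"
    proof (rule integral_dominated_convergence[where w = "\<lambda>x::real^'n. Q powr p * indicator (cball 0 (r + \<epsilon>)) x"])
      show "integrable lborel (\<lambda>x::real^'n. Q powr p * indicator (cball 0 (r + \<epsilon>)) x)"
        using emeasure_lborel_cball_finite[of "0::real^'n" "r + \<epsilon>"] by (intro integrable_mult_right integrable_real_indicator) auto
      show "AE x in lborel. (\<lambda>k. norm (ball_average \<epsilon> (w k) x) powr p) \<longlonglongrightarrow> 0"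
      proof (rule AE_I2)
        fix x
        have "(\<lambda>k. norm (ball_average \<epsilon> (w k) x) powr p) \<longlonglongrightarrow> 0 powr p"
          by (rule tendsto_powr'[OF tendsto_norm_zero[OF lim] tendsto_const]) (use p in auto)
        then show "(\<lambda>k. norm (ball_average \<epsilon> (w k) x) powr p) \<longlonglongrightarrow> 0" by simp
      qed
      show "AE x in lborel. norm (norm (ball_average \<epsilon> (w k) x) powr p) \<le> Q powr p * indicat_real (cball 0 (r + \<epsilon>)) x" for k
      proof (rule AE_I2)
        fix x
        show "norm (norm (ball_average \<epsilon> (w k) x) powr p) \<le> Q powr p * indicat_real (cball 0 (r + \<epsilon>)) x"
          using bd[of k x] zero[of x k] p by (cases "norm x \<le> r + \<epsilon>") auto
      qed
    qed auto
    then show "(\<lambda>k. norm_pow (ball_average \<epsilon> (w k))) \<longlonglongrightarrow> 0" by (simp add: Lp_pow_def)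
  qed
  define c where "c = (1 / 2 :: real) powr (1 - p)"
  have c: "0 < c" by (simp add: c_def)
  define Z where "Z = B1 / unit_ball_vol (real CARD('n))"
  have est: "norm_pow (w k) \<le> c * (\<epsilon> powr (p * s) * Z) + c * norm_pow (ball_average \<epsilon> (w k))" if "0 < \<epsilon>" for \<epsilon> k
  proof -
    note ap = ball_average_approx[OF wF that, of k]
    have "norm_pow (w k) \<le> c * norm_pow (\<lambda>x. w k x - ball_average \<epsilon> (w k) x) + c * norm_pow (ball_average \<epsilon> (w k))"
      using in_Lp_add(2)[OF ap(1) avg(1)[OF that, of k] p(1), of "1/2"] by (simp add: c_def)
    also have "norm_pow (\<lambda>x. w k x - ball_average \<epsilon> (w k) x) \<le> \<epsilon> powr (p * s) / unit_ball_vol (real CARD('n)) * B1"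
      by (rule order_trans[OF ap(2) mult_left_mono[OF B1[of k]]]) simp
    finally show ?thesis using c by (simp add: Z_def)
  qed
  have "(\<lambda>k. norm_pow (w k)) \<longlonglongrightarrow> 0"
  proof (rule order_tendstoI)
    fix e :: real assume "0 < e"
    \<comment> \<open>First \<epsilon> is fixed so that the distance to the averages is small for
      all \<open>k\<close> at once; only then does \<open>k\<close> tend to infinity.\<close>
    have "((\<lambda>\<epsilon>. c * (\<epsilon> powr (p * s) * Z)) \<longlongrightarrow> c * (0 powr (p * s) * Z)) (at_right 0)"
      by (intro tendsto_intros tendsto_powr') (use p s in \<open>auto simp: eventually_at_filter\<close>)
    then have "eventually (\<lambda>\<epsilon>. c * (\<epsilon> powr (p * s) * Z) < e / 2) (at_right 0)"
      by (rule order_tendstoD) (use \<open>0 < e\<close> in simp)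
    then obtain \<epsilon> where \<epsilon>: "0 < \<epsilon>" "c * (\<epsilon> powr (p * s) * Z) < e / 2"
      using eventually_happens'[OF trivial_limit_at_right_real eventually_conj[OF eventually_at_right_less]] by blast
    have "(\<lambda>k. c * norm_pow (ball_average \<epsilon> (w k))) \<longlonglongrightarrow> c * 0" by (intro tendsto_mult_left avg \<epsilon>)
    then have "eventually (\<lambda>k. c * norm_pow (ball_average \<epsilon> (w k)) < e / 2) sequentially"
      by (rule order_tendstoD) (use \<open>0 < e\<close> in simp)
    then show "eventually (\<lambda>k. norm_pow (w k) < e) sequentially"
      by eventually_elim (use est[OF \<epsilon>(1)] \<epsilon>(2) in \<open>smt (verit) field_sum_of_halves\<close>)
  qed (rule always_eventually, blast intro: less_le_trans[OF _ Lp_pow_nonneg])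
  then show ?thesis by (simp add: w_def)
qed

section \<open>Coercivity\<close>

lemma X_frac_sobolev: "u \<in> X \<Longrightarrow> u \<in> frac_sobolev p s"
  using XF_in_Lp[of u] X_subset_XF by (auto simp: frac_sobolev_def X_finite_def in_Lp_def)

text \<open>For \<theta> between 0 and 1 the weight \<open>1 / norm x powr \<theta>\<close> is at
  most \<open>1 + 1 / norm x\<close>, so the Poincare and the Hardy inequality suffice. The constant
  is not sharp; the sharp comparison is made in \<open>energy_bound\<close>.\<close>

lemma weighted_in_Lp:
  assumes \<theta>: "0 \<le> \<theta>" "\<theta> \<le> 1"
  obtains K where "0 \<le> K" "\<And>u. u \<in> X \<Longrightarrow> Lp (\<lambda>x. u x / norm x powr \<theta>)"
    "\<And>u. u \<in> X \<Longrightarrow> norm_pow (\<lambda>x. u x / norm x powr \<theta>) \<le> K * X_norm p s u powr p"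
proof -
  obtain C where C: "0 < C" "\<And>v. v \<in> XF \<Longrightarrow> norm_pow v \<le> C * energy v"
    by (rule XF_Lp_bound) blast
  define K where "K = 2 powr p * (C + hardy_opt TYPE('n) p)"
  have main: "Lp (\<lambda>x. u x / norm x powr \<theta>) \<and>
      norm_pow (\<lambda>x. u x / norm x powr \<theta>) \<le> K * X_norm p s u powr p" if u: "u \<in> X" for u
  proof -
    have uF: "u \<in> XF" using u X_subset_XF by auto
    note [measurable] = XF_D(1)[OF uF]
    have a: "Lp (\<lambda>x. \<bar>u x\<bar>)" "norm_pow (\<lambda>x. \<bar>u x\<bar>) \<le> C * energy u"
      using in_Lp_bounded[OF XF_in_Lp[OF uF] _ _ p(1), of "\<lambda>x. \<bar>u x\<bar>"] C(2)[OF uF] by auto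
    \<comment> \<open>The sum of \<open>|u x|\<close> and \<open>|u x / norm x|\<close> is written
      as a difference so that \<open>in_Lp_diff\<close> applies.\<close>
    have b: "Lp (\<lambda>x. - \<bar>u x / norm x\<bar>)" "norm_pow (\<lambda>x. - \<bar>u x / norm x\<bar>) \<le> hardy_opt TYPE('n) p * G u"
      using in_Lp_bounded[OF hardy_X(1)[OF u] _ _ p(1), of "\<lambda>x. - \<bar>u x / norm x\<bar>"] hardy_X(2)[OF u] by auto
    note d = in_Lp_diff[OF a(1) b(1) p(1)]
    have le: "\<bar>u x / norm x powr \<theta>\<bar> \<le> \<bar>\<bar>u x\<bar> - - \<bar>u x / norm x\<bar>\<bar>" for x
    proof (cases "x = 0")
      case False
      have "1 / norm x powr \<theta> \<le> 1 + 1 / norm x"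
      proof (cases "norm x \<le> 1")
        case True
        have "norm x powr 1 \<le> norm x powr \<theta>" using True False \<theta> by (intro powr_mono') auto
        then have "1 / norm x powr \<theta> \<le> 1 / norm x" using False by (intro divide_left_mono) auto
        then show ?thesis by simp
      next
        case f: False
        have "1 \<le> norm x powr \<theta>" using f \<theta> by (intro ge_one_powr_ge_zero) auto
        then have "1 / norm x powr \<theta> \<le> 1" using frac_le[of 1 1 1 "norm x powr \<theta>"] by simp
        then show ?thesis by (simp add: add_increasing2)
      qed
      then have "\<bar>u x\<bar> * (1 / norm x powr \<theta>) \<le> \<bar>u x\<bar> * (1 + 1 / norm x)" by (intro mult_left_mono) auto
      then show ?thesis by (simp add: abs_div distrib_left)
    qed simp
    have "Lp (\<lambda>x. u x / norm x powr \<theta>) \<and>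
       norm_pow (\<lambda>x. u x / norm x powr \<theta>) \<le> norm_pow (\<lambda>x. \<bar>u x\<bar> - - \<bar>u x / norm x\<bar>)"
      using in_Lp_bounded[OF d(1) _ _ p(1), of "\<lambda>x. u x / norm x powr \<theta>"] le by auto
    moreover have "norm_pow (\<lambda>x. \<bar>u x\<bar> - - \<bar>u x / norm x\<bar>) \<le> K * X_norm p s u powr p"
    proof -
      have H: "0 \<le> hardy_opt TYPE('n) p" by (simp add: hardy_opt_def)
      have "norm_pow (\<lambda>x. \<bar>u x\<bar> - - \<bar>u x / norm x\<bar>) \<le> 2 powr p * (C * energy u + hardy_opt TYPE('n) p * G u)"
        by (rule order_trans[OF d(2) mult_left_mono[OF add_mono[OF a(2) b(2)]]]) simp
      also have "C * energy u + hardy_opt TYPE('n) p * G u \<le> (C + hardy_opt TYPE('n) p) * (G u + energy u)"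
        using C(1) H gagliardo_nonneg[of p s u] by (simp add: algebra_simps)
      finally show ?thesis by (simp add: K_def X_norm_powr mult.assoc)
    qed
    ultimately show ?thesis by linarith
  qed
  have "0 \<le> K" using C(1) by (simp add: K_def hardy_opt_def)
  then show ?thesis by (rule that) (use main in auto)
qed

lemma weighted_pow: "norm (u x / norm x powr \<theta>) powr p = \<bar>u x\<bar> powr p / norm x powr (p * \<theta>)"
  using p by (simp add: abs_div powr_divide powr_powr mult.commute)

text \<open>A constant strictly above \<open>c\<close> is taken from the admissible set itself, so
  the supremum need not be attained.\<close>

lemma frac_hardy_X:
  assumes "c < frac_hardy_const TYPE('n) p s"
  obtains C where "c < C" "0 \<le> C" "\<And>u. u \<in> X \<Longrightarrow> C * norm_pow (\<lambda>x. u x / norm x powr s) \<le> energy u"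
proof -
  define S where "S = {C. 0 \<le> C \<and>
     (\<forall>u\<in>(frac_sobolev p s :: (real^'n \<Rightarrow> real) set).
        ennreal C * (\<integral>\<^sup>+x. ennreal (\<bar>u x\<bar> powr p / norm x powr (p * s)) \<partial>lborel) \<le> ennreal (energy u))}"
  \<comment> \<open>If \<open>S\<close> is unbounded, its \<open>Sup\<close> carries no information,
    but then \<open>S\<close> contains arbitrarily large constants anyway.\<close>
  have "\<exists>C\<in>S. c < C"
  proof (cases "bdd_above S")
    case True
    have "S \<noteq> {}" by (auto simp: S_def intro!: exI[of _ 0])
    moreover have "c < Sup S" using assms by (simp add: frac_hardy_const_def S_def)
    ultimately show ?thesis using less_cSup_iff[OF _ True] by blast
  next
    case False
    then show ?thesis by (auto simp: bdd_above_def not_le)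
  qed
  then obtain C where C: "C \<in> S" "c < C" by blast
  have "C * norm_pow (\<lambda>x. u x / norm x powr s) \<le> energy u" if u: "u \<in> X" for u
  proof -
    have i: "Lp (\<lambda>x. u x / norm x powr s)" using u s weighted_in_Lp[of s] by (metis less_imp_le)
    have "ennreal C * ennreal (norm_pow (\<lambda>x. u x / norm x powr s)) \<le> ennreal (energy u)"
      using C(1) X_frac_sobolev[OF u] unfolding ennreal_Lp_pow[OF i] weighted_pow by (auto simp: S_def)
    then have "ennreal (C * norm_pow (\<lambda>x. u x / norm x powr s)) \<le> ennreal (energy u)"
      by (simp add: ennreal_mult'')
    then show ?thesis using gagliardo_nonneg[of p s u] by simp
  qed
  then show ?thesis using that C by (auto simp: S_def)
qed

text \<open>Both integrals over \<Omega> extend to the whole space, since \<open>u\<close> and its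
  weak gradient vanish a.e. outside.\<close>

lemma I_functional_eq:
  assumes u: "u \<in> X"
  shows "I_functional p s \<theta> \<Omega> \<mu> u = 1 / p * (G u + energy u - \<mu> * norm_pow (\<lambda>x. u x / norm x powr \<theta>))"
proof -
  have uF: "u \<in> XF" using u X_subset_XF by auto
  have [measurable]: "\<Omega> \<in> sets borel" "u \<in> borel_measurable borel" "weak_gradient u \<in> borel_measurable borel"
    using \<Omega>(1) XF_D(1)[OF uF] in_LpD(1)[OF XF_D(4)[OF uF]] by auto
  have "(LINT x:\<Omega>|lborel. norm (weak_gradient u x) powr p) = G u"
    unfolding set_lebesgue_integral_def Lp_pow_def
  proof (rule integral_cong_AE)
    show "AE x in lborel. indicat_real \<Omega> x *\<^sub>R norm (weak_gradient u x) powr p = norm (weak_gradient u x) powr p"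
      using weak_gradient_zero_outside[OF u] by eventually_elim (auto simp: indicator_def)
  qed auto
  moreover have "(LINT x:\<Omega>|lborel. \<bar>u x\<bar> powr p / norm x powr (p * \<theta>)) = norm_pow (\<lambda>x. u x / norm x powr \<theta>)"
    unfolding set_lebesgue_integral_def Lp_pow_def weighted_pow
  proof (rule integral_cong_AE)
    show "AE x in lborel. indicat_real \<Omega> x *\<^sub>R (\<bar>u x\<bar> powr p / norm x powr (p * \<theta>)) = \<bar>u x\<bar> powr p / norm x powr (p * \<theta>)"
      using XF_D(2)[OF uF] by eventually_elim (auto simp: indicator_def)
  qed auto
  ultimately show ?thesis by (simp add: I_functional_def)
qed

text \<open>As \<open>\<theta> = l * 1 + (1 - l) * s\<close>, this is the weighted
  arithmetic-geometric mean inequality for the two extreme weights. For \<theta> strictly between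
  \<open>s\<close> and 1 the factors \<open>1 / l\<close> and \<open>1 / (1 - l)\<close> are exactly
  those that multiply the Hardy constants in \<open>mu_bar\<close>.\<close>

lemma weight_interpolation:
  assumes u: "u \<in> X" and \<theta>: "s \<le> \<theta>" "\<theta> \<le> 1"
  defines "l \<equiv> (\<theta> - s) / (1 - s)"
  shows "norm_pow (\<lambda>x. u x / norm x powr \<theta>) \<le>
    l * norm_pow (\<lambda>x. u x / norm x) + (1 - l) * norm_pow (\<lambda>x. u x / norm x powr s)"
proof -
  have l: "0 \<le> l" "l \<le> 1" using \<theta> s by (auto simp: l_def)
  have i: "Lp (\<lambda>x. u x / norm x powr \<theta>)" "Lp (\<lambda>x. u x / norm x powr s)"
    using u s \<theta> weighted_in_Lp[of s] weighted_in_Lp[of \<theta>] by (meson less_imp_le order_trans)+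
  have i1: "Lp (\<lambda>x. u x / norm x)" by (rule hardy_X[OF u])
  have "norm_pow (\<lambda>x. u x / norm x powr \<theta>) \<le>
     (LINT x|lborel. l * norm (u x / norm x) powr p + (1 - l) * norm (u x / norm x powr s) powr p)"
    unfolding Lp_pow_def
  proof (rule integral_mono)
    fix x :: "real^'n"
    show "norm (u x / norm x powr \<theta>) powr p \<le> l * norm (u x / norm x) powr p + (1 - l) * norm (u x / norm x powr s) powr p"
    proof (cases "x = 0")
      case False
      have "(norm x powr (- p)) powr l * (norm x powr (- p * s)) powr (1 - l) \<le> l * norm x powr (- p) + (1 - l) * norm x powr (- p * s)"
        using False l by (intro Youngs_inequality_0) auto
      also have "(norm x powr (- p)) powr l * (norm x powr (- p * s)) powr (1 - l) = norm x powr (- (p * (l * (1 - s) + s)))"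
        by (simp add: powr_powr powr_add[symmetric] algebra_simps)
      also have "l * (1 - s) + s = \<theta>" using s by (simp add: l_def)
      finally have "\<bar>u x\<bar> powr p * norm x powr (- (p * \<theta>)) \<le> \<bar>u x\<bar> powr p * (l * norm x powr (- p) + (1 - l) * norm x powr (- p * s))"
        by (intro mult_left_mono) auto
      moreover have "norm (u x / norm x) powr p = \<bar>u x\<bar> powr p / norm x powr p"
        using weighted_pow[of u x 1] by simp
      ultimately show ?thesis unfolding weighted_pow by (simp add: powr_minus divide_inverse algebra_simps)
    qed (use p in simp)
  qed (use in_LpD(2)[OF i(1)] in_LpD(2)[OF i(2)] in_LpD(2)[OF i1] in auto)
  also have "\<dots> = l * norm_pow (\<lambda>x. u x / norm x) + (1 - l) * norm_pow (\<lambda>x. u x / norm x powr s)"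
    unfolding Lp_pow_def using in_LpD(2)[OF i(2)] in_LpD(2)[OF i1] by simp
  finally show ?thesis .
qed

lemma hardy_const_opt: "hardy_const TYPE('n) p * hardy_opt TYPE('n) p = 1"
  using p by (simp add: hardy_const_def hardy_opt_def flip: powr_mult)

text \<open>The bound on \<mu> says that \<open>\<mu> * l\<close> is below the local and
  \<open>\<mu> * (1 - l)\<close> below the fractional constant, so each energy absorbs its share of
  the weighted term with a factor less than 1. At the endpoints one share is 0, which is why
  \<open>mu_bar\<close> contains a single constant there.\<close>

lemma energy_bound:
  assumes \<theta>: "s \<le> \<theta>" "\<theta> \<le> 1" and \<mu>: "\<mu> < mu_bar TYPE('n) p s \<theta>"
  obtains c where "0 < c" "\<And>u. u \<in> X \<Longrightarrow> c * X_norm p s u powr p \<le>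
    G u + energy u - \<mu> * norm_pow (\<lambda>x. u x / norm x powr \<theta>)"
proof (cases "\<mu> \<le> 0")
  case True
  then have "\<mu> * norm_pow (\<lambda>x. u x / norm x powr \<theta>) \<le> 0" for u :: "real^'n \<Rightarrow> real" by (simp add: mult_nonpos_nonneg)
  then have "1 * X_norm p s u powr p \<le> G u + energy u - \<mu> * norm_pow (\<lambda>x. u x / norm x powr \<theta>)" for u :: "real^'n \<Rightarrow> real"
    by (simp add: X_norm_powr)
  then show ?thesis using that[of 1] by simp
next
  case False
  define l where "l = (\<theta> - s) / (1 - s)"
  have l: "0 \<le> l" "l \<le> 1" using \<theta> s by (auto simp: l_def)
  have H: "0 \<le> hardy_opt TYPE('n) p" by (simp add: hardy_opt_def)
  have "\<exists>k<1. \<forall>u\<in>X. \<mu> * l * norm_pow (\<lambda>x. u x / norm x) \<le> k * G u"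
  proof (cases "\<theta> = s")
    case True
    then show ?thesis by (intro exI[of _ 0]) (simp add: l_def)
  next
    case ne: False
    have "\<mu> * l < hardy_const TYPE('n) p"
    proof (cases "\<theta> = 1")
      case True
      then show ?thesis using \<mu> s ne by (simp add: mu_bar_def l_def)
    next
      case False
      then have "\<mu> < hardy_const TYPE('n) p * (1 - s) / (\<theta> - s)" using \<mu> ne by (simp add: mu_bar_def)
      then show ?thesis using \<theta> ne s by (simp add: l_def field_simps)
    qed
    moreover have "0 < hardy_opt TYPE('n) p" using hardy_const_opt H by (cases "hardy_opt TYPE('n) p = 0") auto
    ultimately have "\<mu> * l * hardy_opt TYPE('n) p < 1"
      using hardy_const_opt by (metis mult_strict_right_mono)
    moreover have "\<mu> * l * norm_pow (\<lambda>x. u x / norm x) \<le> \<mu> * l * hardy_opt TYPE('n) p * G u" if "u \<in> X" for u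
      using mult_left_mono[OF hardy_X(2)[OF that], of "\<mu> * l"] False l by (simp add: mult.assoc)
    ultimately show ?thesis by blast
  qed
  then obtain k1 where k1: "k1 < 1" "\<And>u. u \<in> X \<Longrightarrow> \<mu> * l * norm_pow (\<lambda>x. u x / norm x) \<le> k1 * G u" by blast
  have "\<exists>k<1. \<forall>u\<in>X. \<mu> * (1 - l) * norm_pow (\<lambda>x. u x / norm x powr s) \<le> k * energy u"
  proof (cases "\<theta> = 1")
    case True
    then show ?thesis using s by (intro exI[of _ 0]) (simp add: l_def)
  next
    case ne: False
    have l1: "1 - l = (1 - \<theta>) / (1 - s)" using s by (simp add: l_def field_simps)
    have "\<mu> * (1 - l) < frac_hardy_const TYPE('n) p s"
    proof (cases "\<theta> = s")
      case True
      then show ?thesis using \<mu> by (simp add: mu_bar_def l_def)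
    next
      case False
      then have "\<mu> < frac_hardy_const TYPE('n) p s * (1 - s) / (1 - \<theta>)" using \<mu> ne by (simp add: mu_bar_def)
      then show ?thesis using \<theta> ne s by (simp add: l1 field_simps)
    qed
    then obtain C where C: "\<mu> * (1 - l) < C" "0 \<le> C"
      "\<And>u. u \<in> X \<Longrightarrow> C * norm_pow (\<lambda>x. u x / norm x powr s) \<le> energy u"
      by (rule frac_hardy_X) blast
    have m0: "0 \<le> \<mu> * (1 - l)" using False l by simp
    then have C0: "0 < C" using C(1) by linarith
    have "\<mu> * (1 - l) * norm_pow (\<lambda>x. u x / norm x powr s) \<le> \<mu> * (1 - l) / C * energy u" if "u \<in> X" for u
    proof -
      have "\<mu> * (1 - l) / C * (C * norm_pow (\<lambda>x. u x / norm x powr s)) \<le> \<mu> * (1 - l) / C * energy u"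
        using m0 C0 by (intro mult_left_mono C(3) that) auto
      then show ?thesis using C0 by simp
    qed
    then show ?thesis using C C0 by (intro exI[of _ "\<mu> * (1 - l) / C"]) auto
  qed
  then obtain k2 where k2: "k2 < 1" "\<And>u. u \<in> X \<Longrightarrow> \<mu> * (1 - l) * norm_pow (\<lambda>x. u x / norm x powr s) \<le> k2 * energy u" by blast
  define c where "c = min (1 - k1) (1 - k2)"
  have "c * X_norm p s u powr p \<le> G u + energy u - \<mu> * norm_pow (\<lambda>x. u x / norm x powr \<theta>)" if u: "u \<in> X" for u
  proof -
    have "\<mu> * norm_pow (\<lambda>x. u x / norm x powr \<theta>) \<le> \<mu> * (l * norm_pow (\<lambda>x. u x / norm x) + (1 - l) * norm_pow (\<lambda>x. u x / norm x powr s))"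
      using weight_interpolation[OF u \<theta>] False by (intro mult_left_mono) (auto simp: l_def)
    also have "\<dots> \<le> k1 * G u + k2 * energy u"
      using k1(2)[OF u] k2(2)[OF u] by (simp add: distrib_left mult.assoc)
    finally have 1: "\<mu> * norm_pow (\<lambda>x. u x / norm x powr \<theta>) \<le> k1 * G u + k2 * energy u" .
    have "c * G u \<le> (1 - k1) * G u" "c * energy u \<le> (1 - k2) * energy u"
      using gagliardo_nonneg[of p s u] by (auto simp: c_def intro!: mult_right_mono)
    then show ?thesis using 1 by (simp add: X_norm_powr algebra_simps)
  qed
  then show ?thesis using that[of c] k1(1) k2(1) by (auto simp: c_def)
qed

lemma I_functional_coercive:
  assumes \<theta>: "s \<le> \<theta>" "\<theta> \<le> 1" and \<mu>: "\<mu> < mu_bar TYPE('n) p s \<theta>"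
  shows "X_coercive p s \<Omega> (I_functional p s \<theta> \<Omega> \<mu>)"
  unfolding X_coercive_def
proof
  fix B :: real
  obtain c where c: "0 < c" "\<And>u. u \<in> X \<Longrightarrow> c * X_norm p s u powr p \<le>
    G u + energy u - \<mu> * norm_pow (\<lambda>x. u x / norm x powr \<theta>)" by (rule energy_bound[OF assms]) blast
  \<comment> \<open>The solution of \<open>c * R powr p = p * |B|\<close>.\<close>
  define R where "R = (p * \<bar>B\<bar> / c) powr (1 / p)"
  have "B \<le> I_functional p s \<theta> \<Omega> \<mu> u" if u: "u \<in> X" and R: "R \<le> X_norm p s u" for u
  proof -
    have "p * \<bar>B\<bar> / c = R powr p" using p c(1) by (simp add: R_def powr_powr)
    also have "\<dots> \<le> X_norm p s u powr p" using R p by (intro powr_mono2) (auto simp: R_def)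
    finally have "p * \<bar>B\<bar> \<le> c * X_norm p s u powr p" using c(1) by (simp add: field_simps)
    also note c(2)[OF u]
    finally have "\<bar>B\<bar> \<le> I_functional p s \<theta> \<Omega> \<mu> u" using p unfolding I_functional_eq[OF u] by (simp add: field_simps)
    then show ?thesis by simp
  qed
  then show "\<exists>R. \<forall>u\<in>X. R \<le> X_norm p s u \<longrightarrow> B \<le> I_functional p s \<theta> \<Omega> \<mu> u" by blast
qed

section \<open>Weak lower semicontinuity\<close>

lemma Lp_pow_split:
  fixes f :: "real^'n \<Rightarrow> 'b::euclidean_space"
  assumes f: "Lp f" and F: "F \<in> sets borel"
  shows "norm_pow f = norm_pow (\<lambda>x. indicator F x *\<^sub>R f x) + norm_pow (\<lambda>x. indicator (- F) x *\<^sub>R f x)"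
proof -
  have i: "Lp (\<lambda>x. indicator F x *\<^sub>R f x)" "Lp (\<lambda>x. indicator (- F) x *\<^sub>R f x)"
    by (intro in_Lp_indicator f p; use F in auto)+
  have "norm_pow f = (LINT x|lborel. norm (indicator F x *\<^sub>R f x) powr p + norm (indicator (- F) x *\<^sub>R f x) powr p)"
    unfolding Lp_pow_def by (intro Bochner_Integration.integral_cong) (auto simp: indicator_def)
  then show ?thesis using in_LpD(2)[OF i(1)] in_LpD(2)[OF i(2)] by (simp add: Lp_pow_def)
qed

text \<open>Absolute continuity of the integral: the balls shrink to the origin, which is a null
  set.\<close>

lemma Lp_pow_small_ball:
  fixes f :: "real^'n \<Rightarrow> 'b::euclidean_space"
  assumes f: "Lp f" and e: "0 < e"
  obtains \<rho>0 where "0 < \<rho>0" "\<And>\<rho>. \<rho> \<le> \<rho>0 \<Longrightarrow> norm_pow (\<lambda>x. indicator (ball 0 \<rho>) x *\<^sub>R f x) < e"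
proof -
  have [measurable]: "f \<in> borel_measurable borel" using in_LpD(1)[OF f] by simp
  define b where "b k = ball (0::real^'n) (inverse (real (Suc k)))" for k
  have [measurable]: "b k \<in> sets borel" for k by (simp add: b_def)
  have "(\<lambda>k. LINT x|lborel. norm (indicator (b k) x *\<^sub>R f x) powr p) \<longlonglongrightarrow> (LINT x|(lborel :: (real^'n) measure). 0 :: real)"
  proof (rule integral_dominated_convergence[where w = "\<lambda>x. norm (f x) powr p"])
    show "AE x in lborel. (\<lambda>k. norm (indicator (b k) x *\<^sub>R f x) powr p) \<longlonglongrightarrow> 0"
      using AE_lborel_singleton[of "0::real^'n"]
    proof eventually_elim
      case (elim x)
      then have "eventually (\<lambda>k. inverse (real (Suc k)) < norm x) sequentially"
        using order_tendstoD(2)[OF LIMSEQ_inverse_real_of_nat] by simp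
      then show ?case
        by (intro tendsto_eventually, elim eventually_mono) (auto simp: b_def indicator_def)
    qed
    show "AE x in lborel. norm (norm (indicat_real (b k) x *\<^sub>R f x) powr p) \<le> norm (f x) powr p" for k
      by (intro AE_I2) (auto simp: indicator_def)
  qed (use in_LpD(2)[OF f] in auto)
  then have "(\<lambda>k. norm_pow (\<lambda>x. indicator (b k) x *\<^sub>R f x)) \<longlonglongrightarrow> 0" by (simp add: Lp_pow_def)
  then have "eventually (\<lambda>k. norm_pow (\<lambda>x. indicator (b k) x *\<^sub>R f x) < e) sequentially"
    by (rule order_tendstoD) (use e in simp)
  then obtain k where k: "norm_pow (\<lambda>x. indicator (b k) x *\<^sub>R f x) < e" by (auto simp: eventually_sequentially)
  show ?thesis
  proof (rule that[of "inverse (real (Suc k))"])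
    fix \<rho> assume \<rho>: "\<rho> \<le> inverse (real (Suc k))"
    have "norm_pow (\<lambda>x. indicator (ball 0 \<rho>) x *\<^sub>R f x) \<le> norm_pow (\<lambda>x. indicator (b k) x *\<^sub>R f x)"
      by (rule in_Lp_bounded(2)[OF in_Lp_indicator(1)[OF f _ p(1)] _ _ p(1)]) (use \<rho> in \<open>auto simp: indicator_def b_def\<close>)
    then show "norm_pow (\<lambda>x. indicator (ball 0 \<rho>) x *\<^sub>R f x) < e" using k by linarith
  qed simp
qed

text \<open>Near the origin the gradient energy absorbs the weighted term, uniformly on bounded sets: for
  \<open>\<theta> < 1\<close> because the weight is of lower order than the Hardy weight, for \<open>\<theta> = 1\<close> by the local Hardy
  inequality.\<close>

lemma weight_absorption:
  assumes \<theta>: "0 \<le> \<theta>" "\<theta> \<le> 1" and \<mu>: "0 < \<mu>" "\<theta> = 1 \<Longrightarrow> \<mu> * hardy_opt TYPE('n) p < 1" and e: "0 < e" and M: "0 \<le> M"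
  obtains T \<delta>0 where "0 < T" "0 < \<delta>0" "\<And>\<delta> v. 0 < \<delta> \<Longrightarrow> \<delta> \<le> \<delta>0 \<Longrightarrow> v \<in> X \<Longrightarrow> G v \<le> M \<Longrightarrow>
    \<mu> * norm_pow (\<lambda>x. indicator (ball 0 \<delta>) x *\<^sub>R (v x / norm x powr \<theta>)) \<le>
      e + norm_pow (\<lambda>x. indicator (ball 0 (T * \<delta>)) x *\<^sub>R weak_gradient v x)"
proof -
  define H where "H = hardy_opt TYPE('n) p"
  have H: "0 \<le> H" by (simp add: H_def hardy_opt_def)
  show ?thesis
  proof (cases "\<theta> = 1")
    case True
    \<comment> \<open>First \<open>l\<close> is fixed so close to 0 that the leading factor stays
      below 1, which is possible because \<open>\<mu> * H < 1\<close>. Then, with \<open>l\<close>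
      frozen, \<open>T\<close> is taken so large that the remainder is below
      \<open>e\<close>.\<close>
    have "((\<lambda>l. \<mu> * ((1 - l) powr (1 - p) * H)) \<longlongrightarrow> \<mu> * ((1 - 0) powr (1 - p) * H)) (at_right 0)"
      by (intro tendsto_intros) auto
    then have "eventually (\<lambda>l. \<mu> * ((1 - l) powr (1 - p) * H) < 1) (at_right 0)"
      by (rule order_tendstoD) (use \<mu>(2)[OF True] in \<open>simp add: H_def\<close>)
    moreover have "eventually (\<lambda>l::real. 0 < l \<and> l < 1) (at_right 0)"
      using eventually_at_right_less by (auto simp: eventually_at_right[of 0 1] intro: exI[of _ 1])
    ultimately have "eventually (\<lambda>l. \<mu> * ((1 - l) powr (1 - p) * H) < 1 \<and> 0 < l \<and> l < 1) (at_right 0)"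
      by eventually_elim simp
    from eventually_happens'[OF trivial_limit_at_right_real this]
    obtain l where l: "\<mu> * ((1 - l) powr (1 - p) * H) < 1" "0 < l" "l < 1" by blast
    define Q where "Q = \<mu> * (l powr (1 - p) * (H * M))"
    have "((\<lambda>T. T powr (p - real CARD('n))) \<longlongrightarrow> 0) at_top"
      by (rule tendsto_neg_powr) (use p in \<open>auto simp: filterlim_ident\<close>)
    then have "((\<lambda>T. Q * T powr (p - real CARD('n))) \<longlongrightarrow> Q * 0) at_top" by (intro tendsto_mult_left)
    then have "eventually (\<lambda>T. Q * T powr (p - real CARD('n)) < e) at_top"
      by (rule order_tendstoD) (use e in simp)
    then have "eventually (\<lambda>T. Q * T powr (p - real CARD('n)) < e \<and> 1 < T) at_top"
      using eventually_gt_at_top by (rule eventually_conj)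
    then obtain T where T: "Q * T powr (p - real CARD('n)) < e" "1 < T"
      using eventually_happens'[OF trivial_limit_at_top_linorder] by blast
    show ?thesis
    \<comment> \<open>The local Hardy inequality holds for every radius, so the value 1 of \<delta>0
      is arbitrary.\<close>
    proof (rule that[of T 1])
      fix \<delta> :: real and v assume \<delta>: "0 < \<delta>" and v: "v \<in> X" "G v \<le> M"
      define g where "g = norm_pow (\<lambda>x. indicator (ball 0 (T * \<delta>)) x *\<^sub>R weak_gradient v x)"
      have g: "0 \<le> g" by (simp add: g_def)
      have "norm_pow (\<lambda>x. indicator (ball 0 \<delta>) x *\<^sub>R (v x / norm x powr \<theta>)) =
          norm_pow (\<lambda>x. indicator (ball 0 \<delta>) x / norm x * v x)" using True by simp
      also have "\<dots> \<le> (1 - l) powr (1 - p) * (H * g) + l powr (1 - p) * (T powr (p - real CARD('n)) * (H * G v))"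
        unfolding H_def g_def by (rule hardy_X_local[OF v(1) T(2) l(2,3) \<delta>])
      also have "\<dots> \<le> (1 - l) powr (1 - p) * (H * g) + l powr (1 - p) * (T powr (p - real CARD('n)) * (H * M))"
        using v(2) H by (intro add_left_mono mult_left_mono) auto
      finally have "\<mu> * norm_pow (\<lambda>x. indicator (ball 0 \<delta>) x *\<^sub>R (v x / norm x powr \<theta>)) \<le>
        \<mu> * ((1 - l) powr (1 - p) * (H * g) + l powr (1 - p) * (T powr (p - real CARD('n)) * (H * M)))"
        using \<mu>(1) by (intro mult_left_mono) auto
      also have "\<dots> = \<mu> * ((1 - l) powr (1 - p) * H) * g + Q * T powr (p - real CARD('n))"
        by (simp add: Q_def algebra_simps)
      also have "\<dots> \<le> 1 * g + e"
        using l(1) T(1) g by (intro add_mono mult_right_mono) auto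
      finally show "\<mu> * norm_pow (\<lambda>x. indicator (ball 0 \<delta>) x *\<^sub>R (v x / norm x powr \<theta>)) \<le> e + g" by simp
    qed (use T in auto)
  next
    case False
    \<comment> \<open>In the ball of radius \<delta> the weight is at most
      \<open>\<delta> powr q\<close> times the Hardy weight, and \<delta>0 solves
      \<open>\<delta>0 powr q * Q = e\<close>. The summand 1 in \<open>Q\<close> keeps the
      denominator positive.\<close>
    define q where "q = p * (1 - \<theta>)"
    have q: "0 < q" using False \<theta> p by (simp add: q_def)
    define Q where "Q = \<mu> * (H * M) + 1"
    have Q: "0 < Q" using \<mu>(1) H M by (simp add: Q_def add_nonneg_pos)
    define \<delta>0 where "\<delta>0 = (e / Q) powr (1 / q)"
    have \<delta>0: "0 < \<delta>0" "\<delta>0 powr q = e / Q" using e Q q by (auto simp: \<delta>0_def powr_powr)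
    show ?thesis
    proof (rule that[of 1 \<delta>0])
      fix \<delta> :: real and v assume \<delta>: "0 < \<delta>" "\<delta> \<le> \<delta>0" and v: "v \<in> X" "G v \<le> M"
      have vm [measurable]: "v \<in> borel_measurable borel" using v(1) X_subset_XF XF_D(1) by auto
      have i: "Lp (\<lambda>x. \<delta> powr (1 - \<theta>) *\<^sub>R (v x / norm x))"
        "norm_pow (\<lambda>x. \<delta> powr (1 - \<theta>) *\<^sub>R (v x / norm x)) = \<delta> powr q * norm_pow (\<lambda>x. v x / norm x)"
        using in_Lp_scaleR[OF hardy_X(1)[OF v(1)], of "\<delta> powr (1 - \<theta>)"] by (auto simp: powr_powr q_def mult.commute)
      have "norm_pow (\<lambda>x. indicator (ball 0 \<delta>) x *\<^sub>R (v x / norm x powr \<theta>)) \<le>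
        norm_pow (\<lambda>x. \<delta> powr (1 - \<theta>) *\<^sub>R (v x / norm x))"
      proof (rule in_Lp_bounded(2)[OF i(1) _ _ p(1)])
        show "AE x in lborel. norm (indicat_real (ball 0 \<delta>) x *\<^sub>R (v x / norm x powr \<theta>)) \<le> norm (\<delta> powr (1 - \<theta>) *\<^sub>R (v x / norm x))"
        proof (rule AE_I2)
          fix x :: "real^'n"
          show "norm (indicat_real (ball 0 \<delta>) x *\<^sub>R (v x / norm x powr \<theta>)) \<le> norm (\<delta> powr (1 - \<theta>) *\<^sub>R (v x / norm x))"
          proof (cases "x \<in> ball 0 \<delta> \<and> x \<noteq> 0")
            case True
            then have x: "0 < norm x" "norm x \<le> \<delta>" by auto
            have "norm x powr (1 - \<theta>) \<le> \<delta> powr (1 - \<theta>)" using x \<theta> by (intro powr_mono2) auto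
            moreover have "1 / norm x powr \<theta> = norm x powr (1 - \<theta>) * (1 / norm x)"
              using x by (simp add: powr_diff)
            ultimately have "1 / norm x powr \<theta> \<le> \<delta> powr (1 - \<theta>) * (1 / norm x)"
              by (simp add: mult_right_mono divide_right_mono)
            then have "\<bar>v x\<bar> * (1 / norm x powr \<theta>) \<le> \<bar>v x\<bar> * (\<delta> powr (1 - \<theta>) * (1 / norm x))"
              by (intro mult_left_mono) auto
            moreover have "norm (indicat_real (ball 0 \<delta>) x *\<^sub>R (v x / norm x powr \<theta>)) = \<bar>v x\<bar> * (1 / norm x powr \<theta>)"
              using True by simp
            moreover have "norm (\<delta> powr (1 - \<theta>) *\<^sub>R (v x / norm x)) = \<bar>v x\<bar> * (\<delta> powr (1 - \<theta>) * (1 / norm x))"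
              unfolding norm_scaleR by (simp add: abs_div)
            ultimately show ?thesis by (simp only:)
          qed auto
        qed
        have [measurable]: "ball (0::real^'n) \<delta> \<in> sets borel" by (rule borel_open) simp
        have "(\<lambda>x. indicat_real (ball 0 \<delta>) x *\<^sub>R (v x / norm x powr \<theta>)) \<in> borel_measurable borel" by measurable
        then show "(\<lambda>x. indicat_real (ball 0 \<delta>) x *\<^sub>R (v x / norm x powr \<theta>)) \<in> borel_measurable lborel" by simp
      qed
      also have "\<dots> \<le> \<delta> powr q * (H * M)"
        unfolding i(2) using hardy_X(2)[OF v(1)] mult_left_mono[OF v(2) H] by (intro mult_left_mono) (auto simp: H_def)
      finally have "\<mu> * norm_pow (\<lambda>x. indicator (ball 0 \<delta>) x *\<^sub>R (v x / norm x powr \<theta>)) \<le> \<mu> * (\<delta> powr q * (H * M))"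
        using \<mu>(1) by (intro mult_left_mono) auto
      also have "\<dots> \<le> \<delta> powr q * Q" by (simp add: Q_def algebra_simps)
      also have "\<dots> \<le> \<delta>0 powr q * Q" using \<delta> q Q by (intro mult_right_mono powr_mono2) auto
      also have "\<dots> = e" using \<delta>0 Q by simp
      finally show "\<mu> * norm_pow (\<lambda>x. indicator (ball 0 \<delta>) x *\<^sub>R (v x / norm x powr \<theta>)) \<le>
        e + norm_pow (\<lambda>x. indicator (ball 0 (1 * \<delta>)) x *\<^sub>R weak_gradient v x)"
        by (simp add: add_increasing2)
    qed (use \<delta>0 in auto)
  qed
qed

lemma energy_lsc:
  assumes \<theta>: "0 \<le> \<theta>" "\<theta> \<le> 1" and \<mu>: "\<theta> = 1 \<Longrightarrow> \<mu> * hardy_opt TYPE('n) p < 1"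
    and U: "X_weakly_converges p s \<Omega> U u" and M0: "\<And>k. X_norm p s (U k) \<le> M0" and e: "0 < e"
  defines "A \<equiv> \<lambda>v. norm_pow (\<lambda>x. v x / norm x powr \<theta>)"
  shows "eventually (\<lambda>k. G u + energy u - \<mu> * A u - 5 * e \<le> G (U k) + energy (U k) - \<mu> * A (U k)) sequentially"
proof -
  have UX: "U k \<in> X" "u \<in> X" for k using U by (auto simp: X_weakly_converges_def)
  have UF: "U k \<in> XF" "u \<in> XF" for k using UX X_subset_XF by auto
  obtain K where K: "0 \<le> K" "\<And>u. u \<in> X \<Longrightarrow> Lp (\<lambda>x. u x / norm x powr \<theta>)"
    "\<And>u. u \<in> X \<Longrightarrow> norm_pow (\<lambda>x. u x / norm x powr \<theta>) \<le> K * X_norm p s u powr p"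
    by (rule weighted_in_Lp[OF \<theta>]) blast
  have gag: "eventually (\<lambda>k. energy u - e \<le> energy (U k)) sequentially"
    using X_operator_lsc[OF gagliardo_operator U e] XF_D(6)[OF UF(1)] XF_D(6)[OF UF(2)] by simp
  show ?thesis
  proof (cases "\<mu> \<le> 0")
    case True
    have grad: "eventually (\<lambda>k. G u - e \<le> G (U k)) sequentially"
      using X_operator_lsc[OF gradient_operator[of UNIV] U e] by simp
    \<comment> \<open>For \<mu> \<le> 0 the weighted term has a favourable sign and is itself a
      convex energy.\<close>
    have "X_operator lborel (\<lambda>v x. 1 / norm x powr \<theta> * v x :: real)"
      by (rule weight_operator[OF _ K(1)]) (use K in auto)
    \<comment> \<open>The error is scaled so that it is at most \<open>e\<close> after
      multiplication by \<open>- \<mu>\<close>; the denominator is positive also for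
      \<open>\<mu> = 0\<close>.\<close>
    from X_operator_lsc[OF this U, of "e / (1 - \<mu>)"]
    have "eventually (\<lambda>k. A u - e / (1 - \<mu>) \<le> A (U k)) sequentially"
      using e True by (simp add: A_def)
    then show ?thesis using grad gag
    proof eventually_elim
      case (elim k)
      have "- \<mu> * (A u - e / (1 - \<mu>)) \<le> - \<mu> * A (U k)" using elim(1) True by (intro mult_left_mono) auto
      moreover have "- \<mu> * (e / (1 - \<mu>)) \<le> e" using True e by (simp add: field_simps)
      ultimately show ?case using elim e by (simp add: algebra_simps)
    qed
  next
    case False
    have M: "G (U k) \<le> M0 powr p" for k
    proof -
      have "G (U k) \<le> X_norm p s (U k) powr p" using gagliardo_nonneg[of p s "U k"] by (simp add: X_norm_powr)
      also have "\<dots> \<le> M0 powr p" using p M0 X_norm_nonneg by (intro powr_mono2) auto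
      finally show ?thesis .
    qed
    obtain T \<delta>0 where T: "0 < T" "0 < \<delta>0" and ab: "\<And>\<delta> v. 0 < \<delta> \<Longrightarrow> \<delta> \<le> \<delta>0 \<Longrightarrow> v \<in> X \<Longrightarrow> G v \<le> M0 powr p \<Longrightarrow>
      \<mu> * norm_pow (\<lambda>x. indicator (ball 0 \<delta>) x *\<^sub>R (v x / norm x powr \<theta>)) \<le>
      e + norm_pow (\<lambda>x. indicator (ball 0 (T * \<delta>)) x *\<^sub>R weak_gradient v x)"
      by (rule weight_absorption[OF \<theta> _ \<mu> e, of "M0 powr p"]) (use False in auto)
    obtain \<rho>0 where \<rho>0: "0 < \<rho>0" "\<And>\<rho>. \<rho> \<le> \<rho>0 \<Longrightarrow> norm_pow (\<lambda>x. indicator (ball 0 \<rho>) x *\<^sub>R weak_gradient u x) < e"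
      by (rule Lp_pow_small_ball[OF XF_D(4)[OF UF(2)] e]) blast
    \<comment> \<open>Small enough for the absorption estimate, and such that the larger ball of
      radius \<open>T * \<delta>\<close> carries less than \<open>e\<close> of the gradient energy
      of the limit \<open>u\<close>.\<close>
    define \<delta> where "\<delta> = min \<delta>0 (\<rho>0 / T)"
    have \<delta>: "0 < \<delta>" "\<delta> \<le> \<delta>0" "T * \<delta> \<le> \<rho>0"
      using T \<rho>0(1) by (auto simp: \<delta>_def min_def field_simps)
    define Gi Go where "Gi v = norm_pow (\<lambda>x. indicator (ball 0 (T * \<delta>)) x *\<^sub>R weak_gradient v x)"
      and "Go v = norm_pow (\<lambda>x. indicator (- ball 0 (T * \<delta>)) x *\<^sub>R weak_gradient v x)" for v :: "real^'n \<Rightarrow> real"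
    define Ai Ao where "Ai v = norm_pow (\<lambda>x. indicator (ball 0 \<delta>) x *\<^sub>R (v x / norm x powr \<theta>))"
      and "Ao v = norm_pow (\<lambda>x. indicator (- ball 0 \<delta>) x *\<^sub>R (v x / norm x powr \<theta>))" for v :: "real^'n \<Rightarrow> real"
    have split: "G v = Gi v + Go v" "A v = Ai v + Ao v" if "v \<in> X" for v
      unfolding Gi_def Go_def Ai_def Ao_def A_def using that X_subset_XF
      by (intro Lp_pow_split XF_D(4) K(2); auto)+
    have ab': "\<mu> * Ai (U k) \<le> e + Gi (U k)" for k
      unfolding Ai_def Gi_def by (rule ab[OF \<delta>(1,2) UX(1) M])
    have Giu: "Gi u < e" unfolding Gi_def by (rule \<rho>0(2)[OF \<delta>(3)])
    have Go: "eventually (\<lambda>k. Go u - e \<le> Go (U k)) sequentially"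
      unfolding Go_def by (rule X_operator_lsc[OF gradient_operator U e]) auto
    have Ao: "(\<lambda>k. Ao (U k)) \<longlonglongrightarrow> Ao u"
    proof -
      have m: "(\<lambda>x::real^'n. indicator (- ball 0 \<delta>) x / norm x powr \<theta>) \<in> borel_measurable borel" by measurable
      have mb: "\<bar>indicator (- ball 0 \<delta>) x / norm x powr \<theta>\<bar> \<le> 1 / \<delta> powr \<theta>" for x :: "real^'n"
      proof (cases "norm x < \<delta>")
        case False
        then have "\<delta> powr \<theta> \<le> norm x powr \<theta>" using \<delta>(1) \<theta> by (intro powr_mono2) auto
        then show ?thesis using False \<delta>(1) by (simp add: frac_le)
      qed simp
      show ?thesis
        using Lp_conv_mult[OF XF_in_Lp[OF UF(1)] XF_in_Lp[OF UF(2)] m mb weak_convergence_Lp[OF U M0]]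
        by (simp add: Ao_def)
    qed
    then have "(\<lambda>k. \<mu> * Ao (U k)) \<longlonglongrightarrow> \<mu> * Ao u" by (intro tendsto_mult_left)
    then have "eventually (\<lambda>k. \<mu> * Ao (U k) < \<mu> * Ao u + e) sequentially"
      by (rule order_tendstoD) (use e in simp)
    then show ?thesis using gag Go
    proof eventually_elim
      case (elim k)
      \<comment> \<open>Five errors \<open>e\<close> add up: the absorption, the outer gradient
        energy, the Gagliardo energy, the outer weighted term, and the inner gradient energy
        \<open>Gi u\<close>, which has no counterpart left on the side of \<open>U k\<close>. The
        inner weighted term of \<open>u\<close> only helps.\<close>
      have "0 \<le> \<mu> * Ai u" using False by (simp add: Ai_def)
      then show ?case using elim ab'[of k] Giu unfolding split[OF UX(1)] split[OF UX(2)] distrib_left by linarith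
    qed
  qed
qed

lemma I_functional_weakly_lsc:
  assumes \<theta>: "s \<le> \<theta>" "\<theta> \<le> 1" and \<mu>: "\<mu> < mu_bar TYPE('n) p s \<theta>"
  shows "X_weakly_lsc p s \<Omega> (I_functional p s \<theta> \<Omega> \<mu>)"
  unfolding X_weakly_lsc_def
proof (intro allI impI)
  fix U u assume U: "X_weakly_converges p s \<Omega> U u"
  let ?J = "I_functional p s \<theta> \<Omega> \<mu>"
  have UX: "U k \<in> X" "u \<in> X" for k using U by (auto simp: X_weakly_converges_def)
  have \<mu>1: "\<mu> * hardy_opt TYPE('n) p < 1" if "\<theta> = 1"
  proof -
    have "0 < hardy_opt TYPE('n) p" using p by (simp add: hardy_opt_def)
    moreover have "\<mu> < hardy_const TYPE('n) p" using \<mu> that s by (simp add: mu_bar_def)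
    ultimately show ?thesis using hardy_const_opt by (metis mult_strict_right_mono)
  qed
  have main: "eventually (\<lambda>k. y < ?J (U k)) sequentially" if y: "y < ?J u" for y
  proof (rule ccontr)
    \<comment> \<open>Otherwise the functional stays at or below \<open>y\<close> along a
      subsequence. Coercivity bounds the norms of that subsequence, and it still converges weakly to
      \<open>u\<close>, so \<open>energy_lsc\<close> applies to it.\<close>
    assume "\<not> eventually (\<lambda>k. y < ?J (U k)) sequentially"
    then have "infinite {k. ?J (U k) \<le> y}"
      by (simp add: not_eventually not_less frequently_cofinite flip: cofinite_eq_sequentially)
    then obtain r :: "nat \<Rightarrow> nat" where r: "strict_mono r" "\<And>k. ?J (U (r k)) \<le> y"
      using infinite_enumerate[of "{k. ?J (U k) \<le> y}"] by auto
    have V: "X_weakly_converges p s \<Omega> (\<lambda>k. U (r k)) u"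
      using U r(1) LIMSEQ_subseq_LIMSEQ[of "\<lambda>k. _ (U k)" _ r] by (auto simp: X_weakly_converges_def o_def)
    obtain R where R: "\<And>v. v \<in> X \<Longrightarrow> R \<le> X_norm p s v \<Longrightarrow> y + 1 \<le> ?J v"
      using I_functional_coercive[OF assms] unfolding X_coercive_def by metis
    have bd: "X_norm p s (U (r k)) \<le> R" for k
      using R[OF UX(1), of "r k"] r(2)[of k] by linarith
    \<comment> \<open>Chosen so that the total loss \<open>5 * e\<close> is half of the gap
      \<open>p * (?J u - y)\<close>; the gap would then be at most half of itself.\<close>
    define e where "e = p * (?J u - y) / 10"
    have e: "0 < e" using y p by (simp add: e_def)
    have "0 \<le> \<theta>" using \<theta> s by simp
    from energy_lsc[OF this \<theta>(2) \<mu>1 V bd e]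
    obtain k where k: "G u + energy u - \<mu> * norm_pow (\<lambda>x. u x / norm x powr \<theta>) - 5 * e \<le>
       G (U (r k)) + energy (U (r k)) - \<mu> * norm_pow (\<lambda>x. U (r k) x / norm x powr \<theta>)"
      by (auto simp: eventually_sequentially)
    have pJ: "G v + energy v - \<mu> * norm_pow (\<lambda>x. v x / norm x powr \<theta>) = p * ?J v" if "v \<in> X" for v
      using p by (simp add: I_functional_eq[OF that])
    have "p * ?J u - 5 * e \<le> p * ?J (U (r k))" using k unfolding pJ[OF UX(1)] pJ[OF UX(2)] .
    moreover have "p * ?J (U (r k)) \<le> p * y" using r(2)[of k] p by (intro mult_left_mono) auto
    ultimately have "p * ?J u - p * y \<le> 5 * e" by linarith
    then have "p * (?J u - y) \<le> p * (?J u - y) / 2" unfolding e_def right_diff_distrib by simp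
    then have "p * (?J u - y) \<le> 0" by linarith
    then show False using y p by (simp add: mult_le_0_iff)
  qed
  show "ereal (?J u) \<le> liminf (\<lambda>k. ereal (?J (U k)))"
    unfolding le_Liminf_iff
  proof (intro allI impI)
    fix y assume y: "y < ereal (?J u)"
    then obtain z where z: "y < ereal z" "z < ?J u" using ereal_dense2 less_ereal.simps(1) by blast
    show "eventually (\<lambda>k. y < ereal (?J (U k))) sequentially"
      using main[OF z(2)] by eventually_elim (use z(1) in \<open>auto intro: less_trans\<close>)
  qed
qed

end

theorem lemma3p1:
  fixes \<Omega> :: "(real^'n::finite) set" and p s \<theta> \<mu> :: real
  assumes "CARD('n) \<ge> 3"
    and "0 < s" and "s < 1" and "1 < p" and "p < real CARD('n)"
    and "s \<le> \<theta>" and "\<theta> \<le> 1"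
    and "smooth_bounded_domain \<Omega>" and "0 \<in> \<Omega>"
    and "\<mu> < mu_bar TYPE('n) p s \<theta>"
  shows "X_coercive p s \<Omega> (I_functional p s \<theta> \<Omega> \<mu>) \<and>
         X_weakly_lsc p s \<Omega> (I_functional p s \<theta> \<Omega> \<mu>)"
proof -
  interpret X_setting \<Omega> p s
    using assms by unfold_locales (auto simp: smooth_bounded_domain_def)
  show ?thesis
    using I_functional_coercive I_functional_weakly_lsc assms by blast
qed

end
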